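(* Let $q_1,q_2$ be PIBQFs with topographs $T_1,T_2$ and rivers $R_1,R_2$. The intersection number $\mathrm{Int}(q_1,q_2)$ is equal to the number of ways to superimpose the topographs $T_1,T_2$ onto each other so that the rivers $R_1$ and $R_2$ meet and cross, modulo the periods of the rivers.
   Context: Forms. Write $[A,B,C]$ for the integral form $Ax^2+Bxy+Cy^2$, of discriminant $D=B^2-4AC$. A PIBQF is such a form with $\gcd(A,B,C)=1$ and $D>0$ not a perfect square. $\Gamma=\mathrm{PSL}(2,\mathbb Z)$ acts on forms (on the right) by $(\gamma\circ q)(x,y)=q(ax+by,cx+dy)$ for $\gamma=\begin{pmatrix}a&b\\c&d\end{pmatrix}$; forms in one orbit are called equivalent. The first root of $q$ is $q_f=\frac{-B+\sqrt D}{2A}$, the second is $q_s=\frac{-B-\sqrt D}{2A}$; $\ell_q$ is the oriented geodesic in the upper half plane $\mathbb H$ from $q_s$ to $q_f$. The invariant automorph is $\gamma_q=\begin{pmatrix}\frac{T-BU}{2} & -CU \\ A U & \frac{T+BU}{2}\end{pmatrix}$, with $(T,U)$ the smallest positive integer solution of $t^2-Du^2=4$; it preserves $\ell_q$, so $\ell_q$ projects to a closed geodesic $\tilde\ell_q$ in $\Gamma\backslash\mathbb H$. Intersection number. $\mathrm{Int}(q_1,q_2)$ is the (unsigned) number of transverse intersections of $\tilde\ell_{q_1}$ with $\tilde\ell_{q_2}$, counted as follows: fix any $z\in\ell_{q_2}$ and let $\dot\ell$ be the half-open segment of $\ell_{q_2}$ from $z$ (included) to $\gamma_{q_2}z$ (excluded);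 $\mathrm{Int}(q_1,q_2)$ is the number of pairs $(\ell,P)$ with $\ell$ an oriented geodesic that is a $\Gamma$-translate of $\ell_{q_1}$ and $P$ a transverse intersection point of $\ell$ with $\dot\ell$ (independent of $z$). Topograph. Let $G$ be the infinite $3$-regular tree drawn in the oriented plane. For an oriented edge $e$ pointing to a vertex $V$, let $\bar e$ be its reversal and let $\mathrm{left}(e)$ be the edge obtained by travelling along $e$ to $V$ and taking the left branch, oriented away from $V$. With $S=\begin{pmatrix}0&1\\-1&0\end{pmatrix}$ and $T=\begin{pmatrix}1&1\\0&1\end{pmatrix}$, the topograph of a form $q$ is $G$ together with the unique assignment $e\mapsto f(e)$ of forms to oriented edges such that $f(e_0)=q$ for a chosen base oriented edge $e_0$, $f(\bar e)=S\circ f(e)$ and $f(\mathrm{left}(e))=T\circ f(e)$. The forms appearing are exactly the forms equivalent to $q$, and equivalent forms give isomorphic topographs. If $f(e)=[A,B,C]$ then $A$ is the number written in the region of the plane to the left of $e$ and $C$ the number in the region to the right (this is consistent). River. For a PIBQF $q$, the river is the set of edges whose form $[A,B,C]$ satisfies $AC<0$; it is a bi-infinite path separating the regions with positive numbers from those with negative numbers, and its sequence of left/right turns is periodic. The river flows in the direction which has the positive regions on its left. Superimposing. A superimposition of $T_1,T_2$ is an identification of the underlying plane trees by an isomorphism $\varphi$ from the tree of $T_2$ to the tree of $T_1$ preserving the cyclic (planar) orientation at every vertex; it is determined by identifying an oriented edge of $T_2$ with one of $T_1$. The rivers meet and cross if $R_1$ and $\varphi(R_2)$ share a finite nonempty path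 and $\varphi(R_2)$ joins this path from one side of $R_1$ and leaves it on the other side of $R_1$. "Modulo the periods of the rivers" means that $\varphi$ is identified with $\tau_1^a\varphi\tau_2^b$ for all $a,b\in\mathbb Z$, where $\tau_i$ is the automorphism of $T_i$ (preserving planar orientation and all forms $f$) translating along $R_i$ by one least period of its left/right turn sequence. *)

theory Defs
  imports "HOL-Analysis.Analysis" "HOL-Computational_Algebra.Nth_Powers"
begin

section \<open>Indefinite binary quadratic forms\<close>

datatype bqf = BQF (coeffA: int) (coeffB: int) (coeffC: int)

fun form_value :: "bqf \<Rightarrow> int \<Rightarrow> int \<Rightarrow> int" where
  "form_value (BQF A B C) x y = A * x\<^sup>2 + B * x * y + C * y\<^sup>2"

fun discriminant :: "bqf \<Rightarrow> int" where
  "discriminant (BQF A B C) = B\<^sup>2 - 4 * A * C"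

definition pibqf :: "bqf \<Rightarrow> bool" where
  "pibqf q \<longleftrightarrow> gcd (coeffA q) (gcd (coeffB q) (coeffC q)) = 1 \<and>
     discriminant q > 0 \<and> \<not> is_square (discriminant q)"

definition mat2 :: "int \<Rightarrow> int \<Rightarrow> int \<Rightarrow> int \<Rightarrow> int^2^2" where
  "mat2 a b c d = vector [vector [a, b], vector [c, d]]"

text \<open>The group PSL(2,Z) enters only through actions in which a matrix and its negative act
  equally, so its elements are represented by matrices in SL(2,Z).\<close>

definition SL2Z :: "(int^2^2) set" where
  "SL2Z = {g. det g = 1}"

fun act :: "int^2^2 \<Rightarrow> bqf \<Rightarrow> bqf" where
  "act g (BQF A B C) = (let a = g$1$1; b = g$1$2; c = g$2$1; d = g$2$2 in
     BQF (A * a\<^sup>2 + B * a * c + C * c\<^sup>2)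
         (2 * A * a * b + B * (a * d + b * c) + 2 * C * c * d)
         (A * b\<^sup>2 + B * b * d + C * d\<^sup>2))"

lemma form_value_act:
  "form_value (act g q) x y =
     form_value q (g$1$1 * x + g$1$2 * y) (g$2$1 * x + g$2$2 * y)"
  by (cases q) (simp add: Let_def power2_eq_square algebra_simps)

definition Smat :: "int^2^2" where "Smat = mat2 0 1 (-1) 0"
definition Tmat :: "int^2^2" where "Tmat = mat2 1 1 0 1"

definition first_root :: "bqf \<Rightarrow> real" where
  "first_root q = (- of_int (coeffB q) + sqrt (of_int (discriminant q))) / (2 * of_int (coeffA q))"

definition second_root :: "bqf \<Rightarrow> real" where
  "second_root q = (- of_int (coeffB q) - sqrt (of_int (discriminant q))) / (2 * of_int (coeffA q))"

definition least_pell :: "int \<Rightarrow> int \<times> int" where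
  "least_pell D = (THE (t, u). t > 0 \<and> u > 0 \<and> t\<^sup>2 - D * u\<^sup>2 = 4 \<and>
     (\<forall>t' u'. t' > 0 \<and> u' > 0 \<and> t'\<^sup>2 - D * u'\<^sup>2 = 4 \<longrightarrow> t \<le> t' \<and> u \<le> u'))"

text \<open>The divisions by 2 are exact: \<open>t\<^sup>2 - (B\<^sup>2 - 4AC) u\<^sup>2 = 4\<close> forces \<open>t\<close> and \<open>B u\<close> to have
  the same parity.\<close>

definition automorph :: "bqf \<Rightarrow> int^2^2" where
  "automorph q = (let (t, u) = least_pell (discriminant q) in
     mat2 ((t - coeffB q * u) div 2) (- coeffC q * u)
          (coeffA q * u) ((t + coeffB q * u) div 2))"


section \<open>Geodesics and intersection numbers\<close>

definition mobius :: "int^2^2 \<Rightarrow> 'a::field \<Rightarrow> 'a" where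
  "mobius g = moebius (of_int (g$1$1)) (of_int (g$1$2)) (of_int (g$2$1)) (of_int (g$2$2))"

text \<open>An oriented geodesic of the upper half plane is given by its ordered pair of endpoints on
  the boundary. The translates of \<open>\<ell>\<^sub>q\<close> have irrational endpoints, so only half circles occur,
  the point at infinity is not needed, and Moebius maps act on the endpoints without zero
  denominators.\<close>

type_synonym geodesic = "real \<times> real"

definition geod :: "bqf \<Rightarrow> geodesic" where
  "geod q = (second_root q, first_root q)"

definition centre :: "geodesic \<Rightarrow> real" where
  "centre l = (fst l + snd l) / 2"

definition points :: "geodesic \<Rightarrow> complex set" where
  "points l = {z. Im z > 0 \<and> dist z (of_real (centre l)) = \<bar>snd l - fst l\<bar> / 2}"

definition translates :: "geodesic \<Rightarrow> geodesic set" where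
  "translates l = {(mobius g (fst l), mobius g (snd l)) |g. g \<in> SL2Z}"

text \<open>The tangent line of a circle at \<open>P\<close> is spanned by \<open>\<i> (P - m)\<close>, where \<open>m\<close> is the centre.\<close>

definition tangent :: "geodesic \<Rightarrow> complex \<Rightarrow> complex" where
  "tangent l P = \<i> * (P - of_real (centre l))"

definition transverse_at :: "geodesic \<Rightarrow> geodesic \<Rightarrow> complex \<Rightarrow> bool" where
  "transverse_at l l' P \<longleftrightarrow> P \<in> points l \<and> P \<in> points l' \<and>
     \<not> collinear {0, tangent l P, tangent l' P}"

text \<open>The real part is a monotone parameter of a half circle with real centre, so it determines
  which points lie between two given ones.\<close>

definition half_open_segment :: "geodesic \<Rightarrow> complex \<Rightarrow> complex \<Rightarrow> complex set" where
  "half_open_segment l z w = {P \<in> points l. Re P \<in> closed_segment (Re z) (Re w) \<and> P \<noteq> w}"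

definition intersections :: "bqf \<Rightarrow> bqf \<Rightarrow> complex \<Rightarrow> (geodesic \<times> complex) set" where
  "intersections q1 q2 z = {(l, P). l \<in> translates (geod q1) \<and>
     P \<in> half_open_segment (geod q2) z (mobius (automorph q2) z) \<and>
     transverse_at l (geod q2) P}"

definition intersection_number :: "bqf \<Rightarrow> bqf \<Rightarrow> complex \<Rightarrow> nat" where
  "intersection_number q1 q2 z = card (intersections q1 q2 z)"


section \<open>Planar 3-regular trees\<close>

text \<open>The drawing in the oriented plane is recorded by the cyclic order of the neighbours of each
  vertex: \<open>cw G v u\<close> is the neighbour of \<open>v\<close> that follows \<open>u\<close> clockwise around \<open>v\<close>.
  An oriented edge is a pair of adjacent vertices.\<close>

record 'v plane_graph =
  adj :: "'v \<Rightarrow> 'v \<Rightarrow> bool"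
  cw :: "'v \<Rightarrow> 'v \<Rightarrow> 'v"

definition plane_cubic_tree :: "('v, 'm) plane_graph_scheme \<Rightarrow> bool" where
  "plane_cubic_tree G \<longleftrightarrow>
     (\<forall>u v. adj G u v \<longrightarrow> u \<noteq> v \<and> adj G v u) \<and>
     (\<forall>u v. (adj G)\<^sup>*\<^sup>* u v) \<and>
     \<not> (\<exists>p. length p \<ge> 3 \<and> distinct p \<and> successively (adj G) p \<and> adj G (last p) (hd p)) \<and>
     (\<forall>v. card {u. adj G v u} = 3) \<and>
     (\<forall>v u. adj G v u \<longrightarrow> adj G v (cw G v u) \<and> cw G v u \<noteq> u \<and>
        cw G v (cw G v (cw G v u)) = u)"

definition oriented_edges :: "('v, 'm) plane_graph_scheme \<Rightarrow> ('v \<times> 'v) set" where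
  "oriented_edges G = {(u, v). adj G u v}"

text \<open>Seen from a traveller arriving at \<open>v\<close> from \<open>u\<close>, the clockwise successor of \<open>u\<close> is on the
  left, and the next one is on the right.\<close>

fun left :: "('v, 'm) plane_graph_scheme \<Rightarrow> 'v \<times> 'v \<Rightarrow> 'v \<times> 'v" where
  "left G (u, v) = (v, cw G v u)"

fun right :: "('v, 'm) plane_graph_scheme \<Rightarrow> 'v \<times> 'v \<Rightarrow> 'v \<times> 'v" where
  "right G (u, v) = (v, cw G v (cw G v u))"

definition plane_iso ::
  "('v, 'm) plane_graph_scheme \<Rightarrow> ('w, 'n) plane_graph_scheme \<Rightarrow> ('v \<Rightarrow> 'w) \<Rightarrow> bool" where
  "plane_iso G H \<phi> \<longleftrightarrow> bij \<phi> \<and> (\<forall>u v. adj H (\<phi> u) (\<phi> v) \<longleftrightarrow> adj G u v) \<and>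
     (\<forall>u v. adj G v u \<longrightarrow> \<phi> (cw G v u) = cw H (\<phi> v) (\<phi> u))"


section \<open>Topographs and rivers\<close>

record 'v topograph = "'v plane_graph" +
  form_at :: "'v \<times> 'v \<Rightarrow> bqf"

definition topograph_of :: "bqf \<Rightarrow> 'v topograph \<Rightarrow> bool" where
  "topograph_of q T \<longleftrightarrow> plane_cubic_tree T \<and>
     (\<exists>e0\<in>oriented_edges T. form_at T e0 = q) \<and>
     (\<forall>e\<in>oriented_edges T. form_at T (prod.swap e) = act Smat (form_at T e) \<and>
        form_at T (left T e) = act Tmat (form_at T e))"

text \<open>The river contains both orientations of each of its edges; \<open>river_flow\<close> selects the
  downstream one, which has the region with the positive number \<open>A\<close> on its left.\<close>

definition river :: "'v topograph \<Rightarrow> ('v \<times> 'v) set" where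
  "river T = {e \<in> oriented_edges T. coeffA (form_at T e) * coeffC (form_at T e) < 0}"

definition river_flow :: "'v topograph \<Rightarrow> ('v \<times> 'v) set" where
  "river_flow T = {e \<in> river T. coeffA (form_at T e) > 0}"

definition turns_left :: "'v topograph \<Rightarrow> 'v \<times> 'v \<Rightarrow> bool" where
  "turns_left T e \<longleftrightarrow> left T e \<in> river T"

definition downstream :: "'v topograph \<Rightarrow> 'v \<times> 'v \<Rightarrow> 'v \<times> 'v" where
  "downstream T e = (if turns_left T e then left T e else right T e)"

definition river_period :: "'v topograph \<Rightarrow> nat" where
  "river_period T = (LEAST n. n > 0 \<and>
     (\<forall>e\<in>river_flow T. turns_left T ((downstream T ^^ n) e) \<longleftrightarrow> turns_left T e))"

definition river_shift :: "'v topograph \<Rightarrow> 'v \<Rightarrow> 'v" where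
  "river_shift T = (THE \<tau>. plane_iso T T \<tau> \<and>
     (\<forall>e\<in>oriented_edges T. form_at T (map_prod \<tau> \<tau> e) = form_at T e) \<and>
     (\<forall>e\<in>river_flow T. map_prod \<tau> \<tau> e = (downstream T ^^ river_period T) e))"


section \<open>Superimpositions\<close>

definition left_bank :: "'v topograph \<Rightarrow> 'v \<Rightarrow> 'v \<Rightarrow> bool" where
  "left_bank T v u \<longleftrightarrow> (\<exists>e\<in>river_flow T. left T e = (v, u) \<and> (v, u) \<notin> river T)"

definition right_bank :: "'v topograph \<Rightarrow> 'v \<Rightarrow> 'v \<Rightarrow> bool" where
  "right_bank T v u \<longleftrightarrow> (\<exists>e\<in>river_flow T. right T e = (v, u) \<and> (v, u) \<notin> river T)"

text \<open>The list \<open>p\<close> consists of the successive vertices of the path shared by the two rivers, in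
  the order in which the image of the second river runs through them. That river enters this path
  from \<open>u\<close> and leaves it to \<open>w\<close>.\<close>

definition rivers_cross :: "'v topograph \<Rightarrow> 'w topograph \<Rightarrow> ('w \<Rightarrow> 'v) \<Rightarrow> bool" where
  "rivers_cross T1 T2 \<phi> \<longleftrightarrow> (let S = map_prod \<phi> \<phi> ` river_flow T2 in
     \<exists>u p w. p \<noteq> [] \<and> set (zip p (tl p)) = S \<inter> river T1 \<and>
       (u, hd p) \<in> S \<and> (last p, w) \<in> S \<and>
       (left_bank T1 (hd p) u \<and> right_bank T1 (last p) w \<or>
        right_bank T1 (hd p) u \<and> left_bank T1 (last p) w))"

definition crossing_superimpositions :: "'v topograph \<Rightarrow> 'w topograph \<Rightarrow> ('w \<Rightarrow> 'v) set" where
  "crossing_superimpositions T1 T2 = {\<phi>. plane_iso T2 T1 \<phi> \<and> rivers_cross T1 T2 \<phi>}"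

definition iterate :: "('a \<Rightarrow> 'a) \<Rightarrow> int \<Rightarrow> 'a \<Rightarrow> 'a" where
  "iterate f k = (if k \<ge> 0 then f ^^ nat k else inv f ^^ nat (- k))"

definition period_equiv :: "'v topograph \<Rightarrow> 'w topograph \<Rightarrow> (('w \<Rightarrow> 'v) \<times> ('w \<Rightarrow> 'v)) set" where
  "period_equiv T1 T2 = {(\<phi>, \<psi>). \<phi> \<in> crossing_superimpositions T1 T2 \<and>
     \<psi> \<in> crossing_superimpositions T1 T2 \<and>
     (\<exists>a b. \<psi> = iterate (river_shift T1) a \<circ> \<phi> \<circ> iterate (river_shift T2) b)}"

definition crossing_classes :: "'v topograph \<Rightarrow> 'w topograph \<Rightarrow> ('w \<Rightarrow> 'v) set set" where
  "crossing_classes T1 T2 = crossing_superimpositions T1 T2 // period_equiv T1 T2"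

end

theory Submission
  imports Defs
begin

text \<open>An isomorphism of the tree of \<open>T\<^sub>2\<close> onto that of \<open>T\<^sub>1\<close> amounts to the form that \<open>T\<^sub>1\<close> puts on
  the base edge of \<open>T\<^sub>2\<close>, taken up to the period of \<open>T\<^sub>1\<close>, and every form \<open>p\<close> equivalent to \<open>q\<^sub>1\<close>
  arises. Both labellings of the tree change by the same matrix along a path, so the signs of the
  first form at the two roots of the second are the same on all edges. Far along the river of
  \<open>T\<^sub>2\<close> these are the signs of the regions of \<open>T\<^sub>1\<close> that it runs in, downstream for the first root
  and upstream for the second. Hence the rivers cross if and only if \<open>p\<close> has opposite signs at the
  roots of \<open>q\<^sub>2\<close>, that is, if and only if the geodesic of \<open>p\<close> crosses that of \<open>q\<^sub>2\<close>.
  Translating along the river of \<open>T\<^sub>2\<close> lets the stabiliser of \<open>q\<^sub>2\<close> act on \<open>p\<close>. By the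
  theory of the Pell equation the automorph generates this stabiliser up to sign, and it multiplies a
  parameter of the geodesic of \<open>q\<^sub>2\<close> by a constant greater than 1. So each class of crossing
  superimpositions has exactly one form whose geodesic meets the given half-open segment.\<close>

section \<open>Forms, matrices and roots\<close>

text \<open>The trees are arbitrary, so there is no model to compute in: isomorphisms have to be
  built from codes of vertices by walks. Statements about the upstream direction are downstream
  statements for the negated forms, since negation keeps the river, reverses its flow and exchanges
  the two roots. Two descriptions by \<open>THE\<close> have to be met. The shift of a river is
  specified by the period of its turns but must preserve the forms, so a period of the turns has to
  be shown to be one of the forms. The least solution of the Pell equation presupposes some
  solution; it comes from the matrix along one period of the river, which stabilises a form without
  being scalar. That opposite signs make the rivers meet at all is a descent along one river.
  Finiteness comes from the rivers too: a crossing superimposition lays two river edges onto each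
  other, and rivers carry only finitely many forms.\<close>

lemma mat2_nth [simp]:
  "mat2 a b c d $ 1 $ 1 = a" "mat2 a b c d $ 1 $ 2 = b"
  "mat2 a b c d $ 2 $ 1 = c" "mat2 a b c d $ 2 $ 2 = d"
  by (simp_all add: mat2_def)

lemma mat2_eqI:
  fixes g h :: "int^2^2"
  assumes "g$1$1 = h$1$1" "g$1$2 = h$1$2" "g$2$1 = h$2$1" "g$2$2 = h$2$2"
  shows "g = h"
  using assms by (simp add: vec_eq_iff forall_2)

lemma matmul_nth [simp]:
  fixes g h :: "int^2^2"
  shows "(g ** h)$i$j = g$i$1 * h$1$j + g$i$2 * h$2$j"
  by (simp add: matrix_matrix_mult_def sum_2)

lemma mat1_nth [simp]:
  "(mat 1 :: int^2^2)$1$1 = 1" "(mat 1 :: int^2^2)$1$2 = 0"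
  "(mat 1 :: int^2^2)$2$1 = 0" "(mat 1 :: int^2^2)$2$2 = 1"
  by (simp_all add: mat_def)

lemma SL2Z_iff: "g \<in> SL2Z \<longleftrightarrow> g$1$1 * g$2$2 - g$1$2 * g$2$1 = 1"
  by (simp add: SL2Z_def det_2)

lemma mat1_SL2Z [simp]: "mat 1 \<in> SL2Z"
  by (simp add: SL2Z_iff)

lemma Smat_SL2Z [simp]: "Smat \<in> SL2Z" and Tmat_SL2Z [simp]: "Tmat \<in> SL2Z"
  by (simp_all add: SL2Z_iff Smat_def Tmat_def)

lemma matmul_SL2Z [simp]: "g \<in> SL2Z \<Longrightarrow> h \<in> SL2Z \<Longrightarrow> g ** h \<in> SL2Z"
  by (simp add: SL2Z_def det_mul)

definition sinv :: "int^2^2 \<Rightarrow> int^2^2" where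
  "sinv g = mat2 (g$2$2) (- g$1$2) (- g$2$1) (g$1$1)"

lemma sinv_SL2Z [simp]: "g \<in> SL2Z \<Longrightarrow> sinv g \<in> SL2Z"
  by (simp add: SL2Z_iff sinv_def algebra_simps)

lemma sinv_left [simp]: "g \<in> SL2Z \<Longrightarrow> sinv g ** g = mat 1"
  and sinv_right [simp]: "g \<in> SL2Z \<Longrightarrow> g ** sinv g = mat 1"
  by (rule mat2_eqI; simp add: SL2Z_iff sinv_def algebra_simps)+

lemma act_mult: "act (g ** h) q = act h (act g q)"
  by (cases q) (simp add: Let_def power2_eq_square algebra_simps)

lemma act_one [simp]: "act (mat 1) q = q"
  by (cases q) (simp add: Let_def)

lemma act_sinv [simp]:
  assumes "g \<in> SL2Z"
  shows "act g (act (sinv g) q) = q" "act (sinv g) (act g q) = q"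
  using assms by (simp_all flip: act_mult)

lemma act_S [simp]: "act Smat (BQF A B C) = BQF C (- B) A"
  and act_T [simp]: "act Tmat (BQF A B C) = BQF A (2 * A + B) (A + B + C)"
  by (simp_all add: Smat_def Tmat_def Let_def)

fun neg :: "bqf \<Rightarrow> bqf" where
  "neg (BQF A B C) = BQF (- A) (- B) (- C)"

lemma act_neg: "act g (neg q) = neg (act g q)"
  by (cases q) (simp add: Let_def algebra_simps)

lemma coeff_neg [simp]:
  "coeffA (neg q) = - coeffA q" "coeffB (neg q) = - coeffB q" "coeffC (neg q) = - coeffC q"
  by (cases q; simp)+

lemma discriminant_neg [simp]: "discriminant (neg q) = discriminant q"
  by (cases q) simp

lemma discriminant_coeffs: "discriminant q = (coeffB q)\<^sup>2 - 4 * coeffA q * coeffC q"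
  by (cases q) simp

lemma discriminant_act [simp]:
  assumes "g \<in> SL2Z"
  shows "discriminant (act g q) = discriminant q"
proof -
  obtain A B C where q: "q = BQF A B C" by (cases q)
  have "discriminant (act g q) = (g$1$1 * g$2$2 - g$1$2 * g$2$1)\<^sup>2 * discriminant q"
    unfolding q by (simp add: Let_def power2_eq_square algebra_simps)
  then show ?thesis using assms by (simp add: SL2Z_iff)
qed

section \<open>Nonsquare discriminants and irrational roots\<close>

definition indef :: "int \<Rightarrow> bool" where
  "indef D \<longleftrightarrow> D > 0 \<and> \<not> is_square D"

lemma pibqf_indef: "pibqf q \<Longrightarrow> indef (discriminant q)"
  by (simp add: pibqf_def indef_def)

text \<open>A nonzero \<open>y\<close> would divide \<open>x\<close>, since its square divides that
  of \<open>x\<close>, and \<open>D\<close> would be the square of the quotient.\<close>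

lemma indef_square:
  assumes "indef D" "(x::int)\<^sup>2 = D * y\<^sup>2"
  shows "x = 0 \<and> y = 0"
proof (cases "y = 0")
  case False
  have "y\<^sup>2 dvd x\<^sup>2" using assms(2) by simp
  then have "y dvd x" by simp
  then obtain k where "x = y * k" by (auto simp: dvd_def)
  then have "D = k\<^sup>2" using assms(2) False by (simp add: power_mult_distrib)
  then show ?thesis using assms(1) by (auto simp: indef_def is_nth_power_def)
qed (use assms in auto)

lemma indef_irrational:
  assumes "indef D" "of_int x + of_int y * sqrt (of_int D) = (0::real)"
  shows "x = 0 \<and> y = 0"
proof -
  have "(of_int x)\<^sup>2 = (of_int y * sqrt (of_int D))\<^sup>2"
    using assms(2) by (metis add_eq_0_iff power2_minus)
  then have "(of_int x :: real)\<^sup>2 = of_int (D * y\<^sup>2)"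
    using assms(1) by (simp add: power_mult_distrib indef_def)
  then have "x\<^sup>2 = D * y\<^sup>2"
    by (metis of_int_eq_iff of_int_power)
  then show ?thesis using indef_square assms(1) by blast
qed

text \<open>A vanishing outer coefficient would leave the square of the middle one as discriminant.
  So no region of a topograph carries 0, and signs are always decided.\<close>

lemma indef_coeff_nonzero:
  assumes "indef (discriminant q)"
  shows "coeffA q \<noteq> 0" "coeffC q \<noteq> 0"
proof -
  have "(coeffB q)\<^sup>2 \<noteq> discriminant q * 1\<^sup>2"
    using indef_square[OF assms, of "coeffB q" 1] by auto
  then show "coeffA q \<noteq> 0" "coeffC q \<noteq> 0" by (auto simp: discriminant_coeffs)
qed

definition rval :: "bqf \<Rightarrow> real \<Rightarrow> real" where
  "rval q x = of_int (coeffA q) * x\<^sup>2 + of_int (coeffB q) * x + of_int (coeffC q)"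

lemma rval_neg [simp]: "rval (neg q) x = - rval q x"
  by (simp add: rval_def)

text \<open>This is the derivative of the polynomial at its roots. Its sign tells the first root
  from the second, also when \<open>coeffA q\<close> is negative and the order of the two on the
  line is reversed.\<close>

lemma sqrt_disc:
  assumes "indef (discriminant q)"
  shows "2 * of_int (coeffA q) * first_root q + of_int (coeffB q) = sqrt (of_int (discriminant q))"
    "2 * of_int (coeffA q) * second_root q + of_int (coeffB q) = - sqrt (of_int (discriminant q))"
  using indef_coeff_nonzero[OF assms] by (simp_all add: first_root_def second_root_def)

lemma rval_factor:
  assumes "indef (discriminant q)"
  shows "rval q x = of_int (coeffA q) * (x - first_root q) * (x - second_root q)"
proof -
  let ?A = "of_int (coeffA q) :: real" and ?B = "of_int (coeffB q) :: real"
  let ?D = "of_int (discriminant q) :: real"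
  have A: "?A \<noteq> 0" using indef_coeff_nonzero[OF assms] by simp
  have D: "?D > 0" using assms by (simp add: indef_def)
  have "4 * ?A * rval q x = (2 * ?A * x + ?B)\<^sup>2 - ?D"
    by (simp add: rval_def discriminant_coeffs power2_eq_square algebra_simps)
  also have "\<dots> = (2 * ?A * x + ?B)\<^sup>2 - (sqrt ?D)\<^sup>2" using D by simp
  also have "\<dots> = (2 * ?A * x + ?B - sqrt ?D) * (2 * ?A * x + ?B - (- sqrt ?D))"
    by (simp add: power2_eq_square algebra_simps)
  also have "\<dots> = 4 * ?A * (?A * (x - first_root q) * (x - second_root q))"
    unfolding sqrt_disc(2)[OF assms, symmetric] unfolding sqrt_disc(1)[OF assms, symmetric]
    by (simp add: algebra_simps)
  finally show ?thesis using A by simp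
qed

lemma root_iff:
  assumes "indef (discriminant q)"
  shows "rval q x = 0 \<longleftrightarrow> x = first_root q \<or> x = second_root q"
  using indef_coeff_nonzero[OF assms] by (simp add: rval_factor[OF assms])

lemma roots_distinct:
  assumes "indef (discriminant q)"
  shows "first_root q \<noteq> second_root q"
  using sqrt_disc[OF assms] assms by (auto simp: indef_def)

lemma first_root_neg [simp]: "first_root (neg q) = second_root q"
  and second_root_neg [simp]: "second_root (neg q) = first_root q"
  by (simp_all add: first_root_def second_root_def divide_simps)

text \<open>After multiplication by \<open>2 * coeffA q\<close>, a zero would be an integral linear
  relation between 1 and the square root of the discriminant, which are independent.\<close>

lemma root_denominator:
  assumes "indef (discriminant q)" "x = first_root q \<or> x = second_root q" "c \<noteq> 0 \<or> d \<noteq> 0"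
  shows "of_int c * x + of_int d \<noteq> 0"
proof
  assume *: "of_int c * x + of_int d = 0"
  let ?A = "of_int (coeffA q) :: real" and ?s = "sqrt (of_int (discriminant q))"
  have "of_int (2 * coeffA q * d - c * coeffB q) + of_int c * ?s = 0
    \<or> of_int (2 * coeffA q * d - c * coeffB q) + of_int (- c) * ?s = 0"
  proof -
    have "2 * ?A * x + of_int (coeffB q) = ?s \<or> 2 * ?A * x + of_int (coeffB q) = - ?s"
      using assms sqrt_disc by blast
    moreover have "of_int (2 * coeffA q * d - c * coeffB q) =
        2 * ?A * (of_int c * x + of_int d) - of_int c * (2 * ?A * x + of_int (coeffB q))"
      by (simp add: algebra_simps)
    ultimately show ?thesis using * by auto
  qed
  then have "c = 0 \<and> 2 * coeffA q * d - c * coeffB q = 0"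
    using indef_irrational[OF assms(1)] by (metis neg_equal_0_iff_equal)
  then show False using assms(3) indef_coeff_nonzero[OF assms(1)] by auto
qed

lemma SL2Z_row2: "g \<in> SL2Z \<Longrightarrow> g$2$1 \<noteq> 0 \<or> g$2$2 \<noteq> 0"
  by (auto simp: SL2Z_iff)

section \<open>Moebius maps acting on values and roots\<close>

lemma rval_act:
  assumes "of_int (g$2$1) * x + of_int (g$2$2) \<noteq> 0"
  shows "rval (act g q) x = (of_int (g$2$1) * x + of_int (g$2$2))\<^sup>2 * rval q (mobius g x)"
proof -
  obtain A B C where q: "q = BQF A B C" by (cases q)
  have *: "w\<^sup>2 * (A * (n / w)\<^sup>2 + B * (n / w) + C) = A * n\<^sup>2 + B * n * w + C * w\<^sup>2"
    if "w \<noteq> 0" for A B C n w :: real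
    using that by (simp add: field_simps power2_eq_square)
  show ?thesis
    unfolding q mobius_def moebius_def rval_def bqf.sel
    apply (subst *[OF assms])
    apply (simp add: Let_def power2_eq_square algebra_simps)
    done
qed

text \<open>It is not enough that roots go to roots; first must go to first. The derivative at a
  root decides this, and it is unchanged because the determinant is 1.\<close>

lemma root_act:
  assumes q: "indef (discriminant q)" and g: "g \<in> SL2Z"
  shows "mobius g (first_root (act g q)) = first_root q"
    "mobius g (second_root (act g q)) = second_root q"
proof -
  have q': "indef (discriminant (act g q))" using q g by simp
  have deriv: "2 * of_int (coeffA q) * mobius g x + of_int (coeffB q)
      = 2 * of_int (coeffA (act g q)) * x + of_int (coeffB (act g q))"
    if "x = first_root (act g q) \<or> x = second_root (act g q)" for x
  proof -
    obtain A B C where eq: "q = BQF A B C" by (cases q)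
    let ?a = "of_int (g$1$1) :: real" and ?b = "of_int (g$1$2) :: real"
    let ?c = "of_int (g$2$1) :: real" and ?d = "of_int (g$2$2) :: real"
    let ?A = "of_int A :: real" and ?B = "of_int B :: real" and ?C = "of_int C :: real"
    have w: "?c * x + ?d \<noteq> 0" using root_denominator[OF q' that] SL2Z_row2[OF g] by simp
    have det: "?a * ?d - ?b * ?c = 1"
      using arg_cong[OF g[unfolded SL2Z_iff], of "of_int :: int \<Rightarrow> real"] by simp
    have "rval (act g q) x = 0" using root_iff[OF q'] that by blast
    then have r: "?A * (?a * x + ?b)\<^sup>2 + ?B * (?a * x + ?b) * (?c * x + ?d) + ?C * (?c * x + ?d)\<^sup>2 = 0"
      by (simp add: eq rval_def Let_def power2_eq_square algebra_simps)
    \<comment> \<open>The subtracted term is \<open>2 * ?c\<close> times the transformed form at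
      \<open>x\<close>, which vanishes at a root.\<close>
    have "(2 * ?A * (?a * x + ?b) + ?B * (?c * x + ?d)) * (?a * ?d - ?b * ?c)
       = (?c * x + ?d) * (2 * of_int (coeffA (act g q)) * x + of_int (coeffB (act g q)))
        - 2 * ?c * (?A * (?a * x + ?b)\<^sup>2 + ?B * (?a * x + ?b) * (?c * x + ?d) + ?C * (?c * x + ?d)\<^sup>2)"
      by (simp add: eq Let_def power2_eq_square algebra_simps)
    then have *: "2 * ?A * (?a * x + ?b) + ?B * (?c * x + ?d) =
       (?c * x + ?d) * (2 * of_int (coeffA (act g q)) * x + of_int (coeffB (act g q)))"
      using r det by simp
    have "2 * ?A * mobius g x + ?B = (2 * ?A * (?a * x + ?b) + ?B * (?c * x + ?d)) / (?c * x + ?d)"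
      using w by (simp add: mobius_def moebius_def field_simps)
    also have "\<dots> = 2 * of_int (coeffA (act g q)) * x + of_int (coeffB (act g q))"
      using w unfolding * by simp
    finally show ?thesis by (simp add: eq)
  qed
  have A: "of_int (coeffA q) \<noteq> (0::real)" using indef_coeff_nonzero[OF q] by simp
  show "mobius g (first_root (act g q)) = first_root q"
    using deriv[of "first_root (act g q)"] sqrt_disc[OF q] sqrt_disc[OF q'] A g
    by (simp add: first_root_def field_simps)
  show "mobius g (second_root (act g q)) = second_root q"
    using deriv[of "second_root (act g q)"] sqrt_disc[OF q] sqrt_disc[OF q'] A g
    by (simp add: second_root_def field_simps)
qed

text \<open>Values change by the square of a nonzero denominator, so their signs are invariant;
  signs are all that crossing depends on.\<close>

lemma rval_root_act:
  assumes q: "indef (discriminant q)" and g: "g \<in> SL2Z"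
  shows "sgn (rval (act g q1) (first_root (act g q))) = sgn (rval q1 (first_root q))"
    "sgn (rval (act g q1) (second_root (act g q))) = sgn (rval q1 (second_root q))"
proof -
  have q': "indef (discriminant (act g q))" using q g by simp
  have w: "of_int (g$2$1) * x + of_int (g$2$2) \<noteq> 0"
    if "x = first_root (act g q) \<or> x = second_root (act g q)" for x
    using root_denominator[OF q' that] SL2Z_row2[OF g] by simp
  have "sgn (y\<^sup>2 * x) = sgn x" if "y \<noteq> 0" for x y :: real
    using that by (auto simp: sgn_real_def zero_less_mult_iff)
  then show "sgn (rval (act g q1) (first_root (act g q))) = sgn (rval q1 (first_root q))"
    "sgn (rval (act g q1) (second_root (act g q))) = sgn (rval q1 (second_root q))"
    using w root_act[OF q g] by (simp_all add: rval_act)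
qed

text \<open>The difference of the ordered roots gives the leading coefficient, the derivative at a
  root the middle one, the discriminant the last. Exchanged roots belong to the negative
  form.\<close>

lemma roots_inj:
  assumes "indef (discriminant p)" "discriminant p = discriminant q"
    "first_root p = first_root q" "second_root p = second_root q"
  shows "p = q"
proof -
  let ?s = "sqrt (of_int (discriminant p))"
  have q: "indef (discriminant q)" using assms by simp
  have "first_root p \<noteq> second_root p" using roots_distinct assms by blast
  moreover have "of_int (coeffA p) * (first_root p - second_root p) = ?s"
    using sqrt_disc[OF assms(1)] by (simp add: algebra_simps)
  moreover have "of_int (coeffA q) * (first_root p - second_root p) = ?s"
    using sqrt_disc[OF q] assms by (simp add: algebra_simps)
  ultimately have A: "coeffA p = coeffA q"
    by (metis mult_cancel_right of_int_eq_iff right_minus_eq)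
  have "of_int (coeffB p) = (of_int (coeffB q)::real)"
    using sqrt_disc(1)[OF assms(1)] sqrt_disc(1)[OF q] A assms by simp
  then have B: "coeffB p = coeffB q" by simp
  have "coeffC p = coeffC q"
    using assms(2) A B indef_coeff_nonzero[OF assms(1)] by (simp add: discriminant_coeffs)
  then show ?thesis using A B by (cases p; cases q) simp
qed

subsection \<open>Stabilisers\<close>

text \<open>The equations say that \<open>q\<close> is proportional to the form
  \<open>[c, d - a, -b]\<close>, whose roots are the fixed points of the matrix with rows
  \<open>a b\<close> and \<open>c d\<close>.\<close>

lemma stabiliser_eqs:
  assumes "g \<in> SL2Z" "act g q = q"
  shows "coeffB q * g$2$1 = coeffA q * (g$2$2 - g$1$1)"
    "coeffA q * g$1$2 = - (coeffC q * g$2$1)"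
    "coeffB q * g$1$2 = coeffC q * (g$1$1 - g$2$2)"
proof -
  obtain A B C where q: "q = BQF A B C" by (cases q)
  obtain a b c d where abcd: "g$1$1 = a" "g$1$2 = b" "g$2$1 = c" "g$2$2 = d" by blast
  have det: "a * d - b * c = 1" using assms(1) abcd by (simp add: SL2Z_iff)
  have e: "A * a\<^sup>2 + B * a * c + C * c\<^sup>2 = A"
    "2 * A * a * b + B * (a * d + b * c) + 2 * C * c * d = B"
    "A * b\<^sup>2 + B * b * d + C * d\<^sup>2 = C"
    using assms(2) by (simp_all add: q abcd Let_def)
  let ?e1 = "A * a\<^sup>2 + B * a * c + C * c\<^sup>2"
  let ?e2 = "2 * A * a * b + B * (a * d + b * c) + 2 * C * c * d"
  let ?e3 = "A * b\<^sup>2 + B * b * d + C * d\<^sup>2"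
  \<comment> \<open>Multiplying by the inverse of \<open>g\<close> turns the quadratic conditions
    into linear ones.\<close>
  have "2 * d * ?e1 - c * ?e2 = (2 * A * a + B * c) * (a * d - b * c)"
    "d * ?e2 - 2 * c * ?e3 = (2 * A * b + B * d) * (a * d - b * c)"
    "2 * a * ?e3 - b * ?e2 = (2 * C * d + B * b) * (a * d - b * c)"
    by (simp_all add: power2_eq_square algebra_simps)
  then have "2 * d * A - c * B = 2 * A * a + B * c" "d * B - 2 * c * C = 2 * A * b + B * d"
    "2 * a * C - b * B = 2 * C * d + B * b"
    unfolding e det by simp_all
  then have "B * c = A * (d - a)" "A * b = - (C * c)" "B * b = C * (a - d)"
    by (simp_all add: algebra_simps)
  then show "coeffB q * g$2$1 = coeffA q * (g$2$2 - g$1$1)"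
    "coeffA q * g$1$2 = - (coeffC q * g$2$1)"
    "coeffB q * g$1$2 = coeffC q * (g$1$1 - g$2$2)"
    by (simp_all add: q abcd)
qed

lemma stabiliser_intro:
  assumes "g \<in> SL2Z" "coeffA q \<noteq> 0" "coeffB q * g$2$1 = coeffA q * (g$2$2 - g$1$1)"
    "coeffA q * g$1$2 = - (coeffC q * g$2$1)"
  shows "act g q = q"
proof -
  obtain A B C where q: "q = BQF A B C" by (cases q)
  obtain a b c d where abcd: "g$1$1 = a" "g$1$2 = b" "g$2$1 = c" "g$2$2 = d" by blast
  have det: "a * d - b * c = 1" using assms(1) abcd by (simp add: SL2Z_iff)
  have e: "B * c = A * (d - a)" "A * b = - (C * c)" "A \<noteq> 0"
    using assms by (simp_all add: q abcd)
  have 3: "B * b = C * (a - d)"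
  proof -
    have "A * (B * b) = B * (A * b)" by simp
    also have "\<dots> = - C * (B * c)" unfolding e(2) by simp
    also have "\<dots> = A * (C * (a - d))" unfolding e by (simp add: algebra_simps)
    finally show ?thesis using e(3) by simp
  qed
  have f: "C * c = - (A * b)" "A * a + B * c = A * d" "B * b + C * d = C * a" "A * b = - (C * c)"
    using e 3 by (simp_all add: algebra_simps)
  have "A * a\<^sup>2 + B * a * c + C * c\<^sup>2 = a * (A * a + B * c) + c * (C * c)"
    by (simp add: power2_eq_square algebra_simps)
  also have "\<dots> = A * (a * d - b * c)" unfolding f(1,2) by (simp add: algebra_simps)
  finally have 4: "A * a\<^sup>2 + B * a * c + C * c\<^sup>2 = A" using det by simp
  have "2 * A * a * b + B * (a * d + b * c) + 2 * C * c * d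
       = 2 * b * (A * a + B * c) + B * (a * d - b * c) + 2 * d * (C * c)"
    by (simp add: power2_eq_square algebra_simps)
  also have "\<dots> = B" unfolding f(1,2) det by (simp add: algebra_simps)
  finally have 5: "2 * A * a * b + B * (a * d + b * c) + 2 * C * c * d = B" .
  have "A * b\<^sup>2 + B * b * d + C * d\<^sup>2 = b * (A * b) + d * (B * b + C * d)"
    by (simp add: power2_eq_square algebra_simps)
  also have "\<dots> = C * (a * d - b * c)" unfolding f(3,4) by (simp add: algebra_simps)
  finally have 6: "A * b\<^sup>2 + B * b * d + C * d\<^sup>2 = C" using det by simp
  show ?thesis using 4 5 6 by (simp add: q abcd Let_def)
qed

text \<open>A matrix other than \<open>\<plusminus>1\<close> has at most two fixed points, so it determines the roots of a form
  that it stabilises.\<close>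

lemma common_stabiliser:
  assumes g: "g \<in> SL2Z" and "g$2$1 \<noteq> 0"
    and q: "indef (discriminant q)" "act g q = q" and p: "act g p = p"
  shows "rval p (first_root q) = 0"
proof -
  let ?c = "of_int (g$2$1) :: real"
  note e = stabiliser_eqs[OF g q(2)] and e' = stabiliser_eqs[OF g p]
  let ?x = "first_root q"
  have "rval q ?x = 0" using root_iff[OF q(1)] by simp
  have "coeffA q * (coeffB p * g$2$1) = coeffA p * (coeffB q * g$2$1)" unfolding e e' by simp
  then have B: "?c * coeffA q * coeffB p = ?c * coeffA p * coeffB q"
    by (metis (no_types, lifting) mult.commute mult.left_commute of_int_mult)
  have "coeffA q * (coeffC p * g$2$1) = - (coeffA q * (coeffA p * g$1$2))"
    unfolding e' by simp
  also have "\<dots> = - (coeffA p * (coeffA q * g$1$2))" by simp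
  also have "\<dots> = coeffA p * (coeffC q * g$2$1)" unfolding e by simp
  finally have C: "?c * coeffA q * coeffC p = ?c * coeffA p * coeffC q"
    by (metis (no_types, lifting) mult.commute mult.left_commute of_int_mult)
  have "?c * coeffA q * rval p ?x
      = ?c * coeffA q * coeffA p * ?x\<^sup>2 + ?c * coeffA q * coeffB p * ?x + ?c * coeffA q * coeffC p"
    by (simp add: rval_def algebra_simps)
  also have "\<dots> = ?c * coeffA p * rval q ?x"
    unfolding B C by (simp add: rval_def algebra_simps)
  finally have "?c * coeffA q * rval p (first_root q) = 0"
    using \<open>rval q ?x = 0\<close> by simp
  then show ?thesis using assms(2) indef_coeff_nonzero[OF q(1)] by simp
qed

subsection \<open>Generators of the modular group\<close>

text \<open>The Euclidean algorithm on the bottom row: \<open>Tmat\<close> and its inverse add the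
  left entry to the right one or subtract it, \<open>Smat\<close> exchanges the entries up to
  sign.\<close>

lemma SL2Z_induct [consumes 1, case_names one S T Tinv]:
  assumes "g \<in> SL2Z" "P (mat 1)"
    and S: "\<And>g. g \<in> SL2Z \<Longrightarrow> P g \<Longrightarrow> P (g ** Smat)"
    and T: "\<And>g. g \<in> SL2Z \<Longrightarrow> P g \<Longrightarrow> P (g ** Tmat)"
    and Ti: "\<And>g. g \<in> SL2Z \<Longrightarrow> P g \<Longrightarrow> P (g ** sinv Tmat)"
  shows "P g"
proof -
  \<comment> \<open>Each generator can be undone by generators (\<open>Smat\<close> has order 4), so
    the property also passes from a product back to its left factor, which the descent
    requires.\<close>
  have eqT: "g = (g ** sinv Tmat) ** Tmat" "g = (g ** Tmat) ** sinv Tmat"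
    "g = (((g ** Smat) ** Smat) ** Smat) ** Smat" for g :: "int^2^2"
    by (auto intro!: mat2_eqI simp: sinv_def Tmat_def Smat_def)
  have dT: "P g" if "g \<in> SL2Z" "P (g ** Tmat)" for g
    using Ti[of "g ** Tmat"] that eqT(2)[of g] by simp
  have dTi: "P g" if "g \<in> SL2Z" "P (g ** sinv Tmat)" for g
    using T[of "g ** sinv Tmat"] that eqT(1)[of g] by simp
  have dS: "P g" if "g \<in> SL2Z" "P (g ** Smat)" for g
    using S[of "g ** Smat"] S[of "(g ** Smat) ** Smat"] S[of "((g ** Smat) ** Smat) ** Smat"]
      that eqT(3)[of g] by simp
  have up: "P g" if "g \<in> SL2Z" "g$2$1 = 0" "g$1$1 = 1" for g
  proof -
    have "P g" if "nat \<bar>g$1$2\<bar> = n" "g \<in> SL2Z" "g$2$1 = 0" "g$1$1 = 1" for g n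
      using that
    proof (induction n arbitrary: g)
      case 0
      then have "g = mat 1" by (intro mat2_eqI) (auto simp: SL2Z_iff)
      then show ?case using assms(2) by simp
    next
      case (Suc n)
      show ?case
      proof (cases "g$1$2 > 0")
        case True
        have "P (g ** sinv Tmat)"
          by (rule Suc.IH) (use Suc.prems True in \<open>auto simp: sinv_def Tmat_def SL2Z_iff\<close>)
        then show ?thesis using dTi Suc.prems by blast
      next
        case False
        have "P (g ** Tmat)"
          by (rule Suc.IH) (use Suc.prems False in \<open>auto simp: Tmat_def SL2Z_iff\<close>)
        then show ?thesis using dT Suc.prems by blast
      qed
    qed
    then show ?thesis using that by blast
  qed
  have zero: "P g" if "g \<in> SL2Z" "g$2$1 = 0" for g
  proof -
    have "g$1$1 * g$2$2 = 1" using that by (simp add: SL2Z_iff)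
    then consider "g$1$1 = 1" | "g$1$1 = -1" using zmult_eq_1_iff by auto
    then show ?thesis
    proof cases
      case 1
      then show ?thesis using up that by blast
    next
      case 2
      \<comment> \<open>The square of \<open>Smat\<close> is minus the identity, which turns the
        diagonal entry into 1.\<close>
      have "P (g ** Smat ** Smat)"
        by (rule up) (use that 2 in \<open>simp_all add: Smat_def SL2Z_iff\<close>)
      then show ?thesis using dS that by simp
    qed
  qed
  have "P g" if "n = nat (\<bar>g$2$1\<bar> + \<bar>g$2$2\<bar>)" "g \<in> SL2Z" for n g
    using that
  proof (induction n arbitrary: g rule: less_induct)
    case (less n)
    \<comment> \<open>For a nonzero left entry a translation shortens the row strictly here. In the
      other case \<open>Smat\<close> leads to this one without changing \<open>n\<close>, hence the
      separate statement.\<close>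
    have *: "P g" if g: "g \<in> SL2Z" "\<bar>g$2$1\<bar> \<le> \<bar>g$2$2\<bar>" "nat (\<bar>g$2$1\<bar> + \<bar>g$2$2\<bar>) = n" for g
    proof (cases "g$2$1 = 0")
      case False
      let ?c = "g$2$1" and ?d = "g$2$2"
      have "\<bar>?d + ?c\<bar> < \<bar>?d\<bar> \<or> \<bar>?d - ?c\<bar> < \<bar>?d\<bar>" using g False by linarith
      then show ?thesis
      proof
        assume a: "\<bar>?d + ?c\<bar> < \<bar>?d\<bar>"
        have "P (g ** Tmat)"
          by (rule less.IH[OF _ refl])
            (use a g(1,2) in \<open>simp_all add: g(3)[symmetric] Tmat_def SL2Z_iff algebra_simps\<close>)
        then show ?thesis using dT g by blast
      next
        assume a: "\<bar>?d - ?c\<bar> < \<bar>?d\<bar>"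
        have "P (g ** sinv Tmat)"
          by (rule less.IH[OF _ refl])
            (use a g(1,2) in \<open>simp_all add: g(3)[symmetric] Tmat_def sinv_def SL2Z_iff algebra_simps\<close>)
        then show ?thesis using dTi g by blast
      qed
    qed (use zero g in blast)
    show ?case
    proof (cases "\<bar>g$2$1\<bar> \<le> \<bar>g$2$2\<bar>")
      case True
      then show ?thesis using * less.prems by blast
    next
      case False
      have "P (g ** Smat)"
        by (rule *) (use less.prems False in \<open>simp_all add: Smat_def SL2Z_iff algebra_simps\<close>)
      then show ?thesis using dS less.prems by blast
    qed
  qed
  then show ?thesis using assms(1) by blast
qed

section \<open>Planar trees\<close>

lemma left_eq: "left G e = (snd e, cw G (snd e) (fst e))"
  and right_eq: "right G e = (snd e, cw G (snd e) (cw G (snd e) (fst e)))"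
  by (cases e; simp)+

locale plane_tree =
  fixes G :: "('v, 'm) plane_graph_scheme"
  assumes tree: "plane_cubic_tree G"
begin

abbreviation "E \<equiv> oriented_edges G"

lemma adj_sym: "adj G u v \<Longrightarrow> adj G v u"
  and adj_neq: "adj G u v \<Longrightarrow> u \<noteq> v"
  and connected_tree: "(adj G)\<^sup>*\<^sup>* u v"
  and no_cycle: "length p \<ge> 3 \<Longrightarrow> distinct p \<Longrightarrow> successively (adj G) p \<Longrightarrow> \<not> adj G (last p) (hd p)"
  and degree: "card {u. adj G v u} = 3"
  and adj_cw: "adj G v u \<Longrightarrow> adj G v (cw G v u)"
  and cw_neq: "adj G v u \<Longrightarrow> cw G v u \<noteq> u"
  and cw_cw_cw: "adj G v u \<Longrightarrow> cw G v (cw G v (cw G v u)) = u"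
  using tree unfolding plane_cubic_tree_def by blast+

lemma cw_cw_neq: "adj G v u \<Longrightarrow> cw G v (cw G v u) \<noteq> u" "adj G v u \<Longrightarrow> cw G v (cw G v u) \<noteq> cw G v u"
  using cw_neq cw_cw_cw adj_cw by metis+

lemma neighbours:
  assumes "adj G v u"
  shows "{w. adj G v w} = {u, cw G v u, cw G v (cw G v u)}"
proof (rule sym, rule card_subset_eq)
  show "finite {w. adj G v w}" using degree[of v] card.infinite by fastforce
  show "{u, cw G v u, cw G v (cw G v u)} \<subseteq> {w. adj G v w}" using assms adj_cw by blast
  show "card {u, cw G v u, cw G v (cw G v u)} = card {w. adj G v w}"
    using degree[of v] cw_neq[OF assms] cw_cw_neq[OF assms] by (auto simp: card_insert_if)
qed

lemma exists_neighbour: "\<exists>u. adj G v u"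
proof -
  have "{u. adj G v u} \<noteq> {}" using degree[of v] by (intro notI) simp
  then show ?thesis by blast
qed

lemma swap_edge [simp]: "prod.swap e \<in> E \<longleftrightarrow> e \<in> E"
  using adj_sym by (cases e) (auto simp: oriented_edges_def)

lemma left_edge [simp]: "e \<in> E \<Longrightarrow> left G e \<in> E"
  and right_edge [simp]: "e \<in> E \<Longrightarrow> right G e \<in> E"
  using adj_sym adj_cw by (cases e; simp add: oriented_edges_def; blast)+

lemma edge_iff: "e \<in> E \<longleftrightarrow> adj G (fst e) (snd e)"
  by (cases e) (simp add: oriented_edges_def)

text \<open>All four express that \<open>cw\<close> has order three at a vertex: coming back along
  one branch, a left turn leads to the next edge in the cycle and a right turn to the one after
  it.\<close>

lemma left_swap_left [simp]: "e \<in> E \<Longrightarrow> left G (prod.swap (left G e)) = right G e"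
  and left_swap_right [simp]: "e \<in> E \<Longrightarrow> left G (prod.swap (right G e)) = prod.swap e"
  and right_swap_left [simp]: "e \<in> E \<Longrightarrow> right G (prod.swap (left G e)) = prod.swap e"
  and right_swap_right [simp]: "e \<in> E \<Longrightarrow> right G (prod.swap (right G e)) = left G e"
  using cw_cw_cw[OF adj_sym] by (cases e; simp add: oriented_edges_def)+

lemma left_neq_right: "e \<in> E \<Longrightarrow> left G e \<noteq> right G e"
  using cw_cw_neq(2)[OF adj_sym] by (cases e) (force simp: oriented_edges_def)

lemma left_inj: "e \<in> E \<Longrightarrow> e' \<in> E \<Longrightarrow> left G e = left G e' \<Longrightarrow> e = e'"
  by (metis left_swap_left left_swap_right swap_swap right_edge)

lemma right_inj: "e \<in> E \<Longrightarrow> e' \<in> E \<Longrightarrow> right G e = right G e' \<Longrightarrow> e = e'"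
  by (metis left_swap_right swap_swap)

lemma left_surj:
  assumes "e \<in> E"
  shows "\<exists>x\<in>E. left G x = e"
  by (rule bexI[of _ "prod.swap (right G (prod.swap e))"]) (use assms in auto)

lemma successor_cases:
  assumes "e \<in> E" "x \<in> E" "fst x = snd e"
  obtains "x = prod.swap e" | "x = left G e" | "x = right G e"
proof -
  have "snd x \<in> {w. adj G (snd e) w}" using assms by (simp add: edge_iff)
  also have "\<dots> = {fst e, cw G (snd e) (fst e), cw G (snd e) (cw G (snd e) (fst e))}"
    by (rule neighbours) (use assms(1) adj_sym in \<open>simp add: edge_iff\<close>)
  finally show ?thesis using that assms(3) by (cases x) (auto simp: left_eq right_eq prod.swap_def)
qed

lemma fst_left [simp]: "fst (left G e) = snd e" and fst_right [simp]: "fst (right G e) = snd e"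
  by (simp_all add: left_eq right_eq)

text \<open>Reversals and left turns generate right turns, hence reach all three edges at a vertex;
  connectedness does the rest. They are the two operations by which labellings are
  specified.\<close>

lemma edge_induct [consumes 2, case_names base swap left]:
  assumes "e0 \<in> E" "e \<in> E" "P e0"
    and swap: "\<And>e. e \<in> E \<Longrightarrow> P e \<Longrightarrow> P (prod.swap e)"
    and left: "\<And>e. e \<in> E \<Longrightarrow> P e \<Longrightarrow> P (left G e)"
  shows "P e"
proof -
  have right: "P (right G e)" if "e \<in> E" "P e" for e
    using left[OF _ swap[OF _ left]] that by (metis left_edge swap_edge left_swap_left)
  have around: "P x" if "e \<in> E" "P e" "x \<in> E" "fst x = snd e" for e x
    using that(1,3,4) by (rule successor_cases) (use that swap left right in auto)
  have "\<forall>x\<in>E. fst x = v \<longrightarrow> P x" if "(adj G)\<^sup>*\<^sup>* (fst e0) v" for v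
    using that
  proof induction
    case base
    then show ?case using around[of "prod.swap e0"] swap assms(1,3) by auto
  next
    case (step v v')
    then show ?case using around[of "(v, v')"] by (auto simp: edge_iff)
  qed
  then show ?thesis using connected_tree assms(2) by blast
qed

subsection \<open>Walks without backtracking\<close>

definition turn :: "bool \<Rightarrow> 'v \<times> 'v \<Rightarrow> 'v \<times> 'v" where
  "turn b e = (if b then left G e else right G e)"

lemma turn_edge [simp]: "e \<in> E \<Longrightarrow> turn b e \<in> E"
  and fst_turn [simp]: "fst (turn b e) = snd e"
  by (simp_all add: turn_def)

lemma turn_neq: "e \<in> E \<Longrightarrow> turn b e = turn b' e \<Longrightarrow> b = b'"
  using left_neq_right[of e] by (auto simp: turn_def split: if_splits)

lemma snd_turn_neq: "e \<in> E \<Longrightarrow> snd (turn b e) \<noteq> fst e"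
  using cw_neq cw_cw_neq adj_sym by (auto simp: turn_def left_eq right_eq edge_iff)

primrec walk :: "bool list \<Rightarrow> 'v \<times> 'v \<Rightarrow> 'v \<times> 'v" where
  "walk [] e = e"
| "walk (b # w) e = walk w (turn b e)"

lemma walk_append [simp]: "walk (w @ w') e = walk w' (walk w e)"
  by (induction w arbitrary: e) auto

lemma walk_edge [simp]: "e \<in> E \<Longrightarrow> walk w e \<in> E"
  by (induction w arbitrary: e) auto

text \<open>A left turn either prolongs the walk or, on an edge traversed against it, changes a last
  left turn into a right one or cancels a last right turn.\<close>

lemma edge_walk_cases:
  assumes "e \<in> E" "x \<in> E"
  shows "\<exists>w. \<exists>e'\<in>{e, prod.swap e}. x = walk w e' \<or> prod.swap x = walk w e'"
  using assms
proof (induction rule: edge_induct)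
  case base
  have "e = walk [] e" by simp
  then show ?case by blast
next
  case (swap x)
  then show ?case by auto
next
  case (left x)
  then obtain w e' where w: "e' \<in> {e, prod.swap e}" "x = walk w e' \<or> prod.swap x = walk w e'" by blast
  have e': "e' \<in> E" "prod.swap e' \<in> {e, prod.swap e}" using w assms by auto
  from w(2) show ?case
  proof
    assume "x = walk w e'"
    then have "left G x = walk (w @ [True]) e'" by (simp add: turn_def)
    then show ?thesis using w(1) by blast
  next
    assume x: "prod.swap x = walk w e'"
    show ?thesis
    proof (cases w rule: rev_cases)
      case Nil
      then have "left G x = walk [True] (prod.swap e')" using x by (auto simp: turn_def)
      then show ?thesis using e' by blast
    next
      case (snoc w' b)
      let ?y = "walk w' e'"
      have y: "?y \<in> E" "x = prod.swap (turn b ?y)" using x e' snoc by (simp, metis swap_swap walk.simps walk_append)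
      show ?thesis
      proof (cases b)
        case True
        then have "left G x = walk (w' @ [False]) e'" using y by (simp add: turn_def)
        then show ?thesis using w(1) by blast
      next
        case False
        then have "prod.swap (left G x) = walk w' e'" using y by (simp add: turn_def)
        then show ?thesis using w(1) by metis
      qed
    qed
  qed
qed

end

section \<open>Uniqueness of paths without backtracking\<close>

fun reduced :: "'a list \<Rightarrow> bool" where
  "reduced (x # y # z # p) \<longleftrightarrow> x \<noteq> z \<and> reduced (y # z # p)"
| "reduced _ \<longleftrightarrow> True"

lemma reduced_Cons: "reduced (x # p) \<Longrightarrow> reduced p"
  by (cases "x # p" rule: reduced.cases) auto

lemma reduced_join: "reduced (xs @ [a, b]) \<Longrightarrow> reduced (a # b # ys) \<Longrightarrow> reduced (xs @ a # b # ys)"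
proof (induction xs)
  case (Cons x xs)
  then show ?case by (cases xs rule: reduced.cases) (auto dest: reduced_Cons)
qed simp

lemma reduced_rev: "reduced p \<Longrightarrow> reduced (rev p)"
proof (induction p rule: reduced.induct)
  case (1 x y z p)
  then show ?case using reduced_join[of "rev p" z y "[x]"] by auto
qed auto

context plane_tree
begin

abbreviation "nb p \<equiv> successively (adj G) p \<and> reduced p"

lemma nb_Cons: "nb (x # p) \<Longrightarrow> nb p"
  using reduced_Cons by (auto simp: successively_Cons)

text \<open>The part of a path up to the first return to its start would be a cycle.\<close>

lemma nb_distinct: "nb p \<Longrightarrow> distinct p"
proof (induction p)
  case (Cons x q)
  then have q: "distinct q" using nb_Cons by blast
  have "x \<notin> set q"
  proof
    assume "x \<in> set q"
    then obtain pre post where s: "q = pre @ x # post" "x \<notin> set pre" by (meson split_list_first)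
    \<comment> \<open>Length 0 would be a loop and length 1 a step back, so the closed path has at
      least three vertices.\<close>
    have len: "length pre \<ge> 2"
    proof -
      have "pre \<noteq> []" using Cons.prems s adj_neq[of x x] by auto
      moreover have "pre \<noteq> [y]" for y using Cons.prems s by auto
      ultimately show ?thesis by (cases pre rule: reduced.cases) auto
    qed
    have "successively (adj G) ((x # pre) @ x # post)" using Cons.prems s by simp
    then have "successively (adj G) (x # pre)" "adj G (last (x # pre)) x"
      by (simp_all only: successively_append_iff) auto
    then show False using no_cycle[of "x # pre"] len q s by auto
  qed
  then show ?case using q by simp
qed simp

text \<open>Where two paths part, the reversal of one followed by the other does not backtrack, so
  its vertices are distinct; but both of its ends are the common last vertex.\<close>

lemma nb_unique:
  assumes "nb p" "nb p'" "p \<noteq> []" "p' \<noteq> []" "hd p = hd p'" "last p = last p'"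
  shows "p = p'"
  using assms
proof (induction p arbitrary: p')
  case (Cons x r)
  then obtain r' where p': "p' = x # r'" by (metis list.collapse list.sel(1))
  note d = nb_distinct[OF Cons.prems(1)] nb_distinct[OF Cons.prems(2)]
  show ?case
  proof (cases "r = [] \<or> r' = []")
    case True
    then show ?thesis using d Cons.prems p' by (auto split: if_splits)
  next
    case False
    then obtain y s y' s' where r: "r = y # s" "r' = y' # s'" by (meson list.exhaust)
    have "y = y'"
    proof (rule ccontr)
      assume "y \<noteq> y'"
      have "successively (adj G) (rev r)"
      proof -
        have "successively (adj G) r" using Cons.prems(1) nb_Cons by blast
        then have "successively (\<lambda>x y. adj G y x) r" by (rule successively_mono) (use adj_sym in auto)
        then show ?thesis by simp
      qed
      moreover have "adj G y x" using Cons.prems(1) r adj_sym by auto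
      ultimately have "successively (adj G) (rev s @ y # x # y' # s')"
        using Cons.prems(2) p' r by (auto simp: successively_append_iff)
      moreover have "reduced (rev s @ y # x # y' # s')"
      proof (rule reduced_join)
        show "reduced (rev s @ [y, x])" using reduced_rev[of "x # y # s"] Cons.prems(1) r by simp
        show "reduced (y # x # y' # s')" using \<open>y \<noteq> y'\<close> Cons.prems(2) r p' by simp
      qed
      ultimately have "distinct (rev s @ y # x # y' # s')" using nb_distinct by blast
      moreover have "last (y # s) = last (y' # s')" using Cons.prems p' r by simp
      moreover have "last (y # s) \<in> set (y # s)" "last (y' # s') \<in> set (y' # s')" by (rule last_in_set; simp)+
      ultimately show False by auto
    qed
    moreover have "r = r'"
    proof (rule Cons.IH)
      show "nb r" "nb r'" using nb_Cons Cons.prems p' by blast+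
    qed (use Cons.prems p' r \<open>y = y'\<close> in auto)
    ultimately show ?thesis using p' by simp
  qed
qed simp

primrec verts :: "bool list \<Rightarrow> 'v \<times> 'v \<Rightarrow> 'v list" where
  "verts [] e = [fst e, snd e]"
| "verts (b # w) e = fst e # verts w (turn b e)"

lemma verts_eq: "\<exists>r. verts w e = fst e # snd e # r"
proof (induction w arbitrary: e)
  case (Cons b w)
  obtain r where "verts w (turn b e) = fst (turn b e) # snd (turn b e) # r" using Cons by blast
  then show ?case by simp
qed simp

lemma verts_Cons_eq: "\<exists>r. verts (b # w) e = fst e # snd e # snd (turn b e) # r"
  using verts_eq[of w "turn b e"] by auto

lemma last_verts [simp]: "last (verts w e) = snd (walk w e)"
proof (induction w arbitrary: e)
  case (Cons b w)
  then show ?case using verts_eq[of w "turn b e"] by auto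
qed simp

lemma verts_nb: "e \<in> E \<Longrightarrow> nb (verts w e)"
proof (induction w arbitrary: e)
  case (Cons b w)
  obtain r where "verts w (turn b e) = snd e # snd (turn b e) # r"
    using verts_eq[of w "turn b e"] by auto
  then show ?case using Cons.IH[of "turn b e"] Cons.prems snd_turn_neq[OF Cons.prems, of b]
      turn_edge[OF Cons.prems, of b] by (auto simp: edge_iff)
qed (simp add: edge_iff)

lemma verts_inj: "e \<in> E \<Longrightarrow> verts w e = verts w' e \<Longrightarrow> w = w'"
proof (induction w arbitrary: e w')
  case Nil
  show ?case
  proof (cases w')
    case (Cons b v)
    then show ?thesis using verts_Cons_eq[of b v e] Nil.prems by auto
  qed simp
next
  case (Cons b w)
  then obtain b' v where w': "w' = b' # v"
    using verts_Cons_eq[of b w e] by (cases w') auto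
  have "snd (turn b e) = snd (turn b' e)"
    using Cons.prems verts_eq[of w "turn b e"] verts_eq[of v "turn b' e"] unfolding w' by auto
  then have "turn b e = turn b' e" by (simp add: prod_eq_iff)
  then have "b = b'" using turn_neq Cons.prems by blast
  then show ?case using Cons.IH[of "turn b e" v] Cons.prems w' by simp
qed

text \<open>A vertex is encoded by the unique walk without backtracking that leads to it from the
  start of the edge \<open>e\<close>; the Boolean tells whether this walk begins with \<open>e\<close>.\<close>

definition vertex :: "'v \<times> 'v \<Rightarrow> bool \<times> bool list \<Rightarrow> 'v" where
  "vertex e c = snd (walk (snd c) (if fst c then e else prod.swap e))"

lemma inj_vertex:
  assumes "e \<in> E"
  shows "inj (vertex e)"
proof (rule injI)
  fix c c' assume eq: "vertex e c = vertex e c'"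
  \<comment> \<open>Both kinds of code become paths from \<open>fst e\<close>: a walk starting with
    the reversed edge has \<open>snd e\<close> as first vertex, which \<open>tl\<close> drops. The
    second vertex then tells the kinds apart.\<close>
  define path where
    "path = (\<lambda>c. if fst c then verts (snd c) e else tl (verts (snd c) (prod.swap e)))"
  have path: "nb (path c)" "path c \<noteq> []" "hd (path c) = fst e" "last (path c) = vertex e c"
    and second: "fst c \<Longrightarrow> \<exists>r. path c = fst e # snd e # r"
      "\<not> fst c \<Longrightarrow> path c = [fst e] \<or> (\<exists>y r. path c = fst e # y # r \<and> y \<noteq> snd e)" for c
  proof -
    obtain r where r: "verts (snd c) e = fst e # snd e # r" using verts_eq by blast
    obtain r' where r': "verts (snd c) (prod.swap e) = snd e # fst e # r'"
      using verts_eq[of _ "prod.swap e"] by auto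
    note nb = verts_nb[OF assms, of "snd c"] verts_nb[of "prod.swap e" "snd c"]
    show "nb (path c)" using nb assms r' nb_Cons[of "snd e" "fst e # r'"] by (auto simp: path_def)
    show "path c \<noteq> []" "hd (path c) = fst e" using r r' by (auto simp: path_def)
    show "last (path c) = vertex e c"
      using last_verts[of "snd c" e] last_verts[of "snd c" "prod.swap e"] r r'
      by (auto simp: path_def vertex_def split: if_splits)
    show "fst c \<Longrightarrow> \<exists>r. path c = fst e # snd e # r" using r by (simp add: path_def)
    assume "\<not> fst c"
    then have "path c = fst e # r'" using r' by (simp add: path_def)
    moreover have "reduced (snd e # fst e # r')" using nb(2) assms r' by simp
    ultimately show "path c = [fst e] \<or> (\<exists>y r. path c = fst e # y # r \<and> y \<noteq> snd e)"
      by (cases r') auto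
  qed
  have p: "path c = path c'"
    by (rule nb_unique) (use path eq in auto)
  have f: "fst c = fst c'"
    using second[of c] second[of c'] p by (cases "fst c"; cases "fst c'") auto
  have "snd c = snd c'"
  proof (cases "fst c")
    case True
    then show ?thesis using p f verts_inj[OF assms] by (simp add: path_def)
  next
    case False
    then have "verts (snd c) (prod.swap e) = verts (snd c') (prod.swap e)"
      using p f verts_eq[of "snd c" "prod.swap e"] verts_eq[of "snd c'" "prod.swap e"]
      by (auto simp: path_def)
    then show ?thesis using verts_inj[of "prod.swap e"] assms by simp
  qed
  then show "c = c'" using f by (simp add: prod_eq_iff)
qed

text \<open>The start of the last edge is the end of the walk that is one turn shorter; for the
  empty walk the code switches to the other direction of \<open>e\<close>.\<close>

lemma fst_walk: "\<exists>c. fst (walk w e) = vertex e c" "\<exists>c. fst (walk w (prod.swap e)) = vertex e c"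
proof -
  show "\<exists>c. fst (walk w e) = vertex e c"
    by (rule exI[of _ "if w = [] then (False, []) else (True, butlast w)"], cases w rule: rev_cases)
      (simp_all add: vertex_def)
  show "\<exists>c. fst (walk w (prod.swap e)) = vertex e c"
    by (rule exI[of _ "if w = [] then (True, []) else (False, butlast w)"], cases w rule: rev_cases)
      (simp_all add: vertex_def)
qed

lemma surj_vertex:
  assumes "e \<in> E"
  shows "surj (vertex e)"
proof -
  have "\<exists>c. v = vertex e c" for v
  proof -
    obtain u where "adj G u v" using exists_neighbour adj_sym by blast
    then have "(u, v) \<in> E" by (simp add: edge_iff)
    then obtain w e' where "e' \<in> {e, prod.swap e}" "(u, v) = walk w e' \<or> prod.swap (u, v) = walk w e'"
      using edge_walk_cases[OF assms, of "(u, v)"] by blast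
    then have e': "e' = e \<or> e' = prod.swap e" and w: "(u, v) = walk w e' \<or> (v, u) = walk w e'"
      by auto
    then consider "v = snd (walk w e')" | "v = fst (walk w e')" by (metis fst_conv snd_conv)
    then show ?thesis
    proof cases
      case 1
      then have "v = vertex e (e' = e, w)" using e' by (auto simp: vertex_def)
      then show ?thesis by blast
    next
      case 2
      then show ?thesis using e' fst_walk by metis
    qed
  qed
  then show ?thesis by (auto simp: surj_def)
qed

lemma bij_vertex: "e \<in> E \<Longrightarrow> bij (vertex e)"
  by (simp add: bij_def inj_vertex surj_vertex)

end

subsection \<open>Isomorphisms\<close>

lemma plane_iso_bij: "plane_iso G H \<phi> \<Longrightarrow> bij \<phi>"
  and plane_iso_adj: "plane_iso G H \<phi> \<Longrightarrow> adj H (\<phi> u) (\<phi> v) \<longleftrightarrow> adj G u v"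
  and plane_iso_cw: "plane_iso G H \<phi> \<Longrightarrow> adj G v u \<Longrightarrow> \<phi> (cw G v u) = cw H (\<phi> v) (\<phi> u)"
  by (simp_all add: plane_iso_def)

lemma plane_iso_edge:
  "plane_iso G H \<phi> \<Longrightarrow> map_prod \<phi> \<phi> e \<in> oriented_edges H \<longleftrightarrow> e \<in> oriented_edges G"
  by (cases e) (simp add: oriented_edges_def plane_iso_adj)

lemma map_prod_swap: "map_prod \<phi> \<phi> (prod.swap e) = prod.swap (map_prod \<phi> \<phi> e)"
  by (cases e) simp

lemma map_prod_comp: "map_prod (\<phi> \<circ> \<psi>) (\<phi> \<circ> \<psi>) e = map_prod \<phi> \<phi> (map_prod \<psi> \<psi> e)"
  by (cases e) simp

lemma map_prod_inj: "bij \<phi> \<Longrightarrow> map_prod \<phi> \<phi> e = map_prod \<phi> \<phi> e' \<longleftrightarrow> e = e'"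
  by (cases e; cases e') (auto dest: bij_is_inj injD)

lemma map_prod_inv: "bij \<phi> \<Longrightarrow> map_prod \<phi> \<phi> (map_prod (inv \<phi>) (inv \<phi>) e) = e"
  "bij \<phi> \<Longrightarrow> map_prod (inv \<phi>) (inv \<phi>) (map_prod \<phi> \<phi> e) = e"
  by (cases e; simp add: bij_is_surj surj_f_inv_f bij_is_inj)+

lemma plane_iso_comp:
  "plane_iso G H \<phi> \<Longrightarrow> plane_iso H K \<psi> \<Longrightarrow> plane_iso G K (\<psi> \<circ> \<phi>)"
  unfolding plane_iso_def using bij_comp by auto

lemma plane_iso_id [simp]: "plane_iso G G id"
  by (simp add: plane_iso_def)

lemma plane_iso_inv:
  assumes "plane_iso G H \<phi>"
  shows "plane_iso H G (inv \<phi>)"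
proof -
  note b = plane_iso_bij[OF assms]
  have f: "\<phi> (inv \<phi> x) = x" for x using b by (simp add: bij_is_surj surj_f_inv_f)
  have a: "adj G (inv \<phi> u) (inv \<phi> v) \<longleftrightarrow> adj H u v" for u v
    using plane_iso_adj[OF assms, of "inv \<phi> u" "inv \<phi> v"] by (simp add: f)
  moreover have "inv \<phi> (cw H v u) = cw G (inv \<phi> v) (inv \<phi> u)" if "adj H v u" for v u
  proof -
    have "\<phi> (cw G (inv \<phi> v) (inv \<phi> u)) = cw H v u"
      using plane_iso_cw[OF assms, of "inv \<phi> v" "inv \<phi> u"] that a by (simp add: f)
    then show ?thesis using b by (metis bij_inv_eq_iff)
  qed
  ultimately show ?thesis using b by (simp add: plane_iso_def bij_imp_bij_inv)
qed

lemma (in plane_tree) plane_iso_left: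
  assumes "plane_iso G H \<phi>" "e \<in> E"
  shows "map_prod \<phi> \<phi> (left G e) = left H (map_prod \<phi> \<phi> e)"
  using plane_iso_cw[OF assms(1) adj_sym] assms(2)
  by (cases e) (simp add: oriented_edges_def)

lemma (in plane_tree) plane_iso_right:
  assumes "plane_iso G H \<phi>" "e \<in> E"
  shows "map_prod \<phi> \<phi> (right G e) = right H (map_prod \<phi> \<phi> e)"
  using plane_iso_cw[OF assms(1)] adj_sym adj_cw assms(2)
  by (cases e) (simp add: oriented_edges_def)

lemma (in plane_tree) edge_at_vertex: "\<exists>e\<in>E. fst e = v"
proof -
  obtain u where "adj G v u" using exists_neighbour by blast
  then show ?thesis by (intro bexI[of _ "(v, u)"]) (simp_all add: edge_iff)
qed

text \<open>Isomorphisms commute with reversals and left turns, so agreement on one oriented edge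
  spreads to all.\<close>

lemma (in plane_tree) plane_iso_unique:
  assumes "plane_iso G H \<phi>" "plane_iso G H \<psi>" "e \<in> E" "map_prod \<phi> \<phi> e = map_prod \<psi> \<psi> e"
  shows "\<phi> = \<psi>"
proof
  fix v
  obtain x where x: "x \<in> E" "fst x = v" using edge_at_vertex by blast
  have "map_prod \<phi> \<phi> x = map_prod \<psi> \<psi> x"
    using assms(3) x(1)
  proof (induction rule: edge_induct)
    case (left x)
    then show ?case using plane_iso_left assms(1,2) by metis
  qed (simp_all add: assms(4) map_prod_swap)
  then show "\<phi> v = \<psi> v" using x by (cases x) simp
qed

text \<open>The set of codes does not depend on the tree, so equal codes define a bijection of the
  vertices. The work lies in showing that it respects left turns at every edge, not only those taken
  by the walks.\<close>

lemma plane_iso_exists: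
  fixes G :: "('v, 'm) plane_graph_scheme" and H :: "('w, 'n) plane_graph_scheme"
  assumes "plane_cubic_tree G" "plane_cubic_tree H"
    and e: "e \<in> oriented_edges G" "e' \<in> oriented_edges H"
  shows "\<exists>\<phi>. plane_iso G H \<phi> \<and> map_prod \<phi> \<phi> e = e'"
proof -
  interpret G: plane_tree G using assms by unfold_locales
  interpret H: plane_tree H using assms by unfold_locales
  define \<phi> where "\<phi> = H.vertex e' \<circ> inv (G.vertex e)"
  have b: "bij \<phi>"
    unfolding \<phi>_def by (intro bij_comp bij_imp_bij_inv G.bij_vertex H.bij_vertex e)
  have v: "\<phi> (G.vertex e c) = H.vertex e' c" for c
    unfolding \<phi>_def using G.inj_vertex[OF e(1)] by simp
  have snd1: "\<phi> (snd (G.walk w e)) = snd (H.walk w e')" for w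
    using v[of "(True, w)"] by (simp add: G.vertex_def H.vertex_def)
  have snd2: "\<phi> (snd (G.walk w (prod.swap e))) = snd (H.walk w (prod.swap e'))" for w
    using v[of "(False, w)"] by (simp add: G.vertex_def H.vertex_def)
  have fst1: "\<phi> (fst (G.walk w e)) = fst (H.walk w e')" for w
    by (cases w rule: rev_cases) (use snd1 snd2[of "[]"] in auto)
  have fst2: "\<phi> (fst (G.walk w (prod.swap e))) = fst (H.walk w (prod.swap e'))" for w
    by (cases w rule: rev_cases) (use snd2 snd1[of "[]"] in auto)
  define \<Phi> where "\<Phi> = map_prod \<phi> \<phi>"
  have swap: "\<Phi> (prod.swap x) = prod.swap (\<Phi> x)" for x by (simp add: \<Phi>_def map_prod_swap)
  have walk: "\<Phi> (G.walk w e) = H.walk w e'" "\<Phi> (G.walk w (prod.swap e)) = H.walk w (prod.swap e')" for w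
    unfolding \<Phi>_def using fst1 snd1 fst2 snd2 by (simp_all add: prod_eq_iff)
  \<comment> \<open>The start \<open>y\<close> will be \<open>e\<close> or its reversal; the cases
    for the last turn are those of \<open>edge_walk_cases\<close>.\<close>
  have *: "\<Phi> x \<in> H.E \<and> \<Phi> (left G x) = left H (\<Phi> x)"
    if x: "x = G.walk w y \<or> prod.swap x = G.walk w y" and y: "y \<in> G.E" "y' \<in> H.E"
      and yw: "\<And>w. \<Phi> (G.walk w y) = H.walk w y'"
      and ysw: "\<And>w. \<Phi> (G.walk w (prod.swap y)) = H.walk w (prod.swap y')" for x w y y'
  proof -
    have "\<Phi> x = H.walk w y' \<or> prod.swap (\<Phi> x) = H.walk w y'" using x yw swap by metis
    then have 1: "\<Phi> x \<in> H.E" using y H.walk_edge H.swap_edge by metis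
    have "\<Phi> (left G x) = left H (\<Phi> x)"
      using x
    proof
      assume "x = G.walk w y"
      then show ?thesis using yw[of "w @ [True]"] yw[of w] by (simp add: G.turn_def H.turn_def)
    next
      assume sx: "prod.swap x = G.walk w y"
      show ?thesis
      proof (cases w rule: rev_cases)
        case Nil
        then have "x = prod.swap y" using sx by (metis G.walk.simps(1) swap_swap)
        then show ?thesis using ysw[of "[True]"] ysw[of "[]"] by (simp add: G.turn_def H.turn_def)
      next
        case (snoc w' b)
        let ?z = "G.walk w' y" and ?z' = "H.walk w' y'"
        have z: "?z \<in> G.E" "?z' \<in> H.E" using y by auto
        have t: "\<Phi> (G.turn b ?z) = H.turn b ?z'" for b
          using yw[of "w' @ [b]"] by simp
        have x: "x = prod.swap (G.turn b ?z)" using sx snoc by (metis G.walk.simps G.walk_append swap_swap)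
        show ?thesis
        proof (cases b)
          case True
          then show ?thesis using t[of True] t[of False] z
            by (simp add: x swap G.turn_def H.turn_def)
        next
          case False
          then show ?thesis using t[of False] yw[of w'] z
            by (simp add: x swap G.turn_def H.turn_def)
        qed
      qed
    qed
    then show ?thesis using 1 by simp
  qed
  have **: "\<Phi> x \<in> H.E" "\<Phi> (left G x) = left H (\<Phi> x)" if "x \<in> G.E" for x
  proof -
    obtain w y where "y \<in> {e, prod.swap e}" "x = G.walk w y \<or> prod.swap x = G.walk w y"
      using G.edge_walk_cases[OF e(1) \<open>x \<in> G.E\<close>] by blast
    then have "\<Phi> x \<in> H.E \<and> \<Phi> (left G x) = left H (\<Phi> x)"
      using *[of x w e e'] *[of x w "prod.swap e" "prod.swap e'"] e walk by auto
    then show "\<Phi> x \<in> H.E" "\<Phi> (left G x) = left H (\<Phi> x)" by auto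
  qed
  have fwd: "adj H (\<phi> u) (\<phi> v)" if "adj G u v" for u v
    using **(1)[of "(u, v)"] that by (simp add: G.edge_iff H.edge_iff \<Phi>_def)
  have "adj H (\<phi> u) (\<phi> v) \<longleftrightarrow> adj G u v" for u v
  proof
    assume a: "adj H (\<phi> u) (\<phi> v)"
    \<comment> \<open>Three neighbours go injectively into three, so no adjacency exists in the
      image only.\<close>
    have "\<phi> ` {w. adj G u w} = {w. adj H (\<phi> u) w}"
    proof (rule card_subset_eq)
      show "finite {w. adj H (\<phi> u) w}" using H.degree[of "\<phi> u"] card.infinite by fastforce
      show "card (\<phi> ` {w. adj G u w}) = card {w. adj H (\<phi> u) w}"
        using card_image[of \<phi> "{w. adj G u w}"] b G.degree H.degree
        by (simp add: bij_is_inj inj_on_subset[OF _ subset_UNIV])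
    qed (use fwd in auto)
    then have "\<phi> v \<in> \<phi> ` {w. adj G u w}" using a by simp
    then show "adj G u v" using b by (auto dest: bij_is_inj injD)
  qed (rule fwd)
  moreover have "\<phi> (cw G v u) = cw H (\<phi> v) (\<phi> u)" if "adj G v u" for v u
    using **(2)[of "(u, v)"] that G.adj_sym by (simp add: G.edge_iff \<Phi>_def)
  ultimately have "plane_iso G H \<phi>" using b by (simp add: plane_iso_def)
  moreover have "map_prod \<phi> \<phi> e = e'" using walk(1)[of "[]"] by (simp add: \<Phi>_def)
  ultimately show ?thesis by blast
qed

section \<open>Labellings of the edges by forms\<close>

definition labelling :: "('v, 'm) plane_graph_scheme \<Rightarrow> ('v \<times> 'v \<Rightarrow> bqf) \<Rightarrow> bool" where
  "labelling G f \<longleftrightarrow> (\<forall>e\<in>oriented_edges G.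
     f (prod.swap e) = act Smat (f e) \<and> f (left G e) = act Tmat (f e))"

text \<open>The same matrix serves all labellings: on one tree, both forms of a superimposition change
  along a path by one and the same matrix.\<close>

definition transport ::
  "('v, 'm) plane_graph_scheme \<Rightarrow> 'v \<times> 'v \<Rightarrow> int^2^2 \<Rightarrow> 'v \<times> 'v \<Rightarrow> bool" where
  "transport G e g e' \<longleftrightarrow> e' \<in> oriented_edges G \<and> g \<in> SL2Z \<and>
     (\<forall>f. labelling G f \<longrightarrow> f e' = act g (f e))"

lemma transportD: "transport G e g e' \<Longrightarrow> labelling G f \<Longrightarrow> f e' = act g (f e)"
  and transport_SL2Z: "transport G e g e' \<Longrightarrow> g \<in> SL2Z"
  by (simp_all add: transport_def)

definition Lmat :: "int^2^2" where "Lmat = mat2 1 0 1 1"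

lemma Lmat_SL2Z [simp]: "Lmat \<in> SL2Z"
  by (simp add: SL2Z_iff Lmat_def)

lemma act_L [simp]: "act Lmat (BQF A B C) = BQF (A + B + C) (B + 2 * C) C"
  by (simp add: Lmat_def Let_def)

declare act.simps [simp del]

lemma act_TST: "act Tmat (act Smat (act Tmat q)) = act Lmat q"
  by (cases q) simp

context plane_tree
begin

lemma labelling_swap: "labelling G f \<Longrightarrow> e \<in> E \<Longrightarrow> f (prod.swap e) = act Smat (f e)"
  and labelling_left: "labelling G f \<Longrightarrow> e \<in> E \<Longrightarrow> f (left G e) = act Tmat (f e)"
  by (simp_all add: labelling_def)

lemma labelling_right:
  assumes "labelling G f" "e \<in> E"
  shows "f (right G e) = act Lmat (f e)"
proof -
  have "f (left G (prod.swap (left G e))) = act Tmat (act Smat (act Tmat (f e)))"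
    using assms by (simp only: labelling_left labelling_swap swap_edge left_edge)
  then show ?thesis using assms by (simp only: left_swap_left act_TST)
qed

lemma labelling_neg: "labelling G f \<Longrightarrow> labelling G (neg \<circ> f)"
  by (simp add: labelling_def act_neg)

lemma labelling_pullback:
  assumes "plane_iso G H \<phi>" "labelling H f"
  shows "labelling G (f \<circ> map_prod \<phi> \<phi>)"
  unfolding labelling_def
proof (intro ballI conjI)
  fix e assume e: "e \<in> E"
  then have "map_prod \<phi> \<phi> e \<in> oriented_edges H" using plane_iso_edge[OF assms(1)] by blast
  then show "(f \<circ> map_prod \<phi> \<phi>) (prod.swap e) = act Smat ((f \<circ> map_prod \<phi> \<phi>) e)"
    "(f \<circ> map_prod \<phi> \<phi>) (left G e) = act Tmat ((f \<circ> map_prod \<phi> \<phi>) e)"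
    using assms(2) e plane_iso_left[OF assms(1)] by (simp_all add: labelling_def map_prod_swap)
qed

lemma transport_exists:
  assumes "e \<in> E" "e' \<in> E"
  shows "\<exists>g. transport G e g e'"
  using assms
proof (induction rule: edge_induct)
  case base
  show ?case by (rule exI[of _ "mat 1"]) (simp add: transport_def assms)
next
  case (swap x)
  then obtain g where g: "transport G e g x" by blast
  show ?case
    by (rule exI[of _ "g ** Smat"]) (use g swap in \<open>simp add: transport_def act_mult labelling_swap\<close>)
next
  case (left x)
  then obtain g where g: "transport G e g x" by blast
  show ?case
    by (rule exI[of _ "g ** Tmat"]) (use g left in \<open>simp add: transport_def act_mult labelling_left\<close>)
qed

text \<open>The generators are realised by reversal, a left turn and the inverse of a left turn, so
  every matrix leads to some edge. Hence every form of the orbit occurs in the topograph.\<close>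

lemma transport_target:
  assumes "g \<in> SL2Z" "e \<in> E"
  shows "\<exists>e'. transport G e g e'"
  using assms(1)
proof (induction rule: SL2Z_induct)
  case one
  show ?case by (rule exI[of _ e]) (simp add: transport_def assms)
next
  case (S g)
  then obtain x where x: "transport G e g x" by blast
  show ?case
    by (rule exI[of _ "prod.swap x"]) (use x S in \<open>auto simp: transport_def act_mult labelling_swap\<close>)
next
  case (T g)
  then obtain x where x: "transport G e g x" by blast
  show ?case
    by (rule exI[of _ "left G x"]) (use x T in \<open>auto simp: transport_def act_mult labelling_left\<close>)
next
  case (Tinv g)
  then obtain x where x: "transport G e g x" by blast
  then have "x \<in> E" by (simp add: transport_def)
  then obtain y where y: "y \<in> E" "left G y = x" using left_surj by blast
  have "f y = act (sinv Tmat) (f x)" if "labelling G f" for f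
    using labelling_left[OF that y(1)] y(2) by simp
  then show ?case
    by (intro exI[of _ y]) (use x Tinv y in \<open>simp add: transport_def act_mult\<close>)
qed

lemma labelling_discriminant:
  assumes "labelling G f" "e \<in> E" "e' \<in> E"
  shows "discriminant (f e') = discriminant (f e)"
  using transport_exists[OF assms(2,3)] transportD[OF _ assms(1)] transport_SL2Z by fastforce

end

section \<open>Rivers\<close>

text \<open>Only the labelling rule and the kind of discriminant are recorded, so that the results
  apply to pulled back and to negated labellings.\<close>

locale topo = plane_tree T for T :: "'v topograph" +
  assumes lab: "labelling T (form_at T)"
    and indef_form: "e \<in> E \<Longrightarrow> indef (discriminant (form_at T e))"
begin

abbreviation "cA e \<equiv> coeffA (form_at T e)"
abbreviation "cB e \<equiv> coeffB (form_at T e)"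
abbreviation "cC e \<equiv> coeffC (form_at T e)"

lemma coeff_left [simp]:
  assumes "e \<in> E"
  shows "cA (left T e) = cA e" "cB (left T e) = 2 * cA e + cB e" "cC (left T e) = cA e + cB e + cC e"
  using labelling_left[OF lab assms] by (cases "form_at T e"; simp)+

lemma coeff_right [simp]:
  assumes "e \<in> E"
  shows "cA (right T e) = cA e + cB e + cC e" "cB (right T e) = cB e + 2 * cC e" "cC (right T e) = cC e"
  using labelling_right[OF lab assms] by (cases "form_at T e"; simp)+

lemma coeff_swap [simp]:
  assumes "e \<in> E"
  shows "cA (prod.swap e) = cC e" "cB (prod.swap e) = - cB e" "cC (prod.swap e) = cA e"
  using labelling_swap[OF lab assms] by (cases "form_at T e"; simp)+

lemma coeff_nonzero:
  assumes "e \<in> E"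
  shows "cA e \<noteq> 0" "cC e \<noteq> 0" "cA e + cB e + cC e \<noteq> 0" "cA e - cB e + cC e \<noteq> 0"
proof -
  have 1: "cA e \<noteq> 0" "cC e \<noteq> 0" if "e \<in> E" for e
    using indef_coeff_nonzero[OF indef_form[OF that]] by auto
  show "cA e \<noteq> 0" "cC e \<noteq> 0" using 1 assms by auto
  show "cA e + cB e + cC e \<noteq> 0" using 1(2)[of "left T e"] assms by simp
  show "cA e - cB e + cC e \<noteq> 0" using 1(2)[of "left T (prod.swap e)"] assms by simp
qed

abbreviation "flow \<equiv> river_flow T"
abbreviation "ds \<equiv> downstream T"

lemma flow_iff: "e \<in> flow \<longleftrightarrow> e \<in> E \<and> cA e > 0 \<and> cC e < 0"
  by (auto simp: river_flow_def river_def mult_less_0_iff)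

lemma flow_edge: "e \<in> flow \<Longrightarrow> e \<in> E"
  by (simp add: flow_iff)

lemma river_iff: "e \<in> river T \<longleftrightarrow> e \<in> flow \<or> prod.swap e \<in> flow"
  by (auto simp: flow_iff river_def mult_less_0_iff)

lemma flow_swap: "e \<in> flow \<Longrightarrow> prod.swap e \<notin> flow"
  using flow_edge[of e] by (auto simp: flow_iff)

lemma turns_left_iff:
  assumes "e \<in> flow"
  shows "turns_left T e \<longleftrightarrow> cA e + cB e + cC e < 0"
  using assms by (auto simp: turns_left_def river_def flow_iff mult_less_0_iff)

lemma downstream_flow [simp]:
  assumes "e \<in> flow"
  shows "ds e \<in> flow"
proof -
  have "e \<in> E" using assms flow_edge by blast
  then show ?thesis using assms turns_left_iff[OF assms] coeff_nonzero(3)[of e]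
    by (auto simp: downstream_def flow_iff)
qed

lemma downstream_funpow_flow [simp]: "e \<in> flow \<Longrightarrow> (ds ^^ n) e \<in> flow"
  by (induction n) auto

text \<open>The direction of the last turn can be read off from the form reached.\<close>

lemma turns_left_downstream:
  assumes "e \<in> flow"
  shows "turns_left T e \<longleftrightarrow> cA (ds e) - cB (ds e) + cC (ds e) < 0"
proof -
  have "e \<in> E" using assms flow_edge by blast
  then show ?thesis using assms turns_left_iff[OF assms] coeff_nonzero(3)[of e]
    by (auto simp: downstream_def flow_iff)
qed

lemma form_downstream:
  assumes "e \<in> flow"
  shows "form_at T (ds e) = act (if turns_left T e then Tmat else Lmat) (form_at T e)"
  using assms labelling_left[OF lab] labelling_right[OF lab] flow_edge by (simp add: downstream_def)

lemma form_downstream_eq_iff: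
  assumes "e \<in> flow" "e' \<in> flow"
  shows "form_at T (ds e) = form_at T (ds e') \<longleftrightarrow> form_at T e = form_at T e'"
proof
  assume eq: "form_at T e = form_at T e'"
  then have "turns_left T e = turns_left T e'" using turns_left_iff assms by simp
  then show "form_at T (ds e) = form_at T (ds e')" using eq form_downstream assms by simp
next
  assume eq: "form_at T (ds e) = form_at T (ds e')"
  then have "turns_left T e = turns_left T e'" using turns_left_downstream assms by simp
  then obtain g where "g \<in> SL2Z" "act g (form_at T e) = act g (form_at T e')"
    using eq form_downstream assms by (metis Lmat_SL2Z Tmat_SL2Z)
  then show "form_at T e = form_at T e'" by (metis act_sinv(2))
qed

lemma downstream_inj:
  assumes "e \<in> flow" "e' \<in> flow" "ds e = ds e'"
  shows "e = e'"
proof -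
  have "turns_left T e = turns_left T e'" using turns_left_downstream assms by simp
  then show ?thesis using assms left_inj[of e e'] right_inj[of e e'] flow_edge
    by (simp add: downstream_def split: if_splits)
qed

lemma downstream_funpow_inj:
  "e \<in> flow \<Longrightarrow> e' \<in> flow \<Longrightarrow> (ds ^^ n) e = (ds ^^ n) e' \<Longrightarrow> e = e'"
  by (induction n) (auto dest: downstream_inj[rotated 2])

text \<open>The number \<open>cA e - cB e + cC e\<close> stands in the region behind the start of
  the edge, as \<open>cA e + cB e + cC e\<close> does in the one beyond its end.\<close>

definition upstream :: "'v \<times> 'v \<Rightarrow> 'v \<times> 'v" where
  "upstream e = (if cA e - cB e + cC e < 0 then prod.swap (right T (prod.swap e))
     else prod.swap (left T (prod.swap e)))"

lemma upstream_flow [simp]: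
  assumes "e \<in> flow"
  shows "upstream e \<in> flow"
proof -
  have "e \<in> E" using assms flow_edge by blast
  then show ?thesis using assms coeff_nonzero(4)[of e]
    by (auto simp: upstream_def flow_iff)
qed

lemma downstream_upstream [simp]:
  assumes "e \<in> flow"
  shows "ds (upstream e) = e"
proof -
  have e: "e \<in> E" using assms flow_edge by blast
  have "turns_left T (upstream e) \<longleftrightarrow> cA e - cB e + cC e < 0"
    using turns_left_iff[OF upstream_flow[OF assms]] e assms coeff_nonzero(4)[of e]
    by (auto simp: upstream_def flow_iff)
  then show ?thesis using e by (simp add: downstream_def upstream_def)
qed

lemma upstream_funpow_flow [simp]: "e \<in> flow \<Longrightarrow> (upstream ^^ n) e \<in> flow"
  by (induction n) auto

lemma downstream_upstream_funpow [simp]: "e \<in> flow \<Longrightarrow> (ds ^^ n) ((upstream ^^ n) e) = e"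
proof (induction n)
  case (Suc n)
  have "(ds ^^ Suc n) ((upstream ^^ Suc n) e) = (ds ^^ n) (ds (upstream ((upstream ^^ n) e)))"
    by (simp only: funpow_Suc_right[of n ds] funpow.simps(2)[where f = upstream] o_apply)
  then show ?case using Suc by simp
qed simp

subsection \<open>The river is a single path\<close>

text \<open>No edge beyond such an edge lies on the river.\<close>

definition outward :: "'v \<times> 'v \<Rightarrow> bool" where
  "outward e \<longleftrightarrow> cA e > 0 \<and> cB e > 0 \<and> cC e > 0 \<or> cA e < 0 \<and> cB e < 0 \<and> cC e < 0"

lemma outward_turn: "e \<in> E \<Longrightarrow> outward e \<Longrightarrow> outward (turn b e)"
  by (auto simp: outward_def turn_def)

text \<open>If the left branch is off the river, its numbers \<open>A\<close> and
  \<open>A + B + C\<close> are positive, and so is its middle coefficient \<open>2 * A + B\<close>,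
  the sum of both minus \<open>C\<close>. The right branch is symmetric.\<close>

lemma flow_turn:
  assumes "e \<in> flow"
  shows "turn b e = ds e \<or> outward (turn b e)"
proof -
  have "e \<in> E" using assms flow_edge by blast
  then show ?thesis using assms turns_left_iff[OF assms] coeff_nonzero(3)[of e]
    by (auto simp: turn_def downstream_def flow_iff outward_def)
qed

lemma flow_swap_turn:
  assumes "e \<in> flow"
  shows "turn b (prod.swap e) = prod.swap (upstream e) \<or> outward (turn b (prod.swap e))"
proof -
  have "e \<in> E" using assms flow_edge by blast
  then show ?thesis using assms coeff_nonzero(4)[of e]
    by (auto simp: turn_def upstream_def flow_iff outward_def)
qed

text \<open>Being outward is never lost, so a walk follows the sequence up to its first deviation
  and is outward from there on.\<close>

lemma walk_track:
  assumes "x 0 \<in> E" "\<And>n b. turn b (x n) = x (Suc n) \<or> outward (turn b (x n))"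
  shows "(\<exists>n. walk w (x 0) = x n) \<or> outward (walk w (x 0))"
proof (induction w rule: rev_induct)
  case (snoc b w)
  show ?case
  proof (cases "outward (walk w (x 0))")
    case True
    then show ?thesis using outward_turn assms(1) by simp
  next
    case False
    then obtain n where "walk w (x 0) = x n" using snoc by blast
    then show ?thesis using assms(2)[of b n] by auto
  qed
qed auto

lemma not_outward_flow: "e \<in> flow \<Longrightarrow> \<not> outward e" "prod.swap e \<in> flow \<Longrightarrow> \<not> outward e"
proof -
  show 1: "e \<in> flow \<Longrightarrow> \<not> outward e" for e by (auto simp: flow_iff outward_def)
  show "prod.swap e \<in> flow \<Longrightarrow> \<not> outward e"
    using flow_edge[of "prod.swap e"] by (auto simp: flow_iff outward_def)
qed

lemma outward_not_river: "outward e \<Longrightarrow> e \<notin> river T"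
  using not_outward_flow river_iff by blast

text \<open>The walk joining two river edges ends on the river, so it has never turned outward and
  must have followed the river.\<close>

lemma flow_orbit:
  assumes e: "e \<in> flow" and e': "e' \<in> flow"
  shows "\<exists>n. e' = (ds ^^ n) e \<or> e = (ds ^^ n) e'"
proof -
  obtain w y where y: "y \<in> {e, prod.swap e}" and w: "e' = walk w y \<or> prod.swap e' = walk w y"
    using edge_walk_cases[of e e'] e e' flow_edge by blast
  have "walk w y \<in> flow \<or> prod.swap (walk w y) \<in> flow" using w e' by (metis swap_swap)
  then have no: "\<not> outward (walk w y)" using not_outward_flow by blast
  from y consider "y = e" | "y = prod.swap e" by blast
  then show ?thesis
  proof cases
    case 1
    then obtain n where "walk w y = (ds ^^ n) e"
      using no walk_track[of "\<lambda>n. (ds ^^ n) e" w] flow_turn e flow_edge by auto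
    then have "walk w y \<in> flow" using e by simp
    then have "e' = walk w y" using w e' flow_swap by metis
    then show ?thesis using \<open>walk w y = (ds ^^ n) e\<close> by blast
  next
    case 2
    then obtain n where n: "walk w y = prod.swap ((upstream ^^ n) e)"
      using no walk_track[of "\<lambda>n. prod.swap ((upstream ^^ n) e)" w] flow_swap_turn e flow_edge by auto
    then have "prod.swap (walk w y) \<in> flow" using e by simp
    then have "e' = prod.swap (walk w y)" using w e' flow_swap by (metis swap_swap)
    then have "e = (ds ^^ n) e'" using n e by simp
    then show ?thesis by blast
  qed
qed

end

subsection \<open>Changing the labels\<close>

definition relabel :: "('v \<times> 'v \<Rightarrow> bqf) \<Rightarrow> 'v topograph \<Rightarrow> 'v topograph" where
  "relabel f T = T\<lparr>form_at := f\<rparr>"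

lemma relabel_simps [simp]:
  "form_at (relabel f T) = f" "adj (relabel f T) = adj T" "cw (relabel f T) = cw T"
  "left (relabel f T) = left T" "right (relabel f T) = right T"
  "oriented_edges (relabel f T) = oriented_edges T"
  "labelling (relabel f T) = labelling T"
  by (auto simp: relabel_def fun_eq_iff oriented_edges_def left_eq right_eq labelling_def)

lemma relabel_tree [simp]: "plane_cubic_tree (relabel f T) = plane_cubic_tree T"
  by (simp add: plane_cubic_tree_def)

abbreviation neg_top :: "'v topograph \<Rightarrow> 'v topograph" where
  "neg_top T \<equiv> relabel (neg \<circ> form_at T) T"

context topo
begin

lemma topo_neg: "topo (neg_top T)"
  using tree lab indef_form labelling_neg by unfold_locales auto

lemma river_neg: "river (neg_top T) = river T"
  by (auto simp: river_def)

lemma flow_neg: "e \<in> river_flow (neg_top T) \<longleftrightarrow> prod.swap e \<in> flow"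
proof -
  have "e \<in> river_flow (neg_top T) \<longleftrightarrow> e \<in> E \<and> cA e < 0 \<and> cC e > 0"
    using topo.flow_iff[OF topo_neg, of e] by auto
  also have "\<dots> \<longleftrightarrow> prod.swap e \<in> flow" by (auto simp: flow_iff)
  finally show ?thesis .
qed

text \<open>A descent: if the region ahead is positive too, \<open>B\<^sup>2 > 4 * A * C\<close>
  forces \<open>A + B\<close> or \<open>B + C\<close> to be negative, and the turn on that side
  lowers \<open>A + C\<close>.\<close>

lemma flow_exists_pos:
  "e \<in> E \<Longrightarrow> cA e > 0 \<Longrightarrow> cC e > 0 \<Longrightarrow> \<exists>e'. e' \<in> flow"
proof (induction "nat (cA e + cC e)" arbitrary: e rule: less_induct)
  case less
  \<comment> \<open>The descent works in the orientation with negative middle coefficient;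
    \<open>A + C\<close> is the same for both orientations.\<close>
  have *: "\<exists>e'. e' \<in> flow" if x: "x \<in> E" "cA x > 0" "cC x > 0" "cB x < 0" "cA x + cC x = cA e + cC e" for x
  proof (cases "cA x + cB x + cC x < 0")
    case True
    then have "left T x \<in> flow" using x by (simp add: flow_iff)
    then show ?thesis by blast
  next
    case False
    then have pos: "cA x + cB x + cC x > 0" using coeff_nonzero(3)[OF x(1)] by simp
    have D: "(cB x)\<^sup>2 > 4 * cA x * cC x"
      using indef_form[OF x(1)] by (simp add: indef_def discriminant_coeffs)
    have "cA x + cB x < 0 \<or> cB x + cC x < 0"
    proof (rule ccontr)
      assume "\<not> ?thesis"
      then have "- cB x \<le> cA x" "- cB x \<le> cC x" by auto
      then have "(- cB x) * (- cB x) \<le> cA x * cC x" using x by (intro mult_mono) auto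
      then show False using D mult_pos_pos[OF x(2,3)] by (simp add: power2_eq_square)
    qed
    then show ?thesis
    proof
      assume "cA x + cB x < 0"
      then show ?thesis using less.hyps[of "left T x"] pos x less.prems by simp
    next
      assume "cB x + cC x < 0"
      then show ?thesis using less.hyps[of "right T x"] pos x less.prems by simp
    qed
  qed
  have "cB e \<noteq> 0"
  proof
    assume "cB e = 0"
    then have "- (4 * cA e * cC e) > 0"
      using indef_form[OF less.prems(1)] by (simp add: indef_def discriminant_coeffs)
    then show False using mult_pos_pos[OF less.prems(2,3)] by simp
  qed
  then show ?case using *[of e] *[of "prod.swap e"] less.prems by fastforce
qed

lemma flow_exists: "\<exists>e. e \<in> flow"
proof -
  obtain e where e: "e \<in> E" using edge_at_vertex by blast
  interpret N: topo "neg_top T" by (rule topo_neg)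
  consider "cA e > 0" "cC e > 0" | "cA e < 0" "cC e < 0" | "e \<in> flow" | "prod.swap e \<in> flow"
    using coeff_nonzero[OF e] e by (simp add: flow_iff) linarith
  then show ?thesis
  proof cases
    case 2
    then show ?thesis using N.flow_exists_pos[of e] e flow_neg by auto
  qed (use flow_exists_pos e in blast)+
qed

end

section \<open>Periods of rivers\<close>

primrec mpow :: "int^2^2 \<Rightarrow> nat \<Rightarrow> int^2^2" where
  "mpow g 0 = mat 1"
| "mpow g (Suc n) = mpow g n ** g"

lemma mpow_SL2Z [simp]: "g \<in> SL2Z \<Longrightarrow> mpow g n \<in> SL2Z"
  by (induction n) auto

text \<open>By the theorem of Cayley and Hamilton a power of \<open>g\<close> is \<open>x g + y\<close>; a nonzero \<open>x\<close> makes the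
  power stabilise the same forms as \<open>g\<close> does.\<close>

lemma mpow_linear:
  assumes "g \<in> SL2Z" "g$1$1 + g$2$2 \<ge> 2"
  shows "\<exists>x y. x \<ge> 1 \<and> y \<ge> 1 - x \<and> mpow g (Suc n) = mat2 (x * g$1$1 + y) (x * g$1$2) (x * g$2$1) (x * g$2$2 + y)"
proof (induction n)
  case 0
  show ?case by (intro exI[of _ 1] exI[of _ 0]) (auto intro!: mat2_eqI)
next
  case (Suc n)
  then obtain x y where xy: "x \<ge> 1" "y \<ge> 1 - x"
    and g: "mpow g (Suc n) = mat2 (x * g$1$1 + y) (x * g$1$2) (x * g$2$1) (x * g$2$2 + y)" by blast
  let ?t = "g$1$1 + g$2$2"
  have det: "g$1$1 * g$2$2 = 1 + g$1$2 * g$2$1" using assms by (simp add: SL2Z_iff)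
  have "x * 2 \<le> x * ?t" by (rule mult_left_mono) (use xy assms(2) in auto)
  then have e: "x * ?t + y \<ge> x + 1" using xy by linarith
  have "mpow g (Suc (Suc n)) = mat2 ((x * ?t + y) * g$1$1 + - x) ((x * ?t + y) * g$1$2)
      ((x * ?t + y) * g$2$1) ((x * ?t + y) * g$2$2 + - x)"
    unfolding mpow.simps(2)[of g "Suc n"] g using det
    by (intro mat2_eqI) (simp_all add: algebra_simps)
  moreover have "x * ?t + y \<ge> 1" "- x \<ge> 1 - (x * ?t + y)" using e xy by linarith+
  ultimately show ?case by blast
qed

lemma stabiliser_root:
  assumes g: "g \<in> SL2Z" "g$1$1 + g$2$2 \<ge> 2" and "k > 0" "coeffA q \<noteq> 0"
    and act: "act (mpow g k) q = q"
  shows "act g q = q"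
proof -
  obtain n where "k = Suc n" using \<open>k > 0\<close> gr0_implies_Suc by blast
  then obtain x y where xy: "x \<ge> 1"
    and k: "mpow g k = mat2 (x * g$1$1 + y) (x * g$1$2) (x * g$2$1) (x * g$2$2 + y)"
    using mpow_linear[OF g] by blast
  have "x * (coeffB q * g$2$1) = x * (coeffA q * (g$2$2 - g$1$1))"
    "x * (coeffA q * g$1$2) = x * - (coeffC q * g$2$1)"
    using stabiliser_eqs(1,2)[OF mpow_SL2Z[OF g(1)] act] by (simp_all add: k algebra_simps)
  then have "coeffB q * g$2$1 = coeffA q * (g$2$2 - g$1$1)" "coeffA q * g$1$2 = - (coeffC q * g$2$1)"
    using xy by (metis mult_left_cancel not_one_le_zero)+
  then show ?thesis using assms by (intro stabiliser_intro)
qed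

context topo
begin

primrec path_matrix :: "nat \<Rightarrow> 'v \<times> 'v \<Rightarrow> int^2^2" where
  "path_matrix 0 e = mat 1"
| "path_matrix (Suc n) e = path_matrix n e ** (if turns_left T ((ds ^^ n) e) then Tmat else Lmat)"

lemma path_matrix_SL2Z [simp]: "path_matrix n e \<in> SL2Z"
  by (induction n) auto

lemma path_matrix_add: "path_matrix (n + m) e = path_matrix n e ** path_matrix m ((ds ^^ n) e)"
  by (induction m) (auto simp: matrix_mul_assoc funpow_add add.commute)

lemma path_matrix_transport:
  assumes "e \<in> flow"
  shows "transport T e (path_matrix n e) ((ds ^^ n) e)"
proof (induction n)
  case 0
  show ?case using flow_edge[OF assms] by (simp add: transport_def)
next
  case (Suc n)
  have e: "(ds ^^ n) e \<in> E" using assms flow_edge by simp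
  define x where "x = (ds ^^ n) e"
  show ?case using Suc e
    by (auto simp: transport_def act_mult downstream_def[of T x] labelling_left labelling_right
        simp flip: x_def)
qed

lemma path_matrix_nonneg:
  "path_matrix n e $1$1 \<ge> 1 \<and> path_matrix n e $1$2 \<ge> 0 \<and> path_matrix n e $2$1 \<ge> 0 \<and> path_matrix n e $2$2 \<ge> 1"
  by (induction n) (auto simp: Tmat_def Lmat_def)

lemma path_matrix_not_one: "n > 0 \<Longrightarrow> path_matrix n e $1$2 > 0 \<or> path_matrix n e $2$1 > 0"
proof (induction n)
  case (Suc n)
  then show ?case using path_matrix_nonneg[of n e] by (auto simp: Tmat_def Lmat_def)
qed simp

text \<open>On the river \<open>- 4 * A * C\<close> is positive, so the discriminant is a sum of two
  nonnegative terms and bounds all three coefficients.\<close>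

lemma flow_forms_finite: "finite (form_at T ` flow)"
proof -
  obtain e where e: "e \<in> E" using edge_at_vertex by blast
  define D where "D = discriminant (form_at T e)"
  have "form_at T ` flow \<subseteq> (\<lambda>(a, b, c). BQF a b c) ` ({-D..D} \<times> {-D..D} \<times> {-D..D})"
  proof
    fix q assume "q \<in> form_at T ` flow"
    then obtain x where x: "x \<in> flow" "q = form_at T x" by blast
    obtain a b c where q: "q = BQF a b c" by (cases q)
    have "discriminant q = D" using labelling_discriminant[OF lab e flow_edge[OF x(1)]] x D_def by simp
    then have D: "D = b\<^sup>2 - 4 * a * c" by (simp add: q)
    have ac: "a > 0" "c < 0" using x q flow_iff by (metis bqf.sel(1), metis bqf.sel(3))
    then have "a * 1 \<le> a * - c" "1 * - c \<le> a * - c" by (intro mult_mono; simp)+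
    then have "a \<le> - (a * c)" "- c \<le> - (a * c)" by simp_all
    moreover have "\<bar>b\<bar> \<le> b\<^sup>2"
    proof (cases "b = 0")
      case False
      then have "\<bar>b\<bar> * 1 \<le> \<bar>b\<bar> * \<bar>b\<bar>" by (intro mult_left_mono) auto
      then show ?thesis by (simp add: power2_eq_square)
    qed simp
    moreover have "b\<^sup>2 \<ge> 0" by simp
    ultimately have "\<bar>a\<bar> \<le> D" "\<bar>b\<bar> \<le> D" "\<bar>c\<bar> \<le> D" using D ac by linarith+
    then have "(a, b, c) \<in> {-D..D} \<times> {-D..D} \<times> {-D..D}" by (auto simp: abs_le_iff)
    then show "q \<in> (\<lambda>(a, b, c). BQF a b c) ` ({-D..D} \<times> {-D..D} \<times> {-D..D})"
      by (rule rev_image_eqI) (simp add: q)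
  qed
  then show ?thesis by (rule finite_subset) simp
qed

lemma river_forms_finite: "finite (form_at T ` river T)"
proof -
  have "river T \<subseteq> flow \<union> prod.swap ` flow" using river_iff by (metis UnI1 UnI2 image_eqI subsetI swap_swap)
  then have "form_at T ` river T \<subseteq> form_at T ` flow \<union> form_at T ` prod.swap ` flow" by blast
  moreover have "form_at T ` prod.swap ` flow = act Smat ` form_at T ` flow"
    unfolding image_image using labelling_swap[OF lab flow_edge] by (intro image_cong) auto
  ultimately show ?thesis
    by (metis finite_UnI finite_imageI finite_subset flow_forms_finite)
qed

lemma flow_all:
  assumes e: "e \<in> flow" and "P e" and P: "\<And>x. x \<in> flow \<Longrightarrow> P (ds x) \<longleftrightarrow> P x" and "x \<in> flow"
  shows "P x"
proof -
  have *: "P ((ds ^^ n) x) \<longleftrightarrow> P x" if "x \<in> flow" for n x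
    by (induction n) (use P that in auto)
  show ?thesis using flow_orbit[OF e \<open>x \<in> flow\<close>] * e assms(2,4) by metis
qed

text \<open>By the pigeonhole principle a form recurs along the river. A step downstream preserves
  and reflects equality of forms, so the recurrence spreads to the whole river.\<close>

lemma form_period: "\<exists>k>0. \<forall>e\<in>flow. form_at T ((ds ^^ k) e) = form_at T e"
proof -
  obtain e where e: "e \<in> flow" using flow_exists by blast
  have "finite (range (\<lambda>n. form_at T ((ds ^^ n) e)))"
    by (rule finite_subset[OF _ flow_forms_finite]) (use e in auto)
  then have "\<not> inj (\<lambda>n. form_at T ((ds ^^ n) e))" using finite_imageD by blast
  then obtain n m where "form_at T ((ds ^^ n) e) = form_at T ((ds ^^ m) e)" "n < m"
    unfolding inj_def by (metis linorder_neqE_nat)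
  then have k: "form_at T ((ds ^^ (m - n)) ((ds ^^ n) e)) = form_at T ((ds ^^ n) e)"
    by (simp flip: funpow_add[THEN fun_cong, unfolded o_apply])
  have "form_at T ((ds ^^ (m - n)) x) = form_at T x" if "x \<in> flow" for x
  proof (rule flow_all[where P = "\<lambda>x. form_at T ((ds ^^ (m - n)) x) = form_at T x", OF _ k _ that])
    fix y assume y: "y \<in> flow"
    have "(ds ^^ (m - n)) (ds y) = ds ((ds ^^ (m - n)) y)" by (simp add: funpow_swap1)
    then show "(form_at T ((ds ^^ (m - n)) (ds y)) = form_at T (ds y)) \<longleftrightarrow>
        (form_at T ((ds ^^ (m - n)) y) = form_at T y)"
      using form_downstream_eq_iff[OF downstream_funpow_flow[OF y] y] by simp
  qed (use e in simp)
  then show ?thesis using \<open>n < m\<close> by (metis zero_less_diff)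
qed

section \<open>Periods of the turns and periods of the forms\<close>

definition turn_period :: "nat \<Rightarrow> bool" where
  "turn_period n \<longleftrightarrow> (\<forall>e\<in>flow. turns_left T ((ds ^^ n) e) \<longleftrightarrow> turns_left T e)"

lemma form_turns_left:
  "e \<in> flow \<Longrightarrow> e' \<in> flow \<Longrightarrow> form_at T e = form_at T e' \<Longrightarrow> turns_left T e \<longleftrightarrow> turns_left T e'"
  using turns_left_iff by simp

lemma turn_period_path_matrix:
  assumes "turn_period n" "e \<in> flow"
  shows "path_matrix m ((ds ^^ n) e) = path_matrix m e"
proof (induction m)
  case (Suc m)
  have "(ds ^^ m) ((ds ^^ n) e) = (ds ^^ n) ((ds ^^ m) e)"
    by (metis funpow_add o_apply add.commute)
  then have "turns_left T ((ds ^^ m) ((ds ^^ n) e)) \<longleftrightarrow> turns_left T ((ds ^^ m) e)"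
    using assms by (simp add: turn_period_def)
  then show ?case using Suc by simp
qed simp

lemma turn_period_mult: "turn_period n \<Longrightarrow> turn_period (k * n)"
  by (induction k) (auto simp: turn_period_def funpow_add)

text \<open>Over \<open>k\<close> turn periods the matrix is the \<open>k\<close>-th power of that
  over one. If \<open>k\<close> is a period of the forms, the power stabilises the form, and then so
  does the matrix itself by \<open>stabiliser_root\<close>.\<close>

lemma turn_period_form:
  assumes "turn_period n" "e \<in> flow"
  shows "form_at T ((ds ^^ n) e) = form_at T e"
proof (cases "n = 0")
  case False
  obtain k where k: "k > 0" "\<forall>e\<in>flow. form_at T ((ds ^^ k) e) = form_at T e"
    using form_period by blast
  have "form_at T ((ds ^^ (j * k)) e) = form_at T e" for j
    by (induction j) (use k assms in \<open>auto simp: funpow_add\<close>)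
  then have kn: "form_at T ((ds ^^ (k * n)) e) = form_at T e" by (metis mult.commute)
  have "path_matrix (j * n) e = mpow (path_matrix n e) j" for j
  proof (induction j)
    case (Suc j)
    have "path_matrix (Suc j * n) e = path_matrix (j * n) e ** path_matrix n ((ds ^^ (j * n)) e)"
      by (simp add: path_matrix_add[symmetric] add.commute)
    then show ?case using Suc turn_period_path_matrix[OF turn_period_mult] assms by simp
  qed simp
  then have "act (mpow (path_matrix n e) k) (form_at T e) = form_at T e"
    using transportD[OF path_matrix_transport[OF assms(2)] lab, of "k * n"] kn by simp
  then have "act (path_matrix n e) (form_at T e) = form_at T e"
    using stabiliser_root[OF path_matrix_SL2Z _ k(1)] path_matrix_nonneg[of n e]
      coeff_nonzero(1) flow_edge assms(2) by fastforce
  then show ?thesis using transportD[OF path_matrix_transport[OF assms(2)] lab, of n] by simp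
qed simp

abbreviation "N \<equiv> river_period T"

lemma river_period: "N > 0 \<and> turn_period N"
proof -
  obtain k where "k > 0" "\<forall>e\<in>flow. form_at T ((ds ^^ k) e) = form_at T e"
    using form_period by blast
  then have "k > 0 \<and> turn_period k"
    unfolding turn_period_def using form_turns_left downstream_funpow_flow by blast
  then show ?thesis unfolding river_period_def turn_period_def by (rule LeastI)
qed

lemma turn_period_dvd:
  assumes "turn_period k"
  shows "N dvd k"
proof -
  have "turn_period (k mod N)"
    unfolding turn_period_def
  proof
    fix e assume e: "e \<in> flow"
    have "(ds ^^ k) e = (ds ^^ (k div N * N)) ((ds ^^ (k mod N)) e)"
      by (metis funpow_add o_apply div_mult_mod_eq)
    then have "turns_left T ((ds ^^ k) e) \<longleftrightarrow> turns_left T ((ds ^^ (k mod N)) e)"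
      using turn_period_mult[of N "k div N"] river_period e by (simp add: turn_period_def)
    then show "turns_left T ((ds ^^ (k mod N)) e) \<longleftrightarrow> turns_left T e"
      using assms e by (simp add: turn_period_def)
  qed
  moreover have "k mod N < N" using river_period by simp
  ultimately have "k mod N = 0"
    using not_less_Least[of "k mod N" "\<lambda>n. n > 0 \<and> turn_period n"]
    unfolding river_period_def turn_period_def by auto
  then show ?thesis by auto
qed

section \<open>Automorphisms that preserve all forms\<close>

definition form_auto :: "('v \<Rightarrow> 'v) \<Rightarrow> bool" where
  "form_auto \<sigma> \<longleftrightarrow> plane_iso T T \<sigma> \<and> (\<forall>e\<in>E. form_at T (map_prod \<sigma> \<sigma> e) = form_at T e)"

lemma form_auto_intro:
  assumes "plane_iso T T \<sigma>" "e \<in> E" "form_at T (map_prod \<sigma> \<sigma> e) = form_at T e"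
  shows "form_auto \<sigma>"
proof -
  have "form_at T (map_prod \<sigma> \<sigma> x) = form_at T x" if "x \<in> E" for x
    using assms(2) that
  proof (induction rule: edge_induct)
    case base
    then show ?case by (rule assms)
  next
    case (swap x)
    then show ?case using labelling_swap[OF lab] plane_iso_edge[OF assms(1)] by (simp add: map_prod_swap)
  next
    case (left x)
    then show ?case using labelling_left[OF lab] plane_iso_edge[OF assms(1)] plane_iso_left[OF assms(1)] by simp
  qed
  then show ?thesis using assms(1) by (simp add: form_auto_def)
qed

lemma form_auto_exists:
  assumes "e \<in> E" "e' \<in> E" "form_at T e = form_at T e'"
  shows "\<exists>\<sigma>. form_auto \<sigma> \<and> map_prod \<sigma> \<sigma> e = e'"
  using plane_iso_exists[OF tree tree assms(1,2)] form_auto_intro assms by metis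

lemma form_auto_edge: "form_auto \<sigma> \<Longrightarrow> map_prod \<sigma> \<sigma> e \<in> E \<longleftrightarrow> e \<in> E"
  using plane_iso_edge[of T T \<sigma> e] by (simp add: form_auto_def)

lemma form_auto_flow: "form_auto \<sigma> \<Longrightarrow> e \<in> flow \<Longrightarrow> map_prod \<sigma> \<sigma> e \<in> flow"
  using form_auto_edge[of \<sigma> e] by (simp add: flow_iff form_auto_def)

lemma form_auto_downstream:
  assumes "form_auto \<sigma>" "e \<in> flow"
  shows "map_prod \<sigma> \<sigma> (ds e) = ds (map_prod \<sigma> \<sigma> e)"
proof -
  have e: "e \<in> E" using assms flow_edge by blast
  have iso: "plane_iso T T \<sigma>" using assms(1) by (simp add: form_auto_def)
  have "turns_left T (map_prod \<sigma> \<sigma> e) \<longleftrightarrow> turns_left T e"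
    using form_turns_left[OF form_auto_flow[OF assms] assms(2)] assms(1) e by (simp add: form_auto_def)
  then show ?thesis using plane_iso_left[OF iso e] plane_iso_right[OF iso e] by (simp add: downstream_def)
qed

lemma form_auto_flow_shift:
  assumes "form_auto \<sigma>" "e \<in> flow" "map_prod \<sigma> \<sigma> e = (ds ^^ k) e" "x \<in> flow"
  shows "map_prod \<sigma> \<sigma> x = (ds ^^ k) x"
proof (rule flow_all[where P = "\<lambda>x. map_prod \<sigma> \<sigma> x = (ds ^^ k) x", OF assms(2,3) _ assms(4)])
  fix y assume y: "y \<in> flow"
  have "(ds ^^ k) (ds y) = ds ((ds ^^ k) y)" by (simp add: funpow_swap1)
  then show "(map_prod \<sigma> \<sigma> (ds y) = (ds ^^ k) (ds y)) \<longleftrightarrow> (map_prod \<sigma> \<sigma> y = (ds ^^ k) y)"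
    using form_auto_downstream[OF assms(1) y] downstream_inj form_auto_flow[OF assms(1) y]
      downstream_funpow_flow[OF y] by metis
qed

abbreviation "\<tau> \<equiv> river_shift T"

text \<open>Existence comes from \<open>turn_period_form\<close>, which lets an automorphism move
  one edge by a period; uniqueness from the rigidity of isomorphisms.\<close>

lemma river_shift: "form_auto \<tau> \<and> (\<forall>e\<in>flow. map_prod \<tau> \<tau> e = (ds ^^ N) e)"
proof -
  obtain e where e: "e \<in> flow" using flow_exists by blast
  obtain \<sigma> where \<sigma>: "form_auto \<sigma>" "map_prod \<sigma> \<sigma> e = (ds ^^ N) e"
    using form_auto_exists[of e "(ds ^^ N) e"] turn_period_form[of N e] river_period e flow_edge by auto
  have "form_auto \<tau> \<and> (\<forall>e\<in>flow. map_prod \<tau> \<tau> e = (ds ^^ N) e)"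
    unfolding river_shift_def form_auto_def
  proof (rule theI2[where a = \<sigma>])
    show *: "plane_iso T T \<sigma> \<and> (\<forall>e\<in>E. form_at T (map_prod \<sigma> \<sigma> e) = form_at T e) \<and>
      (\<forall>e\<in>flow. map_prod \<sigma> \<sigma> e = (ds ^^ N) e)"
      using \<sigma>(1) form_auto_flow_shift[OF \<sigma>(1) e \<sigma>(2)] by (simp add: form_auto_def)
    show "x = \<sigma>" if "plane_iso T T x \<and> (\<forall>e\<in>E. form_at T (map_prod x x e) = form_at T e) \<and>
      (\<forall>e\<in>flow. map_prod x x e = (ds ^^ N) e)" for x
      by (rule plane_iso_unique[of T x \<sigma> e]) (use that * e flow_edge in auto)
  qed blast
  then show ?thesis .
qed

end

subsection \<open>Iterates\<close>

lemma iterate_0 [simp]: "iterate f 0 = id" and iterate_1 [simp]: "iterate f 1 = f"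
  by (simp_all add: iterate_def)

lemma iterate_step:
  assumes "bij f"
  shows "iterate f (k + 1) = f \<circ> iterate f k" "iterate f (k - 1) = inv f \<circ> iterate f k"
proof -
  have *: "f (inv f x) = x" "inv f (f x) = x" for x
    using assms by (simp_all add: bij_is_surj surj_f_inv_f bij_is_inj)
  have up: "iterate f (k + 1) = f \<circ> iterate f k" for k
  proof (cases "k \<ge> 0")
    case True
    then show ?thesis by (simp add: iterate_def nat_add_distrib)
  next
    case False
    then obtain m where "nat (- k) = Suc m" using gr0_implies_Suc[of "nat (- k)"] by auto
    then have "k = - int m - 1" by linarith
    then show ?thesis by (cases m) (simp_all add: iterate_def fun_eq_iff * nat_add_distrib)
  qed
  show "iterate f (k + 1) = f \<circ> iterate f k" by (rule up)
  show "iterate f (k - 1) = inv f \<circ> iterate f k" using up[of "k - 1"] by (simp add: fun_eq_iff *)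
qed

lemma iterate_add:
  assumes "bij f"
  shows "iterate f (a + b) = iterate f a \<circ> iterate f b"
proof (induction a rule: int_induct[of _ 0])
  case (step1 i)
  have "i + 1 + b = (i + b) + 1" by simp
  then show ?case by (simp only: iterate_step[OF assms] step1.IH o_assoc)
next
  case (step2 i)
  have "i - 1 + b = (i + b) - 1" by simp
  then show ?case by (simp only: iterate_step[OF assms] step2.IH o_assoc)
qed simp

lemma iterate_minus:
  assumes "bij f"
  shows "iterate f (- a) \<circ> iterate f a = id" "iterate f a \<circ> iterate f (- a) = id"
  using iterate_add[OF assms, of "- a" a] iterate_add[OF assms, of a "- a"] by simp_all

lemma iterate_minus_apply:
  assumes "bij f"
  shows "iterate f (- a) (iterate f a x) = x" "iterate f a (iterate f (- a) x) = x"
  using iterate_minus[OF assms, of a] by (metis comp_apply id_apply)+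

lemma iterate_of_nat: "iterate f (int n) = f ^^ n"
  by (simp add: iterate_def)

lemma iterate_closed:
  assumes "P id" "\<And>g. P g \<Longrightarrow> P (f \<circ> g)" "\<And>g. P g \<Longrightarrow> P (inv f \<circ> g)"
  shows "P (iterate f k)"
proof -
  have "P (f ^^ n)" "P (inv f ^^ n)" for n by (induction n) (use assms in auto)
  then show ?thesis by (simp add: iterate_def)
qed

context topo
begin

lemma form_auto_bij: "form_auto \<sigma> \<Longrightarrow> bij \<sigma>"
  by (simp add: form_auto_def plane_iso_def)

lemma form_auto_comp: "form_auto \<sigma> \<Longrightarrow> form_auto \<rho> \<Longrightarrow> form_auto (\<sigma> \<circ> \<rho>)"
  using plane_iso_comp plane_iso_edge unfolding form_auto_def map_prod_comp by metis

lemma form_auto_inv: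
  assumes "form_auto \<sigma>"
  shows "form_auto (inv \<sigma>)"
proof -
  have i: "plane_iso T T (inv \<sigma>)" using assms plane_iso_inv by (auto simp: form_auto_def)
  obtain e where e: "e \<in> E" using edge_at_vertex by blast
  then have e': "map_prod \<sigma> \<sigma> e \<in> E" using assms form_auto_edge by blast
  show ?thesis
    by (rule form_auto_intro[OF i e'])
      (use assms e map_prod_inv(2)[OF form_auto_bij[OF assms]] in \<open>simp add: form_auto_def\<close>)
qed

lemma form_auto_id: "form_auto id"
  by (simp add: form_auto_def map_prod.id)

lemma bij_shift: "bij \<tau>"
  using form_auto_bij river_shift by blast

lemma form_auto_iterate: "form_auto (iterate \<tau> k)"
proof (rule iterate_closed[where P = form_auto])
  have \<tau>: "form_auto \<tau>" using river_shift by blast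
  show "form_auto (\<tau> \<circ> g)" "form_auto (inv \<tau> \<circ> g)" if "form_auto g" for g
    using form_auto_comp[OF \<tau> that] form_auto_comp[OF form_auto_inv[OF \<tau>] that] .
qed (rule form_auto_id)

text \<open>Moving the river by \<open>k\<close> steps while keeping the forms makes
  \<open>k\<close> a period of the turns, hence a multiple of the least one.\<close>

lemma form_auto_downstream_iterate:
  assumes "form_auto \<sigma>" "e \<in> flow" "map_prod \<sigma> \<sigma> e = (ds ^^ k) e"
  shows "\<exists>j. \<sigma> = iterate \<tau> j"
proof -
  have "turn_period k"
    unfolding turn_period_def
  proof
    fix x assume x: "x \<in> flow"
    have "map_prod \<sigma> \<sigma> x = (ds ^^ k) x" using form_auto_flow_shift[OF assms x] .
    then have "form_at T ((ds ^^ k) x) = form_at T x"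
      using assms(1) flow_edge[OF x] unfolding form_auto_def by metis
    then show "turns_left T ((ds ^^ k) x) \<longleftrightarrow> turns_left T x"
      using form_turns_left[OF downstream_funpow_flow[OF x] x] by blast
  qed
  then obtain j where k: "k = N * j" using turn_period_dvd by (auto simp: dvd_def)
  have "map_prod (\<tau> ^^ j) (\<tau> ^^ j) e = (ds ^^ (N * j)) e"
  proof (induction j)
    case (Suc j)
    have "map_prod (\<tau> ^^ Suc j) (\<tau> ^^ Suc j) e = map_prod \<tau> \<tau> ((ds ^^ (N * j)) e)"
      unfolding funpow.simps map_prod_comp Suc ..
    also have "\<dots> = (ds ^^ N) ((ds ^^ (N * j)) e)" using river_shift assms(2) by simp
    finally show ?case unfolding mult_Suc_right funpow_add o_apply .
  qed (simp add: map_prod.id)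
  then have "\<sigma> = \<tau> ^^ j"
    using plane_iso_unique[of T \<sigma> "\<tau> ^^ j" e] assms flow_edge form_auto_iterate[of "int j"] k
    by (simp add: form_auto_def iterate_of_nat)
  then show ?thesis using iterate_of_nat by metis
qed

lemma form_auto_iff: "form_auto \<sigma> \<longleftrightarrow> (\<exists>k. \<sigma> = iterate \<tau> k)"
proof
  assume \<sigma>: "form_auto \<sigma>"
  obtain e where e: "e \<in> flow" using flow_exists by blast
  let ?e = "map_prod \<sigma> \<sigma> e"
  have "?e \<in> flow" using form_auto_flow \<sigma> e by blast
  then consider n where "?e = (ds ^^ n) e" | n where "e = (ds ^^ n) ?e" using flow_orbit e by blast
  then show "\<exists>k. \<sigma> = iterate \<tau> k"
  proof cases
    case 1
    then show ?thesis using form_auto_downstream_iterate \<sigma> e by blast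
  next
    case 2
    then have "map_prod (inv \<sigma>) (inv \<sigma>) ?e = (ds ^^ n) ?e"
      using map_prod_inv(2)[OF form_auto_bij[OF \<sigma>], of e] by simp
    then obtain j where j: "inv \<sigma> = iterate \<tau> j"
      using form_auto_downstream_iterate[OF form_auto_inv[OF \<sigma>] \<open>?e \<in> flow\<close>] by blast
    have "iterate \<tau> (- j) = \<sigma>"
    proof
      fix x
      have "iterate \<tau> j (\<sigma> x) = x" using j form_auto_bij[OF \<sigma>] by (metis bij_is_inj inv_f_f)
      then show "iterate \<tau> (- j) x = \<sigma> x" using iterate_minus_apply(1)[OF bij_shift, of j "\<sigma> x"] by simp
    qed
    then show ?thesis by metis
  qed
qed (use form_auto_iterate in blast)

text \<open>Lets forms stand for edges modulo the period: a superimposition modulo the shifts of the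
  target tree is known from the form met at one edge.\<close>

lemma same_form_iff:
  assumes "e \<in> E" "e' \<in> E"
  shows "form_at T e = form_at T e' \<longleftrightarrow> (\<exists>k. e' = map_prod (iterate \<tau> k) (iterate \<tau> k) e)"
proof
  assume "form_at T e = form_at T e'"
  then show "\<exists>k. e' = map_prod (iterate \<tau> k) (iterate \<tau> k) e"
    using form_auto_exists[OF assms] form_auto_iff by metis
next
  assume "\<exists>k. e' = map_prod (iterate \<tau> k) (iterate \<tau> k) e"
  then show "form_at T e = form_at T e'" using form_auto_iterate assms(1) by (auto simp: form_auto_def)
qed

end

section \<open>Two labellings of one tree\<close>

text \<open>A negative product of the outer coefficients makes \<open>coeffB q\<close> smaller in
  absolute value than the square root of the discriminant. For a downstream edge the geodesic thus
  crosses the imaginary axis from left to right.\<close>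

lemma roots_sign:
  assumes "indef (discriminant q)" "coeffA q > 0" "coeffC q < 0"
  shows "first_root q > 0" "second_root q < 0"
proof -
  let ?s = "sqrt (of_int (discriminant q))"
  have "(coeffB q)\<^sup>2 < discriminant q"
    using mult_pos_neg[OF assms(2,3)] by (simp add: discriminant_coeffs)
  then have "(of_int (coeffB q))\<^sup>2 < (of_int (discriminant q) :: real)"
    by (metis of_int_less_iff of_int_power)
  then have "\<bar>of_int (coeffB q)\<bar> < ?s" using real_less_rsqrt by (metis power2_abs)
  then have "- of_int (coeffB q) + ?s > 0" "- of_int (coeffB q) - ?s < 0" by linarith+
  then show "first_root q > 0" "second_root q < 0" using assms(2)
    by (simp_all add: first_root_def second_root_def divide_pos_pos divide_neg_pos del: uminus_add_conv_diff)
qed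

text \<open>\<open>P\<close> stands for the labelling of the other topograph, pulled back to the
  tree of \<open>T\<close>; the superimposition then becomes the identity.\<close>

locale topo_pair = topo T + P: topo P for T P :: "'v topograph" +
  assumes same: "adj P = adj T" "cw P = cw T"
begin

lemma left_P: "left P = left T" and right_P: "right P = right T"
  by (simp_all add: fun_eq_iff left_eq right_eq same)

lemma E_P: "oriented_edges P = E"
  by (simp add: oriented_edges_def same)

lemma turn_P: "P.turn = turn"
  by (simp add: fun_eq_iff turn_def P.turn_def left_P right_P)

lemmas coeff_P [simp] = P.coeff_left[unfolded left_P E_P] P.coeff_right[unfolded right_P E_P]
  P.coeff_swap[unfolded E_P]

lemma labelling_P: "labelling T (form_at P)"
  using P.lab by (simp add: labelling_def E_P left_P)

lemma pair_neg: "topo_pair (neg_top T) P" and pair_neg_P: "topo_pair T (neg_top P)"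
  using topo_neg P.topo_neg topo_axioms P.topo_axioms same
  by (simp_all add: topo_pair_def topo_pair_axioms_def)

definition alpha :: "'v \<times> 'v \<Rightarrow> real" where
  "alpha e = sgn (rval (form_at P e) (first_root (form_at T e)))"

definition beta :: "'v \<times> 'v \<Rightarrow> real" where
  "beta e = sgn (rval (form_at P e) (second_root (form_at T e)))"

lemma alpha_const: "e \<in> E \<Longrightarrow> e' \<in> E \<Longrightarrow> alpha e = alpha e'"
  and beta_const: "e \<in> E \<Longrightarrow> e' \<in> E \<Longrightarrow> beta e = beta e'"
proof -
  assume e: "e \<in> E" "e' \<in> E"
  then obtain g where g: "transport T e g e'" using transport_exists by blast
  note t = transportD[OF g lab] transportD[OF g labelling_P]
  show "alpha e = alpha e'" "beta e = beta e'"
    unfolding alpha_def beta_def t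
    using rval_root_act[OF indef_form[OF e(1)] transport_SL2Z[OF g]] by simp_all
qed

text \<open>The first root is positive on a downstream edge, and a polynomial with coefficients of
  one sign keeps that sign at positive arguments.\<close>

lemma alpha_outward:
  assumes "e \<in> flow" "P.outward e"
  shows "alpha e = sgn (of_int (P.cA e))"
proof -
  let ?x = "first_root (form_at T e)"
  have x: "?x > 0" using roots_sign assms(1) indef_form by (simp add: flow_iff)
  consider "P.cA e > 0" "P.cB e > 0" "P.cC e > 0" | "P.cA e < 0" "P.cB e < 0" "P.cC e < 0"
    using assms(2) by (auto simp: P.outward_def)
  then show ?thesis
  proof cases
    case 1
    then have "rval (form_at P e) ?x > 0" using x by (simp add: rval_def add_pos_pos)
    then show ?thesis using 1 by (simp add: alpha_def)
  next
    case 2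
    then have "rval (form_at P e) ?x < 0" using x
      unfolding rval_def by (intro add_neg_neg mult_neg_pos) auto
    then show ?thesis using 2 by (simp add: alpha_def)
  qed
qed

lemma alpha_beta_neg:
  "topo_pair.alpha (neg_top T) P e = beta e"
  "topo_pair.alpha T (neg_top P) e = - alpha e"
  "topo_pair.beta T (neg_top P) e = - beta e"
proof -
  interpret N: topo_pair "neg_top T" P by (rule pair_neg)
  interpret M: topo_pair T "neg_top P" by (rule pair_neg_P)
  show "N.alpha e = beta e" "M.alpha e = - alpha e" "M.beta e = - beta e"
    by (simp_all add: N.alpha_def M.alpha_def M.beta_def alpha_def beta_def sgn_minus)
qed


lemma beta_outward:
  assumes "e \<in> flow" "P.outward (prod.swap e)"
  shows "beta e = sgn (of_int (P.cC e))"
proof -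
  interpret N: topo_pair "neg_top T" P by (rule pair_neg)
  have e: "e \<in> E" using assms(1) flow_edge by blast
  have "N.alpha (prod.swap e) = sgn (of_int (P.cA (prod.swap e)))"
    by (rule N.alpha_outward) (use assms flow_neg in simp_all)
  then show ?thesis using alpha_beta_neg(1)[of "prod.swap e"] beta_const[of e "prod.swap e"] e by simp
qed

section \<open>Banks of one river and the signs at the roots of the other form\<close>

lemma left_bank_outward: "left_bank P v u \<Longrightarrow> (v, u) \<in> E \<and> P.outward (v, u) \<and> P.cA (v, u) > 0"
  and right_bank_outward: "right_bank P v u \<Longrightarrow> (v, u) \<in> E \<and> P.outward (v, u) \<and> P.cA (v, u) < 0"
proof -
  have *: "x \<in> E \<and> P.outward x" if "d \<in> P.flow" "turn b d = x" "x \<notin> river P" for d b x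
    using P.flow_turn[OF that(1), of b] P.river_iff[of x] P.downstream_flow[OF that(1)]
      P.turn_edge[OF P.flow_edge[OF that(1)], of b] that(2,3) by (auto simp: turn_P E_P)
  show "left_bank P v u \<Longrightarrow> (v, u) \<in> E \<and> P.outward (v, u) \<and> P.cA (v, u) > 0"
    using *[of _ True "(v, u)"] P.coeff_left(1)
    by (auto simp: left_bank_def turn_def left_P P.flow_iff)
  show "right_bank P v u \<Longrightarrow> (v, u) \<in> E \<and> P.outward (v, u) \<and> P.cA (v, u) < 0"
    using *[of _ False "(v, u)"] P.coeff_right(3)
    by (auto simp: right_bank_def turn_def right_P P.flow_iff P.outward_def)
qed

lemma bank_beta:
  assumes "e \<in> E" "(u, v) \<in> flow"
  shows "left_bank P v u \<Longrightarrow> beta e = 1" "right_bank P v u \<Longrightarrow> beta e = - 1"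
proof -
  have E: "(u, v) \<in> E" using assms(2) flow_edge by blast
  have "P.cC (u, v) = P.cA (v, u)" using coeff_P(7)[of "(u, v)"] E by simp
  then have "beta e = sgn (of_int (P.cA (v, u)))" if "P.outward (v, u)"
    using beta_outward[OF assms(2)] that beta_const[OF assms(1) E] by simp
  then show "left_bank P v u \<Longrightarrow> beta e = 1" "right_bank P v u \<Longrightarrow> beta e = - 1"
    using left_bank_outward[of v u] right_bank_outward[of v u] by auto
qed

lemma bank_alpha:
  assumes "e \<in> E" "(v, w) \<in> flow"
  shows "left_bank P v w \<Longrightarrow> alpha e = 1" "right_bank P v w \<Longrightarrow> alpha e = - 1"
  using alpha_outward[OF assms(2)] alpha_const[OF assms(1) flow_edge[OF assms(2)]]
    left_bank_outward[of v w] right_bank_outward[of v w] by auto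

lemma bank_cases:
  assumes x: "x \<in> river P" and e: "e \<in> E" "e \<notin> river P" "fst x = fst e"
  shows "left_bank P (fst e) (snd e) \<or> right_bank P (fst e) (snd e)"
proof -
  \<comment> \<open>\<open>d\<close> is the river edge that flows into the vertex; an edge off the
    river must be one of its two branches.\<close>
  obtain d where d: "d \<in> P.flow" "snd d = fst x"
  proof (cases "x \<in> P.flow")
    case True
    have "snd (P.upstream x) = fst (downstream P (P.upstream x))" by (simp add: downstream_def)
    then show ?thesis using that[of "P.upstream x"] True by simp
  next
    case False
    then show ?thesis using that[of "prod.swap x"] x P.river_iff by auto
  qed
  have "d \<in> P.E" "e \<in> P.E" "fst e = snd d" using d e P.flow_edge by (simp_all add: E_P)
  then consider "e = prod.swap d" | "e = left P d" | "e = right P d" by (rule P.successor_cases)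
  then show ?thesis
  proof cases
    case 1
    then show ?thesis using d e P.river_iff by simp
  next
    case 2
    then show ?thesis using d e unfolding left_bank_def by (metis prod.collapse)
  next
    case 3
    then show ?thesis using d e unfolding right_bank_def by (metis prod.collapse)
  qed
qed

text \<open>The first edge off the river is outward, and outward edges lead only to outward ones. So
  a common stretch of the rivers has no gaps.\<close>

lemma leave_river:
  assumes "d \<in> river P" "d \<in> flow" "ds d \<notin> river P"
  shows "(ds ^^ Suc n) d \<notin> river P"
proof -
  have E: "ds d \<in> E" using assms(2) flow_edge downstream_flow by blast
  have "prod.swap d \<in> river P" using assms(1) P.river_iff by auto
  then have "left_bank P (fst (ds d)) (snd (ds d)) \<or> right_bank P (fst (ds d)) (snd (ds d))"
    using bank_cases[of "prod.swap d" "ds d"] E assms(3) by (simp add: downstream_def)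
  then have o: "P.outward (ds d)" using left_bank_outward right_bank_outward by fastforce
  have "P.outward ((ds ^^ n) (ds d))"
  proof (induction n)
    case (Suc n)
    let ?x = "(ds ^^ n) (ds d)"
    have "?x \<in> E" using assms(2) flow_edge downstream_funpow_flow downstream_flow by blast
    then have "P.outward (turn b ?x)" for b using P.outward_turn[of ?x b] Suc by (simp add: E_P turn_P)
    moreover have "ds ?x = turn (turns_left T ?x) ?x" by (simp add: turn_def downstream_def)
    ultimately show ?case by simp
  qed (use o in simp)
  then show ?thesis using P.outward_not_river by (simp add: funpow_swap1)
qed

subsection \<open>Crossing forces opposite signs\<close>

lemma cross_signs:
  assumes "rivers_cross P T id" "e \<in> E"
  shows "alpha e * beta e < 0"
proof -
  obtain u p w where S: "(u, hd p) \<in> flow" "(last p, w) \<in> flow"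
    and b: "left_bank P (hd p) u \<and> right_bank P (last p) w \<or> right_bank P (hd p) u \<and> left_bank P (last p) w"
    using assms(1) unfolding rivers_cross_def map_prod.id image_id id_apply Let_def by blast
  from b show ?thesis
    using bank_alpha[OF assms(2) S(2)] bank_beta[OF assms(2) S(1)] by auto
qed

subsection \<open>Opposite signs force a crossing\<close>

text \<open>A form with positive outer coefficients that is negative at a positive root has a
  negative middle coefficient. Applied to the next edge, this makes the sum of the outer ones drop
  as long as the river of \<open>P\<close> is not reached.\<close>

lemma alpha_descent:
  assumes "e \<in> flow" "P.cA e > 0" "P.cC e > 0" "alpha e = - 1"
  shows "\<exists>x\<in>flow. x \<in> river P"
  using assms
proof (induction "nat (P.cA e + P.cC e)" arbitrary: e rule: less_induct)
  case less
  have B: "P.cB x < 0" if "x \<in> flow" "P.cA x > 0" "P.cC x > 0" "alpha x = - 1" for x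
  proof (rule ccontr)
    assume "\<not> P.cB x < 0"
    moreover have "first_root (form_at T x) > 0" using roots_sign that(1) indef_form by (simp add: flow_iff)
    ultimately have "rval (form_at P x) (first_root (form_at T x)) > 0"
      using that unfolding rval_def by (intro add_pos_pos add_pos_nonneg mult_pos_pos) auto
    then show False using that(4) by (simp add: alpha_def)
  qed
  have e: "e \<in> E" using less.prems flow_edge by blast
  have ds: "ds e \<in> flow" "ds e \<in> E" using less.prems flow_edge downstream_flow by blast+
  have al: "alpha (ds e) = - 1" using alpha_const[OF e ds(2)] less.prems by simp
  show ?case
  proof (cases "ds e \<in> river P")
    case True
    then show ?thesis using ds by blast
  next
    case False
    let ?s = "P.cA e + P.cB e + P.cC e"
    have "?s \<noteq> 0" using P.coeff_nonzero(3)[of e] e E_P by simp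
    have lr: "turns_left T e \<and> ds e = left T e \<or> \<not> turns_left T e \<and> ds e = right T e"
      by (simp add: downstream_def)
    have "P.cA (ds e) * P.cC (ds e) \<ge> 0" using False ds(2) by (simp add: river_def E_P)
    then have s: "?s > 0" using \<open>?s \<noteq> 0\<close> lr less.prems(2,3) e by (auto simp: zero_le_mult_iff)
    then have "P.cA (ds e) > 0" "P.cC (ds e) > 0" using lr less.prems e by auto
    \<comment> \<open>After a left turn \<open>B'\<close> says \<open>2 * A + B < 0\<close>, so the
      new sum \<open>2 * A + B + C\<close> is below \<open>C\<close>; a right turn is
      symmetric.\<close>
    note B' = B[OF ds(1) this al]
    have "P.cA (ds e) + P.cC (ds e) < P.cA e + P.cC e" using lr B' e less.prems by auto
    then show ?thesis
      using less.hyps[OF _ ds(1) \<open>P.cA (ds e) > 0\<close> \<open>P.cC (ds e) > 0\<close> al] less.prems by simp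
  qed
qed

text \<open>Of two opposite signs one is negative; the descent then runs downstream towards the
  first root or upstream towards the second.\<close>

lemma shared_edge_pos:
  assumes "alpha e * beta e < 0" "e \<in> flow" "P.cA e > 0" "P.cC e > 0"
  shows "\<exists>x\<in>flow. x \<in> river P"
proof -
  interpret N: topo_pair "neg_top T" P by (rule pair_neg)
  have e: "e \<in> E" using assms flow_edge by blast
  have "alpha e = - 1 \<or> beta e = - 1"
    using assms(1) by (auto simp: alpha_def beta_def sgn_if split: if_splits)
  then show ?thesis
  proof
    assume "alpha e = - 1"
    then show ?thesis using alpha_descent assms by blast
  next
    assume b: "beta e = - 1"
    have "N.alpha (prod.swap e) = - 1" using alpha_beta_neg(1) beta_const[of e "prod.swap e"] e b by simp
    moreover have "prod.swap e \<in> N.flow" using flow_neg assms(2) by simp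
    ultimately obtain x where "x \<in> N.flow" "x \<in> river P"
      using N.alpha_descent[of "prod.swap e"] assms e by auto
    then show ?thesis using flow_neg P.river_iff by (metis swap_swap)
  qed
qed

lemma shared_edge:
  assumes "alpha e * beta e < 0" "e \<in> E"
  shows "\<exists>x\<in>flow. x \<in> river P"
proof -
  interpret M: topo_pair T "neg_top P" by (rule pair_neg_P)
  obtain y where y: "y \<in> flow" using flow_exists by blast
  then have yE: "y \<in> E" using flow_edge by blast
  have ab: "alpha y * beta y < 0" using assms alpha_const beta_const yE by metis
  consider "P.cA y > 0 \<and> P.cC y > 0" | "P.cA y < 0 \<and> P.cC y < 0" | "y \<in> river P"
  proof -
    have "P.cA y \<noteq> 0" "P.cC y \<noteq> 0" using P.coeff_nonzero(1,2)[of y] yE E_P by auto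
    moreover have "y \<in> river P \<longleftrightarrow> P.cA y * P.cC y < 0" using yE by (simp add: river_def E_P)
    ultimately show ?thesis using that unfolding mult_less_0_iff by linarith
  qed
  then show ?thesis
  proof cases
    case 1
    then show ?thesis using shared_edge_pos ab y by blast
  next
    case 2
    have "M.alpha y * M.beta y < 0" using ab alpha_beta_neg by simp
    then show ?thesis using M.shared_edge_pos[of y] y 2 P.river_neg by simp
  next
    case 3
    then show ?thesis using y by blast
  qed
qed

text \<open>An endless common stretch would repeat a pair of forms, so one matrix would stabilise
  both and they would share a root, where \<open>alpha\<close> is 0.\<close>

lemma diverge:
  assumes "e \<in> flow" "alpha e \<noteq> 0"
  shows "\<exists>n. (ds ^^ n) e \<notin> river P"
proof (rule ccontr)
  assume "\<not> ?thesis"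
  then have all: "(ds ^^ n) e \<in> river P" for n by blast
  let ?F = "\<lambda>n. (form_at T ((ds ^^ n) e), form_at P ((ds ^^ n) e))"
  have "range ?F \<subseteq> (form_at T ` flow) \<times> (form_at P ` river P)" using all assms(1) by auto
  then have "finite (range ?F)" by (rule finite_subset) (simp add: P.river_forms_finite flow_forms_finite)
  then have "\<not> inj ?F" using finite_imageD by blast
  then obtain n m where nm: "?F n = ?F m" "n < m" unfolding inj_def by (metis linorder_neqE_nat)
  define x where "x = (ds ^^ n) e"
  define g where "g = path_matrix (m - n) x"
  have x: "x \<in> flow" using assms(1) by (simp add: x_def)
  then have xE: "x \<in> E" using flow_edge by blast
  have "(ds ^^ m) e = (ds ^^ (m - n)) x"
    using nm(2) by (simp add: x_def flip: funpow_add[THEN fun_cong, unfolded o_apply])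
  then have t: "transport T x g ((ds ^^ m) e)" using path_matrix_transport[OF x] g_def by simp
  have g: "g \<in> SL2Z" by (simp add: g_def)
  have stab: "act g (form_at T x) = form_at T x" "act g (form_at P x) = form_at P x"
    using transportD[OF t lab] transportD[OF t labelling_P] nm(1) x_def by simp_all
  \<comment> \<open>Otherwise the stabiliser equations make the upper right entry vanish too, but a
    nonempty product of \<open>Tmat\<close> and \<open>Lmat\<close> has a positive entry off the
    diagonal.\<close>
  have "g$2$1 \<noteq> 0"
  proof
    assume 0: "g$2$1 = 0"
    then have "cA x * g$1$2 = 0" using stabiliser_eqs(2)[OF g stab(1)] by simp
    then show False using 0 coeff_nonzero(1)[OF xE] path_matrix_not_one[of "m - n" x] nm(2) g_def by auto
  qed
  then have "rval (form_at P x) (first_root (form_at T x)) = 0"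
    using common_stabiliser[OF g _ indef_form[OF xE] stab] by blast
  then have "alpha x = 0" by (simp add: alpha_def)
  then show False using alpha_const[OF xE, of e] assms flow_edge by simp
qed

lemma downstream_neg:
  assumes "e \<in> flow"
  shows "downstream (neg_top T) (prod.swap e) = prod.swap (upstream e)"
proof -
  have e: "e \<in> E" using assms flow_edge by blast
  have "turns_left (neg_top T) (prod.swap e) \<longleftrightarrow> cA e - cB e + cC e > 0"
    unfolding turns_left_def river_neg relabel_simps
    using e assms by (auto simp: river_def flow_iff mult_less_0_iff)
  then show ?thesis using coeff_nonzero(4)[OF e] by (simp add: downstream_def upstream_def)
qed

lemma downstream_neg_funpow:
  assumes "e \<in> flow"
  shows "(downstream (neg_top T) ^^ n) (prod.swap e) = prod.swap ((upstream ^^ n) e)"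
proof (induction n)
  case (Suc n)
  have *: "(f ^^ Suc n) x = f ((f ^^ n) x)" for f and x :: "'v \<times> 'v" by simp
  show ?case unfolding * Suc using downstream_neg[OF upstream_funpow_flow[OF assms, of n]] .
qed simp

text \<open>The common part is a finite stretch, since the rivers separate in both directions and
  never rejoin. Leaving on the side of entry would give both roots the same sign.\<close>

lemma signs_cross:
  assumes "alpha e * beta e < 0" "e \<in> E"
  shows "rivers_cross P T id"
proof -
  interpret N: topo_pair "neg_top T" P by (rule pair_neg)
  have swapP: "prod.swap x \<in> river P \<longleftrightarrow> x \<in> river P" for x using P.river_iff by auto
  have ab: "alpha x * beta x < 0" "alpha x \<noteq> 0" "beta x \<noteq> 0" if "x \<in> E" for x
  proof -
    have "alpha x * beta x = alpha e * beta e"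
      using assms(2) alpha_const[OF that] beta_const[OF that] by simp
    then show "alpha x * beta x < 0" "alpha x \<noteq> 0" "beta x \<noteq> 0" using assms(1) by auto
  qed
  obtain y where y: "y \<in> flow" "y \<in> river P" using shared_edge assms by blast
  then have yE: "y \<in> E" using flow_edge by blast
  have "N.alpha (prod.swap y) \<noteq> 0" using ab alpha_beta_neg(1) yE by simp
  then obtain m where "(downstream (neg_top T) ^^ m) (prod.swap y) \<notin> river P"
    using N.diverge[of "prod.swap y"] flow_neg y by auto
  then have "\<exists>m. (upstream ^^ m) y \<notin> river P"
    using downstream_neg_funpow[OF y(1)] swapP by metis
  define M where "M = (LEAST m. (upstream ^^ m) y \<notin> river P)"
  have M: "(upstream ^^ M) y \<notin> river P" "m < M \<Longrightarrow> (upstream ^^ m) y \<in> river P" for m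
    unfolding M_def using \<open>\<exists>m. _\<close> by (rule LeastI_ex) (auto dest: not_less_Least)
  have "M \<noteq> 0" using M(1) y(2) by (metis funpow_0)
  then obtain M' where M': "M = Suc M'" using not0_implies_Suc by blast
  \<comment> \<open>The first shared edge; \<open>K\<close> below counts the shared edges from here
    on.\<close>
  define s where "s = (upstream ^^ M') y"
  have s: "s \<in> flow" "s \<in> river P" "upstream s \<notin> river P"
    using M M' y by (simp_all add: s_def)
  have sE: "s \<in> E" using s flow_edge by blast
  obtain K where K: "(ds ^^ K) s \<notin> river P" "\<And>n. n < K \<Longrightarrow> (ds ^^ n) s \<in> river P"
  proof -
    have ex: "\<exists>n. (ds ^^ n) s \<notin> river P" using diverge[OF s(1)] ab sE by blast
    show ?thesis
      by (rule that[OF LeastI_ex[OF ex]]) (auto dest: not_less_Least)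
  qed
  have "K \<noteq> 0" using K(1) s(2) by (metis funpow_0)
  then obtain L where L: "K = Suc L" using not0_implies_Suc by blast
  have after: "(ds ^^ (K + n)) s \<notin> river P" for n
  proof -
    let ?d = "(ds ^^ L) s"
    have d: "?d \<in> river P" "?d \<in> flow" "ds ?d \<notin> river P" using K L s(1) by auto
    have "K + n = Suc n + L" by (simp add: L)
    then have "(ds ^^ (K + n)) s = (ds ^^ Suc n) ?d" by (simp only: funpow_add o_apply)
    then show ?thesis using leave_river[OF d, of n] by (simp only: not_False_eq_True)
  qed
  have before: "(upstream ^^ Suc n) s \<notin> river P" for n
  proof -
    have "(downstream (neg_top T) ^^ Suc n) (prod.swap s) \<notin> river P"
      by (rule N.leave_river) (use s flow_neg swapP downstream_neg in auto)
    then show ?thesis unfolding downstream_neg_funpow[OF s(1)] swapP .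
  qed
  have shared: "flow \<inter> river P = (\<lambda>n. (ds ^^ n) s) ` {0..<K}"
  proof
    show "(\<lambda>n. (ds ^^ n) s) ` {0..<K} \<subseteq> flow \<inter> river P" using K s by auto
    show "flow \<inter> river P \<subseteq> (\<lambda>n. (ds ^^ n) s) ` {0..<K}"
    proof
      fix x assume x: "x \<in> flow \<inter> river P"
      then consider n where "x = (ds ^^ n) s" | n where "s = (ds ^^ n) x" using flow_orbit s(1) by blast
      then show "x \<in> (\<lambda>n. (ds ^^ n) s) ` {0..<K}"
      proof cases
        case 1
        then have "n < K" using after[of "n - K"] x by (cases "n < K") auto
        then show ?thesis using 1 by auto
      next
        case 2
        have "x = (upstream ^^ n) s"
        proof (rule downstream_funpow_inj)
          show "(ds ^^ n) x = (ds ^^ n) ((upstream ^^ n) s)"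
            by (rule trans[OF 2[symmetric] sym[OF downstream_upstream_funpow[OF s(1)]]])
        qed (use x s(1) in auto)
        then have "n = 0" using before x by (metis IntD2 not0_implies_Suc)
        then have "x = (ds ^^ 0) s" using \<open>x = (upstream ^^ n) s\<close> by simp
        moreover have "0 \<in> {0..<K}" using \<open>K \<noteq> 0\<close> by simp
        ultimately show ?thesis by (rule image_eqI)
      qed
    qed
  qed
  \<comment> \<open>\<open>K\<close> edges have \<open>K + 1\<close> vertices; the last one is the
    start of the first edge beyond the stretch.\<close>
  define p where "p = map (\<lambda>j. fst ((ds ^^ j) s)) [0..<Suc K]"
  have fst_ds: "fst (ds x) = snd x" for x by (simp add: downstream_def)
  have "zip p (tl p) = map (\<lambda>j. (ds ^^ j) s) [0..<K]"
  proof (rule nth_equalityI)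
    show "length (zip p (tl p)) = length (map (\<lambda>j. (ds ^^ j) s) [0..<K])" by (simp add: p_def)
    fix i assume "i < length (zip p (tl p))"
    then have "i < K" by (simp add: p_def)
    then have "zip p (tl p) ! i = (fst ((ds ^^ i) s), fst ((ds ^^ Suc i) s))"
      by (simp add: p_def nth_tl del: upt_Suc funpow.simps)
    also have "\<dots> = (ds ^^ i) s" by (simp add: fst_ds)
    finally show "zip p (tl p) ! i = map (\<lambda>j. (ds ^^ j) s) [0..<K] ! i" using \<open>i < K\<close> by simp
  qed
  then have zip: "set (zip p (tl p)) = flow \<inter> river P" by (simp add: shared)
  have p: "p \<noteq> []" "hd p = fst s" "last p = fst ((ds ^^ K) s)"
    by (simp_all add: p_def hd_map del: upt_Suc) (simp_all add: last_map)
  let ?i = "upstream s" and ?o = "(ds ^^ K) s"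
  have flows: "?i \<in> flow" "?o \<in> flow" using s(1) by simp_all
  then have E: "?i \<in> E" "?o \<in> E" using flow_edge by blast+
  have si: "snd ?i = fst s" using fst_ds[of ?i] s(1) by simp
  have i: "(fst ?i, hd p) = ?i" using si p by (simp add: prod_eq_iff)
  have o: "(last p, snd ?o) = ?o" using p by (simp add: prod_eq_iff)
  have "left_bank P (hd p) (fst ?i) \<or> right_bank P (hd p) (fst ?i)"
    using bank_cases[of s "prod.swap ?i"] s(2,3) E(1) swapP si p(2) by auto
  moreover have "left_bank P (last p) (snd ?o) \<or> right_bank P (last p) (snd ?o)"
  proof -
    have "prod.swap ((ds ^^ L) s) \<in> river P" using K(2)[of L] L swapP by simp
    moreover have "fst (prod.swap ((ds ^^ L) s)) = fst ?o" by (simp add: L fst_ds)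
    ultimately show ?thesis using bank_cases[of "prod.swap ((ds ^^ L) s)" ?o] K(1) E(2) p(3) by simp
  qed
  moreover have "\<not> (left_bank P (hd p) (fst ?i) \<and> left_bank P (last p) (snd ?o))"
    "\<not> (right_bank P (hd p) (fst ?i) \<and> right_bank P (last p) (snd ?o))"
    using bank_alpha[OF assms(2), of "last p" "snd ?o"] bank_beta[OF assms(2), of "fst ?i" "hd p"]
      flows assms(1) unfolding i o by auto
  ultimately have banks: "left_bank P (hd p) (fst ?i) \<and> right_bank P (last p) (snd ?o) \<or>
      right_bank P (hd p) (fst ?i) \<and> left_bank P (last p) (snd ?o)" by blast
  have "p \<noteq> [] \<and> set (zip p (tl p)) = flow \<inter> river P \<and> (fst ?i, hd p) \<in> flow \<and> (last p, snd ?o) \<in> flow \<and>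
    (left_bank P (hd p) (fst ?i) \<and> right_bank P (last p) (snd ?o) \<or>
      right_bank P (hd p) (fst ?i) \<and> left_bank P (last p) (snd ?o))"
    using p(1) zip banks flows unfolding i o by blast
  then show ?thesis unfolding rivers_cross_def map_prod.id Let_def image_id id_apply by blast
qed

lemma cross_iff_signs: "e \<in> E \<Longrightarrow> rivers_cross P T id \<longleftrightarrow> alpha e * beta e < 0"
  using cross_signs signs_cross by blast

end

subsection \<open>Superimpositions\<close>

context
  fixes T1 :: "'v topograph" and T2 :: "'w topograph" and \<phi> :: "'w \<Rightarrow> 'v" and P :: "'w topograph"
  assumes T1: "topo T1" and T2: "topo T2" and iso: "plane_iso T2 T1 \<phi>"
  defines "P \<equiv> relabel (form_at T1 \<circ> map_prod \<phi> \<phi>) T2"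
begin

interpretation T1: topo T1 by (rule T1)
interpretation T2: topo T2 by (rule T2)

lemma pullback_pair: "topo_pair T2 P"
proof -
  have "topo P"
  proof
    show "plane_cubic_tree P" using T2.tree by (simp add: P_def)
    show "labelling P (form_at P)"
      using T2.labelling_pullback[OF iso T1.lab] by (simp add: P_def)
    show "indef (discriminant (form_at P e))" if "e \<in> oriented_edges P" for e
      using that plane_iso_edge[OF iso, of e] T1.indef_form by (simp add: P_def)
  qed
  then show ?thesis using T2 by (simp add: topo_pair_def topo_pair_axioms_def P_def)
qed

interpretation pair: topo_pair T2 P by (rule pullback_pair)

lemma pullback_river: "map_prod \<phi> \<phi> e \<in> river T1 \<longleftrightarrow> e \<in> river P"
  and pullback_flow: "map_prod \<phi> \<phi> e \<in> river_flow T1 \<longleftrightarrow> e \<in> river_flow P"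
  using plane_iso_edge[OF iso, of e] by (simp_all add: river_def river_flow_def P_def)

lemma surj_edge: obtains x where "map_prod \<phi> \<phi> x = e"
proof -
  obtain a b where "\<phi> a = fst e" "\<phi> b = snd e"
    using plane_iso_bij[OF iso] by (metis bij_pointE)
  then have "map_prod \<phi> \<phi> (a, b) = e" by simp
  then show ?thesis by (rule that)
qed

lemma pullback_banks:
  "left_bank T1 (\<phi> v) (\<phi> u) \<longleftrightarrow> left_bank P v u"
  "right_bank T1 (\<phi> v) (\<phi> u) \<longleftrightarrow> right_bank P v u"
proof -
  have r: "(\<phi> v, \<phi> u) \<in> river T1 \<longleftrightarrow> (v, u) \<in> river P" using pullback_river[of "(v, u)"] by simp
  have l: "left T1 (map_prod \<phi> \<phi> x) = (\<phi> v, \<phi> u) \<longleftrightarrow> left P x = (v, u)"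
    "right T1 (map_prod \<phi> \<phi> x) = (\<phi> v, \<phi> u) \<longleftrightarrow> right P x = (v, u)" if "x \<in> river_flow P" for x
  proof -
    have x: "x \<in> oriented_edges T2" using pair.P.flow_edge[OF that] pair.E_P by simp
    have "map_prod \<phi> \<phi> y = (\<phi> v, \<phi> u) \<longleftrightarrow> y = (v, u)" for y
      using map_prod_inj[OF plane_iso_bij[OF iso], of y "(v, u)"] by simp
    then show "left T1 (map_prod \<phi> \<phi> x) = (\<phi> v, \<phi> u) \<longleftrightarrow> left P x = (v, u)"
      "right T1 (map_prod \<phi> \<phi> x) = (\<phi> v, \<phi> u) \<longleftrightarrow> right P x = (v, u)"
      unfolding T2.plane_iso_left[OF iso x, symmetric] T2.plane_iso_right[OF iso x, symmetric]
        pair.left_P pair.right_P by blast+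
  qed
  have ex: "(\<exists>e\<in>river_flow T1. Q e) \<longleftrightarrow> (\<exists>x\<in>river_flow P. Q (map_prod \<phi> \<phi> x))" for Q
    using pullback_flow surj_edge by metis
  show "left_bank T1 (\<phi> v) (\<phi> u) \<longleftrightarrow> left_bank P v u"
    "right_bank T1 (\<phi> v) (\<phi> u) \<longleftrightarrow> right_bank P v u"
    unfolding left_bank_def right_bank_def ex r using l by blast+
qed

lemma pullback_cross: "rivers_cross T1 T2 \<phi> \<longleftrightarrow> rivers_cross P T2 id"
proof -
  let ?\<Phi> = "map_prod \<phi> \<phi>"
  define body where "body = (\<lambda>u p w. p \<noteq> [] \<and> set (zip p (tl p)) = ?\<Phi> ` river_flow T2 \<inter> river T1 \<and>
       (u, hd p) \<in> ?\<Phi> ` river_flow T2 \<and> (last p, w) \<in> ?\<Phi> ` river_flow T2 \<and>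
       (left_bank T1 (hd p) u \<and> right_bank T1 (last p) w \<or>
        right_bank T1 (hd p) u \<and> left_bank T1 (last p) w))"
  define body' where "body' = (\<lambda>u p w. p \<noteq> [] \<and> set (zip p (tl p)) = river_flow T2 \<inter> river P \<and>
       (u, hd p) \<in> river_flow T2 \<and> (last p, w) \<in> river_flow T2 \<and>
       (left_bank P (hd p) u \<and> right_bank P (last p) w \<or>
        right_bank P (hd p) u \<and> left_bank P (last p) w))"
  have inj: "inj ?\<Phi>" using map_prod_inj[OF plane_iso_bij[OF iso]] by (auto intro!: injI)
  have mem: "(\<phi> v, \<phi> u) \<in> ?\<Phi> ` X \<longleftrightarrow> (v, u) \<in> X" for v u X
    using inj_image_mem_iff[OF inj, of "(v, u)" X] by simp
  have im: "?\<Phi> ` X = ?\<Phi> ` river_flow T2 \<inter> river T1 \<longleftrightarrow> X = river_flow T2 \<inter> river P" for X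
  proof -
    have "?\<Phi> ` river_flow T2 \<inter> river T1 = ?\<Phi> ` (river_flow T2 \<inter> river P)"
    proof -
      have "f ` A \<inter> B = f ` (A \<inter> f -` B)" for f :: "'w \<times> 'w \<Rightarrow> 'v \<times> 'v" and A B by auto
      moreover have "?\<Phi> -` river T1 = river P" by (rule set_eqI) (simp only: vimage_eq pullback_river)
      ultimately show ?thesis by simp
    qed
    then show ?thesis using inj_image_eq_iff[OF inj] by simp
  qed
  have eq: "body (\<phi> u) (map \<phi> p) (\<phi> w) \<longleftrightarrow> body' u p w" for u p w
  proof (cases "p = []")
    case False
    have "set (zip (map \<phi> p) (tl (map \<phi> p))) = ?\<Phi> ` set (zip p (tl p))"
      by (simp add: map_tl[symmetric] zip_map_map map_prod_def)
    then show ?thesis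
      using False unfolding body_def body'_def by (simp add: hd_map last_map mem im pullback_banks)
  qed (simp add: body_def body'_def)
  have s: "\<exists>x'. x = \<phi> x'" for x using plane_iso_bij[OF iso] by (metis bij_pointE)
  have sl: "\<exists>p'. p = map \<phi> p'" for p
    using ex_map_conv[of p \<phi>] s by metis
  have "(\<exists>u p w. body u p w) \<longleftrightarrow> (\<exists>u p w. body' u p w)"
    using eq s sl by metis
  then show ?thesis
    unfolding rivers_cross_def Let_def body_def body'_def map_prod.id image_id id_apply .
qed

lemma rivers_cross_iff:
  assumes "e \<in> oriented_edges T2"
  shows "rivers_cross T1 T2 \<phi> \<longleftrightarrow> rval (form_at T1 (map_prod \<phi> \<phi> e)) (first_root (form_at T2 e)) *
    rval (form_at T1 (map_prod \<phi> \<phi> e)) (second_root (form_at T2 e)) < 0"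
proof -
  have "sgn x * sgn y < 0 \<longleftrightarrow> x * y < 0" for x y :: real
    by (metis sgn_mult sgn_less)
  then show ?thesis
    using pair.cross_iff_signs[OF assms] unfolding pullback_cross pair.alpha_def pair.beta_def
    by (simp add: P_def)
qed

text \<open>Prepares finiteness: the two forms on such an edge come from the finitely many river
  forms of both topographs.\<close>

lemma cross_shared_edge:
  assumes "rivers_cross T1 T2 \<phi>"
  shows "\<exists>e\<in>river_flow T2. map_prod \<phi> \<phi> e \<in> river T1"
proof -
  obtain e where "e \<in> T2.E" using T2.edge_at_vertex by blast
  then show ?thesis
    using pair.shared_edge pair.cross_iff_signs assms pullback_cross pullback_river by blast
qed

end

section \<open>Automorphs and the Pell equation\<close>

definition pell :: "int \<Rightarrow> int \<Rightarrow> int \<Rightarrow> bool" where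
  "pell D t u \<longleftrightarrow> t\<^sup>2 - D * u\<^sup>2 = 4"

text \<open>As \<open>t\<^sup>2\<close> is determined by \<open>u\<^sup>2\<close> and grows with it,
  the positive solution with the least \<open>u\<close> also has the least \<open>t\<close>, so
  exactly one pair meets the description.\<close>

lemma least_pell:
  assumes D: "D > 0" and ex: "pell D t1 u1" "u1 \<noteq> 0"
  obtains t u where "least_pell D = (t, u)" "t > 0" "u > 0" "pell D t u"
    "\<And>t' u'. t' > 0 \<Longrightarrow> u' > 0 \<Longrightarrow> pell D t' u' \<Longrightarrow> t \<le> t' \<and> u \<le> u'"
proof -
  let ?Q = "\<lambda>n. \<exists>t>0. pell D t (int n) \<and> n > 0"
  have "D * u1\<^sup>2 \<ge> 0" using D by simp
  then have "t1 \<noteq> 0" using ex by (auto simp: pell_def)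
  then have "?Q (nat \<bar>u1\<bar>)" using ex by (intro exI[of _ "\<bar>t1\<bar>"]) (auto simp: pell_def)
  define n where "n = (LEAST n. ?Q n)"
  have "?Q n" unfolding n_def by (rule LeastI[of ?Q]) fact
  then obtain t where t: "t > 0" "pell D t (int n)" "n > 0" by blast
  have min: "t \<le> t' \<and> int n \<le> u'" if "t' > 0" "u' > 0" "pell D t' u'" for t' u'
  proof -
    have "?Q (nat u')" using that by auto
    then have "n \<le> nat u'" unfolding n_def by (rule Least_le)
    then have u: "int n \<le> u'" using that(2) by linarith
    then have "(int n)\<^sup>2 \<le> u'\<^sup>2" by (intro power_mono) auto
    then have "D * (int n)\<^sup>2 \<le> D * u'\<^sup>2" using D by simp
    then have "t\<^sup>2 \<le> t'\<^sup>2" using that(3) t(2) by (simp add: pell_def)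
    then have "t \<le> t'" by (rule power2_le_imp_le) (use that(1) in simp)
    then show ?thesis using u by simp
  qed
  have "least_pell D = (t, int n)"
    unfolding least_pell_def
  proof (rule the_equality)
    show "case (t, int n) of (t, u) \<Rightarrow> t > 0 \<and> u > 0 \<and> t\<^sup>2 - D * u\<^sup>2 = 4 \<and>
     (\<forall>t' u'. t' > 0 \<and> u' > 0 \<and> t'\<^sup>2 - D * u'\<^sup>2 = 4 \<longrightarrow> t \<le> t' \<and> u \<le> u')"
      using t min by (auto simp: pell_def)
    fix x assume x: "case x of (t, u) \<Rightarrow> t > 0 \<and> u > 0 \<and> t\<^sup>2 - D * u\<^sup>2 = 4 \<and>
     (\<forall>t' u'. t' > 0 \<and> u' > 0 \<and> t'\<^sup>2 - D * u'\<^sup>2 = 4 \<longrightarrow> t \<le> t' \<and> u \<le> u')"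
    obtain a b where ab: "x = (a, b)" by fastforce
    have "t \<le> a \<and> int n \<le> b" using x min[of a b] by (auto simp: ab pell_def)
    moreover have "int n > 0" using t(3) by simp
    then have "a \<le> t \<and> b \<le> int n" using x t(1,2) unfolding ab pell_def prod.case by blast
    ultimately show "x = (t, int n)" by (simp add: ab)
  qed
  then show ?thesis using that[of t "int n"] t min by simp
qed

text \<open>The doubled diagonal entries keep the integer division of \<open>automorph\<close> out
  of the computations.\<close>

definition pell_matrix :: "bqf \<Rightarrow> int \<Rightarrow> int \<Rightarrow> int^2^2 \<Rightarrow> bool" where
  "pell_matrix q t u g \<longleftrightarrow> 2 * g$1$1 = t - coeffB q * u \<and> g$1$2 = - coeffC q * u \<and>
     g$2$1 = coeffA q * u \<and> 2 * g$2$2 = t + coeffB q * u"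

lemma pell_matrix_SL2Z:
  assumes "pell (discriminant q) t u" "pell_matrix q t u g"
  shows "g \<in> SL2Z"
proof -
  have "4 * (g$1$1 * g$2$2 - g$1$2 * g$2$1) = (2 * g$1$1) * (2 * g$2$2) - 4 * g$1$2 * g$2$1" by simp
  also have "\<dots> = (t - coeffB q * u) * (t + coeffB q * u) - 4 * (- coeffC q * u) * (coeffA q * u)"
    by (simp only: assms(2)[unfolded pell_matrix_def])
  also have "\<dots> = t\<^sup>2 - discriminant q * u\<^sup>2"
    unfolding discriminant_coeffs by (simp add: power2_eq_square algebra_simps)
  finally show ?thesis using assms(1) by (simp add: SL2Z_iff pell_def)
qed

lemma pell_matrix_stabilises:
  assumes "g \<in> SL2Z" "pell_matrix q t u g" "coeffA q \<noteq> 0"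
  shows "act g q = q"
proof (rule stabiliser_intro)
  have "2 * (coeffB q * g$2$1) = coeffA q * (2 * g$2$2 - 2 * g$1$1)"
    using assms(2) by (simp add: pell_matrix_def)
  then show "coeffB q * g$2$1 = coeffA q * (g$2$2 - g$1$1)" by (simp add: algebra_simps)
  show "coeffA q * g$1$2 = - (coeffC q * g$2$1)" using assms(2) by (simp add: pell_matrix_def)
qed fact+

text \<open>Primitivity makes \<open>u\<close> an integer: \<open>coeffA q\<close> divides the lower
  left entry times each of the other coefficients and is coprime to their gcd, so it divides that
  entry. The number \<open>t\<close> is the trace.\<close>

lemma stabiliser_pell:
  assumes q: "pibqf q" and g: "g \<in> SL2Z" "act g q = q"
  obtains t u where "pell (discriminant q) t u" "pell_matrix q t u g"
proof -
  let ?A = "coeffA q" and ?B = "coeffB q" and ?C = "coeffC q"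
  have A: "?A \<noteq> 0" using indef_coeff_nonzero[OF pibqf_indef[OF q]] by simp
  note e = stabiliser_eqs[OF g]
  have "?A dvd g$2$1"
  proof -
    have "?A dvd ?A * g$2$1" "?A dvd ?B * g$2$1" using e(1) by auto
    moreover have "?A dvd ?C * g$2$1" using e(2) by (metis dvd_minus_iff dvd_triv_left)
    ultimately have "?A dvd gcd (g$2$1 * ?B) (g$2$1 * ?C)" by (simp add: mult.commute)
    then have "?A dvd \<bar>g$2$1\<bar> * gcd ?B ?C" unfolding gcd_mult_distrib_int .
    moreover have "coprime ?A (gcd ?B ?C)" using q by (simp add: pibqf_def coprime_iff_gcd_eq_1)
    ultimately have "?A dvd \<bar>g$2$1\<bar>" using coprime_dvd_mult_left_iff by blast
    then show ?thesis by simp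
  qed
  then obtain u where c: "g$2$1 = ?A * u" by (auto simp: dvd_def)
  have "?A * g$1$2 = ?A * (- ?C * u)" using e(2) c by simp
  then have b: "g$1$2 = - ?C * u" using mult_left_cancel[OF A] by blast
  have "?A * (?B * u) = ?A * (g$2$2 - g$1$1)" using e(1) c by (simp add: algebra_simps)
  then have d: "g$2$2 - g$1$1 = ?B * u" using A by simp
  define t where "t = g$1$1 + g$2$2"
  have m: "pell_matrix q t u g" using b c d by (simp add: pell_matrix_def t_def)
  have "(t - ?B * u) * (t + ?B * u) = (2 * g$1$1) * (2 * g$2$2)"
    by (simp only: m[unfolded pell_matrix_def])
  also have "\<dots> = 4 * (g$1$1 * g$2$2)" by simp
  also have "\<dots> = 4 * (1 + g$1$2 * g$2$1)" using g(1) by (simp add: SL2Z_iff algebra_simps)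
  also have "\<dots> = 4 - 4 * ?A * ?C * u\<^sup>2" by (simp add: b c power2_eq_square)
  finally have "pell (discriminant q) t u"
    by (simp add: pell_def discriminant_coeffs power2_eq_square algebra_simps)
  then show ?thesis using that m by blast
qed

lemma act_uminus [simp]: "act (- g) q = act g q"
  by (cases q) (simp add: act.simps Let_def)

lemma uminus_SL2Z [simp]: "- g \<in> SL2Z \<longleftrightarrow> g \<in> SL2Z"
  by (simp add: SL2Z_iff)

lemma pell_matrix_uminus: "pell_matrix q t u g \<Longrightarrow> pell_matrix q (- t) (- u) (- g)"
  and pell_matrix_sinv: "pell_matrix q t u g \<Longrightarrow> pell_matrix q t (- u) (sinv g)"
  by (simp_all add: pell_matrix_def sinv_def)

lemma pell_neg [simp]: "pell D (- t) u = pell D t u" "pell D t (- u) = pell D t u"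
  by (simp_all add: pell_def)

text \<open>The matrices multiply like the numbers \<open>(t + u * sqrt D) / 2\<close>, and
  inversion is conjugation, from \<open>u\<close> to \<open>- u\<close>.\<close>

lemma pell_matrix_quotient:
  assumes "pell_matrix q t u g" "pell_matrix q t0 u0 g0" "pell_matrix q t' u' (g ** sinv g0)" "coeffA q \<noteq> 0"
  shows "2 * u' = u * t0 - t * u0" "2 * t' = t * t0 - discriminant q * u * u0"
proof -
  let ?A = "coeffA q" and ?B = "coeffB q" and ?C = "coeffC q"
  note d = assms(1-2)[unfolded pell_matrix_def] and h = assms(3)[unfolded pell_matrix_def]
  have "2 * (?A * u') = 2 * (g ** sinv g0)$2$1" using h by (simp del: matmul_nth)
  also have "\<dots> = g$2$1 * (2 * g0$2$2) - (2 * g$2$2) * g0$2$1"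
    by (simp add: sinv_def)
  also have "\<dots> = ?A * u * (t0 + ?B * u0) - (t + ?B * u) * (?A * u0)" by (simp only: d)
  also have "\<dots> = ?A * (u * t0 - t * u0)" by (simp add: algebra_simps)
  finally have "?A * (2 * u') = ?A * (u * t0 - t * u0)" by simp
  then show "2 * u' = u * t0 - t * u0" using mult_left_cancel[OF assms(4)] by blast
  have "4 * t' = 2 * (2 * (g ** sinv g0)$1$1) + 2 * (2 * (g ** sinv g0)$2$2)"
    using h by (simp del: matmul_nth)
  also have "\<dots> = (2 * g$1$1) * (2 * g0$2$2) - 4 * g$1$2 * g0$2$1 - 4 * g$2$1 * g0$1$2
      + (2 * g$2$2) * (2 * g0$1$1)"
    by (simp add: sinv_def algebra_simps)
  also have "\<dots> = (t - ?B * u) * (t0 + ?B * u0) - 4 * (- ?C * u) * (?A * u0) - 4 * (?A * u) * (- ?C * u0)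
      + (t + ?B * u) * (t0 - ?B * u0)" by (simp only: d)
  also have "\<dots> = 2 * (t * t0 - discriminant q * u * u0)"
    by (simp add: discriminant_coeffs power2_eq_square algebra_simps)
  finally show "2 * t' = t * t0 - discriminant q * u * u0" by simp
qed

text \<open>Bounds for the quotient by a smaller solution: its \<open>u\<close> is nonnegative and
  below the old one, its \<open>t\<close> is positive. Comparing squares keeps the argument within
  the integers.\<close>

lemma pell_descent:
  assumes D: "D > 0" and "pell D t u" "t > 0" "u > 0" "pell D t0 u0" "t0 > 0" "u0 > 0" "u0 \<le> u"
  shows "u * t0 \<ge> t * u0" "u * t0 - t * u0 < 2 * u" "t * t0 > D * u * u0"
proof -
  have e: "t\<^sup>2 = 4 + D * u\<^sup>2" "t0\<^sup>2 = 4 + D * u0\<^sup>2" using assms by (simp_all add: pell_def)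
  have "(t * u0)\<^sup>2 \<le> (u * t0)\<^sup>2"
  proof -
    have "u0\<^sup>2 \<le> u\<^sup>2" using assms by (intro power_mono) auto
    moreover have "(u * t0)\<^sup>2 - (t * u0)\<^sup>2 = 4 * (u\<^sup>2 - u0\<^sup>2)"
      unfolding power_mult_distrib e by (simp add: algebra_simps)
    ultimately show ?thesis by simp
  qed
  then show "u * t0 \<ge> t * u0" by (rule power2_le_imp_le) (use assms in simp)
  have "t0\<^sup>2 > 2\<^sup>2" using e assms by simp
  then have t0: "t0 > 2" using assms(6) power2_less_imp_less[of 2 t0] by simp
  have "D * (u * (t0 - 2))\<^sup>2 < D * (t * u0)\<^sup>2"
  proof -
    have "D * (t * u0)\<^sup>2 = t\<^sup>2 * (D * u0\<^sup>2)" by (simp add: power_mult_distrib)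
    also have "\<dots> = (4 + D * u\<^sup>2) * ((t0 - 2) * (t0 + 2))"
      using e by (simp add: power2_eq_square algebra_simps)
    also have "\<dots> > (D * u\<^sup>2) * ((t0 - 2) * (t0 + 2))"
      using t0 by (intro mult_strict_right_mono) auto
    finally have "D * (t * u0)\<^sup>2 > (D * u\<^sup>2) * ((t0 - 2) * (t0 + 2))" .
    moreover have "(D * u\<^sup>2) * ((t0 - 2) * (t0 + 2)) \<ge> (D * u\<^sup>2) * ((t0 - 2) * (t0 - 2))"
      using t0 D by (intro mult_left_mono) auto
    ultimately show ?thesis by (simp add: power2_eq_square algebra_simps)
  qed
  then have "(u * (t0 - 2))\<^sup>2 < (t * u0)\<^sup>2" using D by simp
  then have "u * (t0 - 2) < t * u0" by (rule power2_less_imp_less) (use assms in simp)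
  then show "u * t0 - t * u0 < 2 * u" by (simp add: algebra_simps)
  have "(D * u * u0)\<^sup>2 < (t * t0)\<^sup>2"
  proof -
    have "(t * t0)\<^sup>2 = (D * u * u0)\<^sup>2 + (16 + 4 * D * u\<^sup>2 + 4 * D * u0\<^sup>2)"
      unfolding power_mult_distrib e by (simp add: power2_eq_square algebra_simps)
    moreover have "4 * D * u\<^sup>2 \<ge> 0" "4 * D * u0\<^sup>2 \<ge> 0" using D by simp_all
    ultimately show ?thesis by linarith
  qed
  then show "t * t0 > D * u * u0" by (rule power2_less_imp_less) (use assms in simp)
qed

text \<open>The two numbers have an even product and differ by
  \<open>2 * coeffB q * u\<close>.\<close>

lemma pell_parity:
  assumes "pell (discriminant q) t u"
  shows "even (t - coeffB q * u)" "even (t + coeffB q * u)"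
proof -
  have "(t - coeffB q * u) * (t + coeffB q * u) = 2 * (2 - 2 * coeffA q * coeffC q * u\<^sup>2)"
    using assms by (simp add: pell_def discriminant_coeffs power2_eq_square algebra_simps)
  then have "even ((t - coeffB q * u) * (t + coeffB q * u))" by simp
  then show "even (t - coeffB q * u)" "even (t + coeffB q * u)" by auto
qed

section \<open>The automorph as a generator of the stabiliser\<close>

locale automorphic =
  fixes q :: bqf and t0 u0 :: int
  assumes q: "pibqf q" and t0: "t0 > 0" and u0: "u0 > 0" and pell0: "pell (discriminant q) t0 u0"
    and matrix0: "pell_matrix q t0 u0 (automorph q)"
    and minimal: "t > 0 \<Longrightarrow> u > 0 \<Longrightarrow> pell (discriminant q) t u \<Longrightarrow> t0 \<le> t \<and> u0 \<le> u"

lemma automorphic_intro: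
  assumes q: "pibqf q" and "pell (discriminant q) t1 u1" "u1 \<noteq> 0"
  shows "\<exists>t0 u0. automorphic q t0 u0"
proof -
  have "discriminant q > 0" using q by (simp add: pibqf_def)
  then obtain t u where l: "least_pell (discriminant q) = (t, u)" "t > 0" "u > 0" "pell (discriminant q) t u"
    "\<And>t' u'. t' > 0 \<Longrightarrow> u' > 0 \<Longrightarrow> pell (discriminant q) t' u' \<Longrightarrow> t \<le> t' \<and> u \<le> u'"
    using least_pell assms(2,3) by metis
  have "pell_matrix q t u (automorph q)"
    using pell_parity[OF l(4)] by (simp add: pell_matrix_def automorph_def l(1))
  then have "automorphic q t u" using q l by unfold_locales auto
  then show ?thesis by blast
qed

context automorphic
begin

abbreviation "D \<equiv> discriminant q"
abbreviation "\<gamma> \<equiv> automorph q"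

lemma indef_q: "indef D" and D_pos: "D > 0" and A_nonzero: "coeffA q \<noteq> 0"
  using pibqf_indef[OF q] indef_coeff_nonzero[of q] by (simp_all add: indef_def)

lemma gamma_SL2Z [simp]: "\<gamma> \<in> SL2Z"
  using pell_matrix_SL2Z pell0 matrix0 by blast

lemma gamma_stabilises [simp]: "act \<gamma> q = q"
  using pell_matrix_stabilises matrix0 A_nonzero by simp

lemma bij_act: "bij (act g)" if "g \<in> SL2Z" for g
  by (rule o_bij[of "act (sinv g)"]) (use that in auto)

text \<open>Descent on \<open>u\<close>: division by \<gamma> yields smaller solutions until
  \<open>u = 0\<close>, where only the identity is left.\<close>

lemma stabiliser_power:
  assumes "pell D t u" "pell_matrix q t u g" "t > 0" "u \<ge> 0"
  shows "\<exists>n. act g = act \<gamma> ^^ n"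
  using assms
proof (induction "nat u" arbitrary: g t u rule: less_induct)
  case less
  have g: "g \<in> SL2Z" "act g q = q"
    using pell_matrix_SL2Z pell_matrix_stabilises A_nonzero less.prems by blast+
  show ?case
  proof (cases "u = 0")
    case True
    then have "t\<^sup>2 = 2\<^sup>2" using less.prems(1) by (simp add: pell_def)
    then have "t = 2" by (rule power2_eq_imp_eq) (use less.prems(3) in auto)
    then have "g = mat 1" using less.prems(2) True by (intro mat2_eqI) (auto simp: pell_matrix_def)
    then have "act g = act \<gamma> ^^ 0" by (simp add: fun_eq_iff)
    then show ?thesis by blast
  next
    case False
    then have u: "u > 0" using less.prems(4) by simp
    then have "u0 \<le> u" using minimal less.prems by blast
    note d = pell_descent[OF D_pos less.prems(1,3) u pell0 t0 u0 this]
    let ?h = "g ** sinv \<gamma>"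
    have h: "?h \<in> SL2Z" using g by simp
    moreover have "act ?h q = q"
      using g act_sinv(2)[OF gamma_SL2Z, of q] by (simp add: act_mult)
    ultimately obtain t' u' where p: "pell D t' u'" "pell_matrix q t' u' ?h"
      using stabiliser_pell[OF q] by blast
    note e = pell_matrix_quotient[OF less.prems(2) matrix0 p(2) A_nonzero]
    have "nat u' < nat u" "t' > 0" "u' \<ge> 0" using d e u by linarith+
    then obtain n where n: "act ?h = act \<gamma> ^^ n" using less.hyps p by blast
    have "g = ?h ** \<gamma>" by (simp flip: matrix_mul_assoc)
    then have "act g = act \<gamma> \<circ> act ?h" by (metis act_mult comp_apply ext)
    also have "\<dots> = act \<gamma> ^^ Suc n" by (simp add: n)
    finally show ?thesis by blast
  qed
qed

text \<open>Passing to the negative matrix, which acts equally, makes \<open>t\<close> positive;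
  passing to the inverse makes \<open>u\<close> nonnegative.\<close>

lemma stabiliser_iterate:
  assumes "g \<in> SL2Z" "act g q = q"
  shows "\<exists>k. act g = iterate (act \<gamma>) k"
proof -
  have *: "\<exists>k. act g = iterate (act \<gamma>) k" if g: "g \<in> SL2Z" and p: "pell D t u" "pell_matrix q t u g" and "t > 0" for g t u
  proof (cases "u \<ge> 0")
    case True
    then show ?thesis using stabiliser_power[OF p \<open>t > 0\<close>] iterate_of_nat by metis
  next
    case False
    then obtain n where n: "act (sinv g) = act \<gamma> ^^ n"
      using stabiliser_power[of t "- u" "sinv g"] pell_matrix_sinv[OF p(2)] p(1) \<open>t > 0\<close> by auto
    have "act g p = iterate (act \<gamma>) (- int n) p" for p
    proof -
      have "iterate (act \<gamma>) (int n) (act g p) = p"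
        unfolding iterate_of_nat n[symmetric] using g by simp
      then show ?thesis using iterate_minus_apply(1)[OF bij_act[OF gamma_SL2Z]] by metis
    qed
    then show ?thesis by blast
  qed
  obtain t u where p: "pell D t u" "pell_matrix q t u g" using stabiliser_pell[OF q assms] by blast
  have "D * u\<^sup>2 \<ge> 0" using D_pos by simp
  then have "t \<noteq> 0" using p(1) by (auto simp: pell_def)
  then consider "t > 0" | "- t > 0" by linarith
  then show ?thesis
  proof cases
    case 1
    then show ?thesis using * assms p by blast
  next
    case 2
    have "act (- g) = act g" by (simp add: fun_eq_iff)
    then show ?thesis using *[OF _ _ pell_matrix_uminus[OF p(2)] 2] assms p(1) by simp
  qed
qed

lemma iterate_stabiliser: "\<exists>g\<in>SL2Z. act g q = q \<and> iterate (act \<gamma>) k = act g"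
proof (rule iterate_closed[where P = "\<lambda>f. \<exists>g\<in>SL2Z. act g q = q \<and> f = act g"])
  show "\<exists>g\<in>SL2Z. act g q = q \<and> id = act g" by (rule bexI[of _ "mat 1"]) (auto simp: fun_eq_iff)
  have inv: "inv (act \<gamma>) = act (sinv \<gamma>)"
    by (rule inv_unique_comp) (auto simp: fun_eq_iff)
  have iq: "act (sinv \<gamma>) q = q" using act_sinv(2)[OF gamma_SL2Z, of q] by simp
  fix f assume "\<exists>g\<in>SL2Z. act g q = q \<and> f = act g"
  then obtain g where g: "g \<in> SL2Z" "act g q = q" "f = act g" by blast
  show "\<exists>g\<in>SL2Z. act g q = q \<and> act \<gamma> \<circ> f = act g"
    by (rule bexI[of _ "g ** \<gamma>"]) (use g in \<open>auto simp: act_mult fun_eq_iff\<close>)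
  show "\<exists>g\<in>SL2Z. act g q = q \<and> inv (act \<gamma>) \<circ> f = act g"
    by (rule bexI[of _ "g ** sinv \<gamma>"]) (use g iq in \<open>auto simp: act_mult fun_eq_iff inv\<close>)
qed

end

section \<open>Geodesics\<close>

lemma points_iff: "P \<in> points (a, b) \<longleftrightarrow> Im P > 0 \<and> (Re P - a) * (Re P - b) + (Im P)\<^sup>2 = 0"
proof -
  have "dist P (of_real (centre (a, b))) = \<bar>b - a\<bar> / 2 \<longleftrightarrow>
      (dist P (of_real (centre (a, b))))\<^sup>2 = (\<bar>b - a\<bar> / 2)\<^sup>2"
    by (rule power2_eq_iff_nonneg[symmetric]) auto
  also have "\<dots> \<longleftrightarrow> (Re P - (a + b) / 2)\<^sup>2 + (Im P)\<^sup>2 = (b - a)\<^sup>2 / 4"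
    by (simp add: dist_norm cmod_power2 centre_def power_divide)
  also have "\<dots> \<longleftrightarrow> (Re P - a) * (Re P - b) + (Im P)\<^sup>2 = 0"
  proof -
    have "(Re P - (a + b) / 2)\<^sup>2 + (Im P)\<^sup>2 - (b - a)\<^sup>2 / 4 = (Re P - a) * (Re P - b) + (Im P)\<^sup>2"
      by (simp add: power2_eq_square field_simps)
    then show ?thesis by linarith
  qed
  finally show ?thesis by (simp add: points_def)
qed

text \<open>Parallel tangents mean that the differences from the centres to \<open>P\<close> are
  real multiples of each other. Their imaginary parts agree and are nonzero, so the factor is 1 and
  the centres coincide.\<close>

lemma transverse_iff:
  "transverse_at l l' P \<longleftrightarrow> P \<in> points l \<and> P \<in> points l' \<and> centre l \<noteq> centre l'"
proof (cases "P \<in> points l \<and> P \<in> points l'")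
  case True
  then have y: "Im P > 0" by (simp add: points_def)
  have n: "tangent l P \<noteq> 0" for l
  proof
    assume "tangent l P = 0"
    then have "Im (P - of_real (centre l)) = 0" by (auto simp: tangent_def)
    then show False using y by simp
  qed
  have "collinear {0, tangent l P, tangent l' P} \<longleftrightarrow> (\<exists>c. tangent l' P = c *\<^sub>R tangent l P)"
    using n by (simp add: collinear_lemma)
  also have "\<dots> \<longleftrightarrow> (\<exists>c. P - of_real (centre l') = c *\<^sub>R (P - of_real (centre l)))"
  proof -
    have "tangent l' P = c *\<^sub>R tangent l P \<longleftrightarrow> P - of_real (centre l') = c *\<^sub>R (P - of_real (centre l))" for c
    proof -
      have "c *\<^sub>R tangent l P = \<i> * (c *\<^sub>R (P - of_real (centre l)))" by (simp add: tangent_def)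
      then show ?thesis unfolding tangent_def by (simp only: mult_cancel_left) simp
    qed
    then show ?thesis by simp
  qed
  also have "\<dots> \<longleftrightarrow> centre l = centre l'"
  proof
    assume "\<exists>c. P - of_real (centre l') = c *\<^sub>R (P - of_real (centre l))"
    then obtain c where c: "P - of_real (centre l') = c *\<^sub>R (P - of_real (centre l))" by blast
    have "Im P = c * Im P" using arg_cong[OF c, of Im] by simp
    then have "c = 1" using y by simp
    then show "centre l = centre l'" using c by simp
  qed (auto intro: exI[of _ 1])
  finally show ?thesis using True by (simp add: transverse_at_def)
qed (auto simp: transverse_at_def)

text \<open>Subtracting the equations of the two circles leaves a linear equation for the real part; the
  square of the imaginary part is then the negative of a resultant divided by a square.\<close>

definition resultant :: "geodesic \<Rightarrow> geodesic \<Rightarrow> real" where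
  "resultant l l' = (fst l - fst l') * (fst l - snd l') * (snd l - fst l') * (snd l - snd l')"

lemma transverse_coords:
  assumes "transverse_at (a, b) (c, d) P"
  shows "Re P = (a * b - c * d) / (a + b - c - d)" "Im P > 0"
    "(Im P)\<^sup>2 = - resultant (a, b) (c, d) / (a + b - c - d)\<^sup>2"
proof -
  have e: "(Re P - a) * (Re P - b) + (Im P)\<^sup>2 = 0" "(Re P - c) * (Re P - d) + (Im P)\<^sup>2 = 0"
    and y: "Im P > 0" and n: "a + b - c - d \<noteq> 0"
    using assms by (auto simp: transverse_iff points_iff centre_def)
  show "Im P > 0" by (fact y)
  have "Re P * (a + b - c - d) = a * b - c * d" using e by (simp add: algebra_simps)
  then show x: "Re P = (a * b - c * d) / (a + b - c - d)" using n by (simp add: field_simps)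
  let ?s = "a + b - c - d" and ?p = "a * b - c * d"
  have "(Im P)\<^sup>2 = - ((Re P - a) * (Re P - b))" using e(1) by simp
  moreover have "- ((x - v) * (x - w)) * s\<^sup>2 = - ((x * s - v * s) * (x * s - w * s))" for x v w s :: real
    by (simp add: power2_eq_square algebra_simps)
  ultimately have "(Im P)\<^sup>2 * ?s\<^sup>2 = - ((Re P * ?s - a * ?s) * (Re P * ?s - b * ?s))" by metis
  also have "\<dots> = - ((?p - a * ?s) * (?p - b * ?s))"
    unfolding \<open>Re P * ?s = ?p\<close> ..
  also have "\<dots> = - resultant (a, b) (c, d)" by (simp add: resultant_def algebra_simps)
  finally show "(Im P)\<^sup>2 = - resultant (a, b) (c, d) / ?s\<^sup>2" using n by (simp add: field_simps)
qed

lemma transverse_unique: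
  assumes "transverse_at l l' P" "transverse_at l l' P'"
  shows "P = P'"
proof -
  obtain a b c d where l: "l = (a, b)" "l' = (c, d)" by fastforce
  note t = transverse_coords[OF assms(1)[unfolded l]] transverse_coords[OF assms(2)[unfolded l]]
  have "(Im P)\<^sup>2 = (Im P')\<^sup>2" using t by simp
  then have "Im P = Im P'" by (rule power2_eq_imp_eq) (use t in auto)
  then show ?thesis using t by (simp add: complex_eq_iff)
qed

text \<open>A negative resultant means that the end points interlace.\<close>

lemma transverse_exists_iff: "(\<exists>P. transverse_at l l' P) \<longleftrightarrow> resultant l l' < 0"
proof -
  obtain a b c d where l: "l = (a, b)" "l' = (c, d)" by fastforce
  let ?R = "resultant (a, b) (c, d)" and ?s = "a + b - c - d" and ?p = "a * b - c * d"
  have R: "?R = (?p - a * ?s) * (?p - b * ?s)" "?R = (?p - c * ?s) * (?p - d * ?s)"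
    by (simp_all add: resultant_def algebra_simps)
  have "\<exists>P. transverse_at (a, b) (c, d) P" if neg: "?R < 0"
  proof -
    \<comment> \<open>For concentric circles the resultant would be the square of
      \<open>?p\<close>.\<close>
    have s: "?s \<noteq> 0"
    proof
      assume "?s = 0"
      then have "?R = ?p * ?p" unfolding R(1) by (simp only: mult_zero_right diff_zero)
      then show False using neg by (simp add: mult_less_0_iff)
    qed
    define P where "P = Complex (?p / ?s) (sqrt (- ?R / ?s\<^sup>2))"
    have pos: "- ?R / ?s\<^sup>2 > 0" using neg s by (intro divide_pos_pos) auto
    have y: "Im P > 0" "(Im P)\<^sup>2 = - ?R / ?s\<^sup>2" using pos by (simp_all add: P_def)
    have x: "(Re P - v) * (Re P - w) = (?p - v * ?s) * (?p - w * ?s) / ?s\<^sup>2" for v w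
      using s by (simp add: P_def power2_eq_square diff_divide_distrib[symmetric] field_simps)
    have "P \<in> points (a, b)" "P \<in> points (c, d)"
      using y by (simp_all add: points_iff x R[symmetric])
    moreover have "centre (a, b) \<noteq> centre (c, d)" using s by (simp add: centre_def)
    ultimately show ?thesis by (auto simp: transverse_iff)
  qed
  moreover have "?R < 0" if "transverse_at (a, b) (c, d) P" for P
  proof -
    note t = transverse_coords[OF that]
    have "- ?R / ?s\<^sup>2 > 0" using t(2) unfolding t(3)[symmetric] by simp
    then show ?thesis by (simp add: divide_less_0_iff)
  qed
  ultimately show ?thesis using l by blast
qed

text \<open>Evaluating \<open>p\<close> at the roots of \<open>q\<close> produces the four
  differences of roots, up to the positive factor \<open>(coeffA p)\<^sup>2\<close>. This ties
  crossing geodesics to opposite signs.\<close>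

lemma resultant_geod:
  assumes "indef (discriminant p)"
  shows "resultant (geod p) (geod q) < 0 \<longleftrightarrow> rval p (first_root q) * rval p (second_root q) < 0"
proof -
  have A: "(of_int (coeffA p))\<^sup>2 > (0::real)" using indef_coeff_nonzero[OF assms] by simp
  have "rval p (first_root q) * rval p (second_root q) = (of_int (coeffA p))\<^sup>2 * resultant (geod p) (geod q)"
  proof -
    have "A * (x - f) * (x - s) * (A * (y - f) * (y - s)) = A\<^sup>2 * ((s - y) * (s - x) * (f - y) * (f - x))"
      for A x y f s :: real by (simp add: power2_eq_square algebra_simps)
    then show ?thesis unfolding rval_factor[OF assms] by (simp add: resultant_def geod_def)
  qed
  then show ?thesis using A by (simp add: mult_less_0_iff)
qed

lemma mobius_denominator:
  assumes "g \<in> SL2Z" "Im P > 0"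
  shows "of_int (g$2$1) * P + of_int (g$2$2) \<noteq> (0::complex)"
proof
  assume "of_int (g$2$1) * P + of_int (g$2$2) = (0::complex)"
  then have "Re (of_int (g$2$1) * P + of_int (g$2$2)) = 0" "Im (of_int (g$2$1) * P + of_int (g$2$2)) = 0"
    by simp_all
  then show False using assms(2) SL2Z_row2[OF assms(1)] by auto
qed

lemma mobius_difference:
  assumes "g \<in> SL2Z" "of_int (g$2$1) * P + of_int (g$2$2) \<noteq> (0::complex)"
    "of_int (g$2$1) * r + of_int (g$2$2) \<noteq> (0::real)"
  shows "mobius g P - of_real (mobius g r) = (P - of_real r) /
    ((of_int (g$2$1) * P + of_int (g$2$2)) * of_real (of_int (g$2$1) * r + of_int (g$2$2)))"
proof -
  let ?w = "of_int (g$2$1) * P + of_int (g$2$2)" and ?v = "of_int (g$2$1) * of_real r + of_int (g$2$2) :: complex"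
  have v: "?v = of_real (of_int (g$2$1) * r + of_int (g$2$2))" by simp
  then have v0: "?v \<noteq> 0" using assms(3) of_real_eq_0_iff by metis
  have det: "of_int (g$1$1) * of_int (g$2$2) - of_int (g$1$2) * of_int (g$2$1) = (1::complex)"
    using arg_cong[OF assms(1)[unfolded SL2Z_iff], of "of_int :: int \<Rightarrow> complex"] by simp
  have "of_real (mobius g r) = (of_int (g$1$1) * of_real r + of_int (g$1$2)) / ?v"
    by (simp add: mobius_def moebius_def)
  then have "mobius g P - of_real (mobius g r) =
     ((of_int (g$1$1) * P + of_int (g$1$2)) * ?v - (of_int (g$1$1) * of_real r + of_int (g$1$2)) * ?w) / (?w * ?v)"
    using assms(2) v0 by (simp add: mobius_def moebius_def diff_frac_eq)
  also have "(of_int (g$1$1) * P + of_int (g$1$2)) * ?v - (of_int (g$1$1) * of_real r + of_int (g$1$2)) * ?w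
    = (of_int (g$1$1) * of_int (g$2$2) - of_int (g$1$2) * of_int (g$2$1)) * (P - of_real r)"
    by (simp add: algebra_simps)
  finally show ?thesis unfolding det v by simp
qed

text \<open>The point \<open>P\<close> sees its geodesic under a right angle, and the quotients by which \<open>g\<close> changes the
  differences from \<open>P\<close> to the two end points have a real ratio.\<close>

lemma mobius_point:
  assumes g: "g \<in> SL2Z" and p: "indef (discriminant p)" and P: "P \<in> points (geod (act g p))"
  shows "mobius g P \<in> points (geod p)"
proof -
  let ?f = "first_root (act g p)" and ?s = "second_root (act g p)"
  let ?w = "of_int (g$2$1) * P + of_int (g$2$2)"
  have p': "indef (discriminant (act g p))" using p g by simp
  have y: "Im P > 0" and perp: "Re ((P - of_real ?s) * cnj (P - of_real ?f)) = 0"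
    using P by (simp_all add: geod_def points_iff power2_eq_square)
  have w: "?w \<noteq> 0" by (rule mobius_denominator[OF g y])
  have den: "of_int (g$2$1) * ?f + of_int (g$2$2) \<noteq> 0" "of_int (g$2$1) * ?s + of_int (g$2$2) \<noteq> 0"
    using root_denominator[OF p'] SL2Z_row2[OF g] by blast+
  have *: "(a / (w * of_real u)) * cnj (b / (w * of_real v)) = a * cnj b / of_real ((cmod w)\<^sup>2 * u * v)"
    for a b w u v by (simp add: complex_norm_square mult_ac del: of_real_power)
  have "Re ((mobius g P - of_real (second_root p)) * cnj (mobius g P - of_real (first_root p))) = 0"
    unfolding root_act[OF p g, symmetric] mobius_difference[OF g w den(1)] mobius_difference[OF g w den(2)] *
    by (simp only: Re_divide_of_real perp div_0)
  moreover have "Im (mobius g P) > 0"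
  proof -
    have det: "of_int (g$1$1) * of_int (g$2$2) - of_int (g$1$2) * of_int (g$2$1) = (1::real)"
      using arg_cong[OF g[unfolded SL2Z_iff], of "of_int :: int \<Rightarrow> real"] by simp
    have "Im (mobius g P) =
        Im P * (of_int (g$1$1) * of_int (g$2$2) - of_int (g$1$2) * of_int (g$2$1)) / (cmod ?w)\<^sup>2"
      by (simp add: mobius_def moebius_def Im_divide cmod_power2 algebra_simps)
    then show ?thesis using y w unfolding det by simp
  qed
  ultimately show ?thesis by (simp add: geod_def points_iff power2_eq_square)
qed

text \<open>A parameter of the half circle that every automorph multiplies by a constant.\<close>

definition param :: "bqf \<Rightarrow> complex \<Rightarrow> real" where
  "param q P = (cmod (P - of_real (second_root q)))\<^sup>2 / (cmod (P - of_real (first_root q)))\<^sup>2"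

lemma between_roots:
  assumes "P \<in> points (geod q)"
  shows "(Re P - second_root q) * (first_root q - Re P) > 0"
proof -
  have "(Re P - second_root q) * (first_root q - Re P) = (Im P)\<^sup>2" "Im P > 0"
    using assms by (auto simp: geod_def points_iff algebra_simps)
  then show ?thesis by simp
qed

text \<open>In the right triangle over the diameter each leg is the mean proportional between the
  diameter and its own projection, and the diameter cancels.\<close>

lemma param_eq:
  assumes "P \<in> points (geod q)"
  shows "param q P = (Re P - second_root q) / (first_root q - Re P)"
proof -
  let ?s = "second_root q" and ?f = "first_root q"
  have e: "(Re P - ?s) * (Re P - ?f) + (Im P)\<^sup>2 = 0" and y: "Im P > 0"
    using assms by (auto simp: geod_def points_iff)
  have sf: "?f \<noteq> ?s" "?f \<noteq> Re P" using between_roots[OF assms] by (auto simp: mult_less_0_iff zero_less_mult_iff)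
  have "(cmod (P - of_real ?s))\<^sup>2 = (Re P - ?s)\<^sup>2 + (Im P)\<^sup>2" by (simp add: cmod_power2)
  also have "\<dots> = (Re P - ?s) * (?f - ?s)" using e by (simp add: power2_eq_square algebra_simps)
  finally have 1: "(cmod (P - of_real ?s))\<^sup>2 = (Re P - ?s) * (?f - ?s)" .
  have "(cmod (P - of_real ?f))\<^sup>2 = (Re P - ?f)\<^sup>2 + (Im P)\<^sup>2" by (simp add: cmod_power2)
  also have "\<dots> = (?f - Re P) * (?f - ?s)" using e by (simp add: power2_eq_square algebra_simps)
  finally show ?thesis using sf by (simp add: param_def 1)
qed

lemma param_pos: "P \<in> points (geod q) \<Longrightarrow> param q P > 0"
  using between_roots[of P q] by (auto simp: param_eq zero_less_mult_iff zero_less_divide_iff)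

text \<open>The parameter grows from the second root to the first; the factor accounts for either
  order of the roots on the line.\<close>

lemma param_diff:
  assumes "P \<in> points (geod q)" "P' \<in> points (geod q)"
  shows "sgn (param q P' - param q P) = sgn ((first_root q - second_root q) * (Re P' - Re P))"
proof -
  let ?f = "first_root q"
  note b = between_roots[OF assms(1)] between_roots[OF assms(2)]
  have n: "?f - Re P \<noteq> 0" "?f - Re P' \<noteq> 0" and pos: "(?f - Re P) * (?f - Re P') > 0"
    using b by (auto simp: zero_less_mult_iff)
  have "param q P' - param q P =
      (?f - second_root q) * (Re P' - Re P) / ((?f - Re P) * (?f - Re P'))"
    using n by (simp add: param_eq assms field_simps)
  then show ?thesis by (simp only: sgn_divide sgn_pos[OF pos] div_by_1)
qed

lemma param_inj:
  assumes "P \<in> points (geod q)" "P' \<in> points (geod q)" "param q P = param q P'"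
  shows "P = P'"
proof -
  have "first_root q \<noteq> second_root q"
    using between_roots[OF assms(1)] by (auto simp: zero_less_mult_iff)
  then have re: "Re P = Re P'"
    using param_diff[OF assms(1,2)] assms(3) by (simp add: sgn_zero_iff)
  have "(Im P)\<^sup>2 = - ((Re P - second_root q) * (Re P - first_root q))"
    "(Im P')\<^sup>2 = - ((Re P' - second_root q) * (Re P' - first_root q))" "Im P > 0" "Im P' > 0"
    using assms(1,2) unfolding geod_def points_iff by linarith+
  note e = this
  have "(Im P)\<^sup>2 = (Im P')\<^sup>2" unfolding e(1,2) re ..
  then have "Im P = Im P'" by (rule power2_eq_imp_eq) (use e in auto)
  then show ?thesis using re by (simp add: complex_eq_iff)
qed

lemma param_segment:
  assumes P: "P \<in> points (geod q)" and z: "z \<in> points (geod q)" and w: "w \<in> points (geod q)"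
    and less: "param q z < param q w"
  shows "P \<in> half_open_segment (geod q) z w \<longleftrightarrow> param q z \<le> param q P \<and> param q P < param q w"
proof -
  have le: "0 \<le> a \<longleftrightarrow> 0 \<le> b" "0 < a \<longleftrightarrow> 0 < b" if "sgn a = sgn b" for a b :: real
    using that by (auto simp: sgn_if split: if_splits)
  note d = le(1)[OF param_diff[OF z P]] le(1)[OF param_diff[OF P w]] le(2)[OF param_diff[OF z w]]
  have "Re P \<in> closed_segment (Re z) (Re w) \<longleftrightarrow> 0 \<le> param q P - param q z \<and> 0 \<le> param q w - param q P"
    unfolding d(1,2) using d(3) less
    by (cases "first_root q > second_root q")
      (auto simp: closed_segment_eq_real_ivl zero_le_mult_iff zero_less_mult_iff)
  moreover have "P \<noteq> w \<longleftrightarrow> param q P \<noteq> param q w" using param_inj[OF P w] by auto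
  ultimately show ?thesis using P by (auto simp: half_open_segment_def)
qed

section \<open>The multiplier of the automorph\<close>

context automorphic
begin

text \<open>The two denominators are the unit \<open>(t0 + u0 * sqrt D) / 2\<close> and its inverse,
  so this is the fourth power of the unit.\<close>

definition kappa :: real where
  "kappa = ((of_int (\<gamma>$2$1) * first_root q + of_int (\<gamma>$2$2)) /
     (of_int (\<gamma>$2$1) * second_root q + of_int (\<gamma>$2$2)))\<^sup>2"

lemma denominators:
  "2 * (of_int (\<gamma>$2$1) * first_root q + of_int (\<gamma>$2$2)) = of_int t0 + of_int u0 * sqrt (of_int D)"
  "2 * (of_int (\<gamma>$2$1) * second_root q + of_int (\<gamma>$2$2)) = of_int t0 - of_int u0 * sqrt (of_int D)"
proof -
  have c: "of_int (\<gamma>$2$1) = (of_int (coeffA q) * of_int u0 :: real)"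
    using matrix0 by (simp add: pell_matrix_def)
  have "2 * \<gamma>$2$2 = t0 + coeffB q * u0" using matrix0 by (simp add: pell_matrix_def)
  from arg_cong[OF this, of "of_int :: int \<Rightarrow> real"]
  have d: "2 * of_int (\<gamma>$2$2) = (of_int t0 + of_int (coeffB q) * of_int u0 :: real)" by simp
  have "2 * (of_int (\<gamma>$2$1) * r + of_int (\<gamma>$2$2)) = of_int t0 + of_int u0 * (2 * of_int (coeffA q) * r + of_int (coeffB q))" for r :: real
    unfolding distrib_left c d by (simp add: algebra_simps)
  then show "2 * (of_int (\<gamma>$2$1) * first_root q + of_int (\<gamma>$2$2)) = of_int t0 + of_int u0 * sqrt (of_int D)"
    "2 * (of_int (\<gamma>$2$1) * second_root q + of_int (\<gamma>$2$2)) = of_int t0 - of_int u0 * sqrt (of_int D)"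
    unfolding sqrt_disc[OF indef_q, symmetric] using sqrt_disc(2)[OF indef_q] sqrt_disc(1)[OF indef_q] by simp_all
qed

lemma denominators_nonzero:
  "of_int (\<gamma>$2$1) * first_root q + of_int (\<gamma>$2$2) \<noteq> 0"
  "of_int (\<gamma>$2$1) * second_root q + of_int (\<gamma>$2$2) \<noteq> 0"
  using root_denominator[OF indef_q] SL2Z_row2[OF gamma_SL2Z] by blast+

lemma kappa_gt_1: "kappa > 1"
proof -
  let ?f = "of_int (\<gamma>$2$1) * first_root q + of_int (\<gamma>$2$2)"
    and ?s = "of_int (\<gamma>$2$1) * second_root q + of_int (\<gamma>$2$2)"
  have "of_int t0 > (0::real)" "of_int u0 * sqrt (of_int D) > (0::real)"
    using t0 u0 D_pos by simp_all
  moreover have "\<bar>s\<bar> < \<bar>f\<bar>" if "2 * f = a + b" "2 * s = a - b" "0 < a" "0 < b" for a b f s :: real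
    using that by linarith
  ultimately have "\<bar>?s\<bar> < \<bar>?f\<bar>" using denominators by blast
  then have "\<bar>?s\<bar>\<^sup>2 < \<bar>?f\<bar>\<^sup>2" by (intro power_strict_mono) simp_all
  then have "?s\<^sup>2 < ?f\<^sup>2" by (simp only: power2_abs)
  then show ?thesis using denominators_nonzero by (simp add: kappa_def power_divide less_divide_eq)
qed

lemma mobius_root: "mobius \<gamma> (first_root q) = first_root q" "mobius \<gamma> (second_root q) = second_root q"
  using root_act[OF indef_q gamma_SL2Z] by simp_all

lemma gamma_point: "P \<in> points (geod q) \<Longrightarrow> mobius \<gamma> P \<in> points (geod q)"
  using mobius_point[OF gamma_SL2Z indef_q, of P] by simp

lemma param_gamma:
  assumes "P \<in> points (geod q)"
  shows "param q (mobius \<gamma> P) = kappa * param q P"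
proof -
  have w: "of_int (\<gamma>$2$1) * P + of_int (\<gamma>$2$2) \<noteq> 0"
    using mobius_denominator[OF gamma_SL2Z] assms by (simp add: points_def)
  have d: "cmod (mobius \<gamma> P - of_real r) = cmod (P - of_real r) /
      (cmod (of_int (\<gamma>$2$1) * P + of_int (\<gamma>$2$2)) * \<bar>of_int (\<gamma>$2$1) * r + of_int (\<gamma>$2$2)\<bar>)"
    if "mobius \<gamma> r = r" "of_int (\<gamma>$2$1) * r + of_int (\<gamma>$2$2) \<noteq> 0" for r
    using arg_cong[OF mobius_difference[OF gamma_SL2Z w that(2)], of cmod]
    by (simp only: that(1) norm_divide norm_mult norm_of_real)
  show ?thesis
    using w denominators_nonzero
    by (simp add: d mobius_root param_def kappa_def power_divide power_mult_distrib)
qed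

section \<open>Forms whose geodesics cross that of \<open>q\<close>\<close>

definition crosses :: "bqf \<Rightarrow> bool" where
  "crosses p \<longleftrightarrow> indef (discriminant p) \<and> rval p (first_root q) * rval p (second_root q) < 0"

text \<open>Arbitrary unless \<open>crosses p\<close>, where the point is unique.\<close>

definition meet :: "bqf \<Rightarrow> complex" where
  "meet p = (SOME P. transverse_at (geod p) (geod q) P)"

lemma crosses_iff: "indef (discriminant p) \<Longrightarrow> crosses p \<longleftrightarrow> (\<exists>P. transverse_at (geod p) (geod q) P)"
  by (simp add: crosses_def transverse_exists_iff resultant_geod)

lemma meet:
  assumes "crosses p"
  shows "transverse_at (geod p) (geod q) P \<longleftrightarrow> P = meet p"
proof -
  have "transverse_at (geod p) (geod q) (meet p)"
    unfolding meet_def by (rule someI_ex) (use assms crosses_iff crosses_def in blast)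
  then show ?thesis using transverse_unique by blast
qed

lemma meet_points: "crosses p \<Longrightarrow> meet p \<in> points (geod p)" "crosses p \<Longrightarrow> meet p \<in> points (geod q)"
  using meet transverse_iff by blast+

definition place :: "bqf \<Rightarrow> real" where
  "place p = param q (meet p)"

lemma place_pos: "crosses p \<Longrightarrow> place p > 0"
  using param_pos meet_points by (simp add: place_def)

lemma crosses_gamma: "crosses (act \<gamma> p) \<longleftrightarrow> crosses p"
proof -
  have "sgn (rval (act \<gamma> p) (first_root q)) = sgn (rval p (first_root q))"
    "sgn (rval (act \<gamma> p) (second_root q)) = sgn (rval p (second_root q))"
    using rval_root_act[OF indef_q gamma_SL2Z, of p] by simp_all
  moreover have "x * y < 0 \<longleftrightarrow> sgn x * sgn y < 0" for x y :: real by (metis sgn_mult sgn_less)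
  ultimately have "rval (act \<gamma> p) (first_root q) * rval (act \<gamma> p) (second_root q) < 0 \<longleftrightarrow>
    rval p (first_root q) * rval p (second_root q) < 0" by metis
  then show ?thesis by (simp add: crosses_def)
qed

text \<open>Forms are acted on from the right, so \<gamma> maps the geodesic of
  \<open>act \<gamma> p\<close> to that of \<open>p\<close>, and the meeting points with it. Hence
  acting by \<gamma> divides the place by \<open>kappa\<close>.\<close>

lemma place_gamma:
  assumes "crosses (act \<gamma> p)"
  shows "place p = kappa * place (act \<gamma> p)"
proof -
  have p: "crosses p" using assms crosses_gamma by blast
  let ?P = "meet (act \<gamma> p)"
  have "mobius \<gamma> ?P \<in> points (geod p)"
    by (rule mobius_point[OF gamma_SL2Z]) (use p assms meet_points in \<open>auto simp: crosses_def\<close>)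
  moreover have "mobius \<gamma> ?P \<in> points (geod q)" using gamma_point meet_points assms by blast
  moreover have "centre (geod p) \<noteq> centre (geod q)" using meet[OF p, of "meet p"] by (simp add: transverse_iff)
  ultimately have "mobius \<gamma> ?P = meet p" using meet[OF p, of "mobius \<gamma> ?P"] by (simp add: transverse_iff)
  then show ?thesis using param_gamma[OF meet_points(2)[OF assms]] by (simp add: place_def)
qed

lemma crosses_iterate: "crosses (iterate (act \<gamma>) k p) \<longleftrightarrow> crosses p"
proof -
  have inv: "crosses (inv (act \<gamma>) p) \<longleftrightarrow> crosses p" for p
    using crosses_gamma[of "inv (act \<gamma>) p"] bij_act[OF gamma_SL2Z]
    by (simp add: bij_is_surj surj_f_inv_f)
  have "\<forall>p. crosses (iterate (act \<gamma>) k p) \<longleftrightarrow> crosses p"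
    by (rule iterate_closed[where P = "\<lambda>f. \<forall>p. crosses (f p) \<longleftrightarrow> crosses p"])
      (simp_all add: inv crosses_gamma)
  then show ?thesis by blast
qed

lemma place_iterate:
  assumes "crosses p"
  shows "place p = kappa powr (of_int k) * place (iterate (act \<gamma>) k p)"
proof -
  have step: "place (iterate (act \<gamma>) k p) = kappa * place (iterate (act \<gamma>) (k + 1) p)" for k
    unfolding iterate_step(1)[OF bij_act[OF gamma_SL2Z]] o_apply
    using assms crosses_iterate crosses_gamma place_gamma by blast
  show ?thesis
  proof (induction k rule: int_induct[of _ 0])
    case (step1 i)
    then show ?case using step[of i] kappa_gt_1 by (simp add: powr_add)
  next
    case (step2 i)
    then show ?case using step[of "i - 1"] kappa_gt_1 by (simp add: powr_diff)
  qed (use kappa_gt_1 in simp)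
qed

text \<open>The segment of the intersection number is a fundamental domain for the automorphs.\<close>

lemma fundamental_domain:
  assumes "x0 > 0" "crosses p"
  shows "\<exists>!k. x0 \<le> place (iterate (act \<gamma>) k p) \<and> place (iterate (act \<gamma>) k p) < kappa * x0"
proof -
  have pos: "place p > 0" using place_pos assms by blast
  \<comment> \<open>The \<open>k\<close>-th iterate divides the place by the \<open>k\<close>-th
    power of \<open>kappa\<close>, so the exponent is the integer part of a logarithm.\<close>
  have eq: "x0 \<le> place (iterate (act \<gamma>) k p) \<and> place (iterate (act \<gamma>) k p) < kappa * x0 \<longleftrightarrow>
      k = \<lfloor>log kappa (place p / x0)\<rfloor>" for k
  proof -
    let ?y = "place (iterate (act \<gamma>) k p)"
    have y: "?y > 0" using place_pos assms crosses_iterate by blast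
    have "place p / x0 = kappa powr (of_int k) * (?y / x0)" using place_iterate[OF assms(2), of k] by simp
    then have "log kappa (place p / x0) = of_int k + log kappa (?y / x0)"
      using kappa_gt_1 y assms(1) log_mult_pos[of "kappa powr of_int k" "?y / x0" kappa]
      by (simp del: times_divide_eq_right)
    then have "k = \<lfloor>log kappa (place p / x0)\<rfloor> \<longleftrightarrow> 0 \<le> log kappa (?y / x0) \<and> log kappa (?y / x0) < 1"
      by linarith
    also have "\<dots> \<longleftrightarrow> 1 \<le> ?y / x0 \<and> ?y / x0 < kappa"
      using kappa_gt_1 y assms(1) by (simp add: zero_le_log_cancel_iff log_less_one_cancel_iff)
    also have "\<dots> \<longleftrightarrow> x0 \<le> ?y \<and> ?y < kappa * x0" using assms(1) by (simp add: field_simps)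
    finally show ?thesis by blast
  qed
  show ?thesis unfolding eq by simp
qed

end

section \<open>Translates of a geodesic and forms of an orbit\<close>

definition orbit :: "bqf \<Rightarrow> bqf set" where
  "orbit q = {act g q |g. g \<in> SL2Z}"

lemma orbit_act: "p \<in> orbit q \<Longrightarrow> g \<in> SL2Z \<Longrightarrow> act g p \<in> orbit q"
  unfolding orbit_def using act_mult matmul_SL2Z by (smt (verit, best) mem_Collect_eq)

lemma orbit_discriminant: "p \<in> orbit q \<Longrightarrow> discriminant p = discriminant q"
  by (auto simp: orbit_def)

text \<open>The translate by \<open>g\<close> belongs to the form acted on by the inverse of
  \<open>g\<close>.\<close>

lemma translates_geod:
  assumes "indef (discriminant q)"
  shows "translates (geod q) = geod ` orbit q"
proof -
  have *: "(mobius g (fst (geod q)), mobius g (snd (geod q))) = geod (act (sinv g) q)" if "g \<in> SL2Z" for g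
    using root_act[of "act (sinv g) q" g] assms that by (simp add: geod_def)
  have "translates (geod q) = (\<lambda>g. (mobius g (fst (geod q)), mobius g (snd (geod q)))) ` SL2Z"
    by (auto simp: translates_def)
  also have "\<dots> = (\<lambda>g. geod (act (sinv g) q)) ` SL2Z" by (intro image_cong refl *)
  also have "\<dots> = (\<lambda>g. geod (act g q)) ` sinv ` SL2Z" by (simp add: image_image)
  also have "sinv ` SL2Z = SL2Z"
  proof -
    have "sinv (sinv g) = g" for g by (intro mat2_eqI) (simp_all add: sinv_def)
    then show ?thesis by (metis image_eqI image_subsetI sinv_SL2Z subsetI subset_antisym)
  qed
  finally show ?thesis by (auto simp: orbit_def)
qed

lemma kernel_classes:
  assumes r: "r = {(x, y). x \<in> A \<and> y \<in> A \<and> h x = h y}"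
  shows "bij_betw (\<lambda>c. the_elem (h ` c)) (A // r) (h ` A)"
proof -
  have c: "r `` {x} = {y \<in> A. h y = h x}" if "x \<in> A" for x using that r by auto
  have t: "the_elem (h ` (r `` {x})) = h x" if "x \<in> A" for x
  proof -
    have "h ` (r `` {x}) = {h x}" using c[OF that] that by auto
    then show ?thesis by simp
  qed
  have q: "A // r = (\<lambda>x. r `` {x}) ` A" by (auto simp: quotient_def)
  show ?thesis
    unfolding bij_betw_def
  proof
    show "inj_on (\<lambda>c. the_elem (h ` c)) (A // r)"
      unfolding q by (rule inj_onI) (use t c in auto)
    show "(\<lambda>c. the_elem (h ` c)) ` (A // r) = h ` A" unfolding q image_image using t by auto
  qed
qed

context automorphic
begin

text \<open>The discriminant is fixed on an orbit, so an oriented geodesic belongs to one form only,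
  and when it crosses that of \<open>q\<close> it does so in one point. Counting pairs is therefore
  counting forms.\<close>

lemma intersections_bij:
  assumes q1: "indef (discriminant q1)" and z: "z \<in> points (geod q)"
  defines "X \<equiv> {p \<in> orbit q1. crosses p \<and> param q z \<le> place p \<and> place p < kappa * param q z}"
  shows "bij_betw (\<lambda>p. (geod p, meet p)) X (intersections q1 q z)"
  unfolding bij_betw_def
proof
  have ind: "indef (discriminant p)" if "p \<in> orbit q1" for p using that q1 orbit_discriminant by simp
  show "inj_on (\<lambda>p. (geod p, meet p)) X"
  proof (rule inj_onI)
    fix p p' assume "p \<in> X" "p' \<in> X" "(geod p, meet p) = (geod p', meet p')"
    then show "p = p'" using ind orbit_discriminant
      by (intro roots_inj) (auto simp: X_def geod_def)
  qed
  have less: "param q z < param q (mobius \<gamma> z)"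
    using param_gamma[OF z] kappa_gt_1 param_pos[OF z] by simp
  note seg = param_segment[OF _ z gamma_point[OF z] less, unfolded param_gamma[OF z]]
  have mem: "(geod p, P) \<in> intersections q1 q z \<longleftrightarrow> p \<in> X \<and> P = meet p" if p: "p \<in> orbit q1" for p P
  proof (cases "crosses p")
    case True
    have "geod p \<in> translates (geod q1)" using p translates_geod[OF q1] by blast
    then have "(geod p, P) \<in> intersections q1 q z \<longleftrightarrow>
        P = meet p \<and> meet p \<in> half_open_segment (geod q) z (mobius \<gamma> z)"
      using meet[OF True, of P] by (auto simp: intersections_def)
    then show ?thesis using seg[OF meet_points(2)[OF True]] True p by (auto simp: X_def place_def)
  next
    case False
    then have "\<not> transverse_at (geod p) (geod q) P" using crosses_iff[OF ind[OF p]] by blast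
    then show ?thesis using False by (auto simp: intersections_def X_def)
  qed
  show "(\<lambda>p. (geod p, meet p)) ` X = intersections q1 q z"
  proof
    show "(\<lambda>p. (geod p, meet p)) ` X \<subseteq> intersections q1 q z" using mem by (auto simp: X_def)
    show "intersections q1 q z \<subseteq> (\<lambda>p. (geod p, meet p)) ` X"
    proof
      fix x assume x: "x \<in> intersections q1 q z"
      obtain l P where lP: "x = (l, P)" by fastforce
      then have "l \<in> translates (geod q1)" using x by (simp add: intersections_def)
      then obtain p where "p \<in> orbit q1" "l = geod p" using translates_geod[OF q1] by blast
      then show "x \<in> (\<lambda>p. (geod p, meet p)) ` X" using mem[of p P] x lP by auto
    qed
  qed
qed

section \<open>Representatives modulo the automorph\<close>

abbreviation "\<gamma>pow \<equiv> iterate (act \<gamma>)"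

lemma pow_add: "\<gamma>pow a (\<gamma>pow b p) = \<gamma>pow (a + b) p"
  using iterate_add[OF bij_act[OF gamma_SL2Z], of a b] by (simp add: fun_eq_iff)

text \<open>For a crossing form and positive \<open>x\<close> the exponent is unique by
  \<open>fundamental_domain\<close>; in other cases \<open>THE\<close> yields some integer, and the
  result is still an iterate applied to \<open>p\<close>.\<close>

definition rep :: "real \<Rightarrow> bqf \<Rightarrow> bqf" where
  "rep x p = \<gamma>pow (THE k. x \<le> place (\<gamma>pow k p) \<and> place (\<gamma>pow k p) < kappa * x) p"

context
  fixes x :: real
  assumes x: "x > 0"
begin

lemma rep_in_domain:
  assumes "crosses p"
  shows "x \<le> place (rep x p) \<and> place (rep x p) < kappa * x"
  unfolding rep_def by (rule theI'[OF fundamental_domain[OF x assms]])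

lemma rep_eq:
  assumes "crosses p" "x \<le> place (\<gamma>pow k p) \<and> place (\<gamma>pow k p) < kappa * x"
  shows "rep x p = \<gamma>pow k p"
  unfolding rep_def using the1_equality[OF fundamental_domain[OF x assms(1)] assms(2)] by simp

lemma rep_power: "\<exists>k. rep x p = \<gamma>pow k p"
  by (auto simp: rep_def)

lemma rep_eq_iff:
  assumes "crosses p" "crosses p'"
  shows "rep x p = rep x p' \<longleftrightarrow> (\<exists>k. p' = \<gamma>pow k p)"
proof
  assume eq: "rep x p = rep x p'"
  obtain a b where ab: "rep x p = \<gamma>pow a p" "rep x p' = \<gamma>pow b p'" using rep_power by metis
  then have "\<gamma>pow (- b) (\<gamma>pow a p) = \<gamma>pow (- b) (\<gamma>pow b p')" using eq by simp
  then have "p' = \<gamma>pow (- b + a) p" by (simp add: pow_add)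
  then show "\<exists>k. p' = \<gamma>pow k p" by blast
next
  assume "\<exists>k. p' = \<gamma>pow k p"
  then obtain k where k: "p' = \<gamma>pow k p" by blast
  obtain a where a: "rep x p = \<gamma>pow a p" using rep_power by blast
  have "\<gamma>pow (a - k) p' = \<gamma>pow a p" by (simp add: k pow_add)
  then have "rep x p' = \<gamma>pow (a - k) p'"
    using rep_in_domain[OF assms(1)] a by (intro rep_eq[OF assms(2)]) simp
  then show "rep x p = rep x p'" using a \<open>\<gamma>pow (a - k) p' = \<gamma>pow a p\<close> by simp
qed

lemma rep_crosses: "crosses p \<Longrightarrow> crosses (rep x p)"
  using rep_power crosses_iterate by metis

lemma rep_orbit: "p \<in> orbit q' \<Longrightarrow> rep x p \<in> orbit q'"
  using rep_power iterate_stabiliser orbit_act by metis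

lemma rep_id: "crosses p \<Longrightarrow> x \<le> place p \<Longrightarrow> place p < kappa * x \<Longrightarrow> rep x p = p"
  using rep_eq[of p 0] by simp

end

end

section \<open>Counting\<close>

lemma topograph_topo:
  assumes "pibqf q" "topograph_of q T"
  shows "topo T"
proof -
  have tree: "plane_cubic_tree T" and lab: "labelling T (form_at T)"
    using assms(2) by (auto simp: topograph_of_def labelling_def)
  interpret plane_tree T by unfold_locales (rule tree)
  obtain e0 where e0: "e0 \<in> E" "form_at T e0 = q" using assms(2) by (auto simp: topograph_of_def)
  show ?thesis
  proof
    show "indef (discriminant (form_at T e))" if "e \<in> E" for e
      using labelling_discriminant[OF lab e0(1) that] e0(2) pibqf_indef[OF assms(1)] by simp
  qed (rule lab)
qed

text \<open>Solvability of the Pell equation comes from the river: the matrix of one period,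
  conjugated to the base edge, stabilises \<open>q\<close>.\<close>

lemma (in topo) automorphic_exists:
  assumes q: "pibqf q" and e0: "e0 \<in> E" "form_at T e0 = q"
  shows "\<exists>t u. automorphic q t u"
proof -
  obtain y where y: "y \<in> flow" using flow_exists by blast
  define g where "g = path_matrix N y"
  obtain h where h: "transport T e0 h y" using transport_exists[OF e0(1) flow_edge[OF y]] by blast
  have SL: "g \<in> SL2Z" "h \<in> SL2Z" using transport_SL2Z[OF h] by (auto simp: g_def)
  have y': "form_at T y = act h q" using transportD[OF h lab] e0(2) by simp
  have "form_at T ((ds ^^ N) y) = form_at T y" using turn_period_form river_period y by blast
  then have "act g (act h q) = act h q"
    using transportD[OF path_matrix_transport[OF y] lab, of N] y' g_def by simp
  then have "act (h ** g ** sinv h) q = q" using SL by (simp add: act_mult)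
  then obtain t u where p: "pell (discriminant q) t u" "pell_matrix q t u (h ** g ** sinv h)"
    using stabiliser_pell[OF q] SL by (metis matmul_SL2Z sinv_SL2Z)
  \<comment> \<open>With \<open>u = 0\<close> the matrix would be scalar, and conjugating back would
    leave the period matrix without entries off the diagonal.\<close>
  have "u \<noteq> 0"
  proof
    assume "u = 0"
    have "h ** g ** sinv h = mat2 ((h ** g ** sinv h)$1$1) 0 0 ((h ** g ** sinv h)$1$1)"
      using p(2) \<open>u = 0\<close> by (intro mat2_eqI) (auto simp: pell_matrix_def simp del: matmul_nth)
    then obtain k where k: "h ** g ** sinv h = mat2 k 0 0 k" by blast
    have "sinv h ** (h ** g ** sinv h) ** h = (sinv h ** h) ** g ** (sinv h ** h)"
      by (simp only: matrix_mul_assoc)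
    then have "g = sinv h ** mat2 k 0 0 k ** h" using SL(2) unfolding k by simp
    moreover have "(sinv h ** mat2 k 0 0 k ** h)$1$2 = 0" "(sinv h ** mat2 k 0 0 k ** h)$2$1 = 0"
      by (simp_all add: sinv_def algebra_simps)
    ultimately have "g$1$2 = 0" "g$2$1 = 0" by metis+
    then show False using path_matrix_not_one[of N y] river_period g_def by simp
  qed
  then show ?thesis using automorphic_intro[OF q p(1)] by blast
qed

lemma finite_image_factor:
  assumes "finite (f ` A)" "\<And>x y. x \<in> A \<Longrightarrow> y \<in> A \<Longrightarrow> f x = f y \<Longrightarrow> h x = h y"
  shows "finite (h ` A)"
proof -
  have "h ` A \<subseteq> (\<lambda>v. h (inv_into A f v)) ` f ` A"
  proof
    fix v assume "v \<in> h ` A"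
    then obtain a where a: "a \<in> A" "v = h a" by blast
    then have "v = h (inv_into A f (f a))"
      using assms(2)[OF a(1) inv_into_into[of "f a" f A]] f_inv_into_f[of "f a" f A] by simp
    then show "v \<in> (\<lambda>v. h (inv_into A f v)) ` f ` A" using a(1) by blast
  qed
  then show ?thesis by (rule finite_subset) (use assms(1) in simp)
qed

text \<open>Finiteness is claimed together with the equality because \<open>card\<close> assigns 0
  to infinite sets.\<close>

theorem theorem5:
  fixes q1 q2 :: bqf and T1 :: "'v topograph" and T2 :: "'w topograph" and z :: complex
  assumes "pibqf q1" and "pibqf q2"
    and "topograph_of q1 T1" and "topograph_of q2 T2"
    and "z \<in> points (geod q2)"
  shows "finite (intersections q1 q2 z) \<and> finite (crossing_classes T1 T2) \<and>
    intersection_number q1 q2 z = card (crossing_classes T1 T2)"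
proof -
  interpret T1: topo T1 using assms topograph_topo by blast
  interpret T2: topo T2 using assms topograph_topo by blast
  obtain e1 where e1: "e1 \<in> T1.E" "form_at T1 e1 = q1" using assms(3) by (auto simp: topograph_of_def)
  obtain e2 where e2: "e2 \<in> T2.E" "form_at T2 e2 = q2" using assms(4) by (auto simp: topograph_of_def)
  obtain t u where "automorphic q2 t u" using T2.automorphic_exists[OF assms(2) e2] by blast
  then interpret A: automorphic q2 t u .
  have ind: "indef (discriminant p)" if "p \<in> orbit q1" for p
    using that orbit_discriminant pibqf_indef[OF assms(1)] by simp
  define CS where "CS = crossing_superimpositions T1 T2"
  define Q where "Q = (\<lambda>\<phi>. form_at T1 (map_prod \<phi> \<phi> e2))"
  have Q_orbit: "Q \<phi> \<in> orbit q1" if iso: "plane_iso T2 T1 \<phi>" for \<phi>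
  proof -
    have "map_prod \<phi> \<phi> e2 \<in> T1.E" using plane_iso_edge[OF iso, of e2] e2(1) by blast
    then obtain g where g: "transport T1 e1 g (map_prod \<phi> \<phi> e2)" using T1.transport_exists[OF e1(1)] by blast
    have "Q \<phi> = act g q1" unfolding Q_def using transportD[OF g T1.lab] e1(2) by simp
    then show ?thesis using transport_SL2Z[OF g] by (auto simp: orbit_def)
  qed
  have CS_iff: "\<phi> \<in> CS \<longleftrightarrow> plane_iso T2 T1 \<phi> \<and> A.crosses (Q \<phi>)" for \<phi>
  proof (cases "plane_iso T2 T1 \<phi>")
    case True
    then show ?thesis
      using rivers_cross_iff[OF T1.topo_axioms T2.topo_axioms True e2(1)] ind[OF Q_orbit[OF True]]
      by (simp add: CS_def crossing_superimpositions_def A.crosses_def Q_def e2(2))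
  qed (simp add: CS_def crossing_superimpositions_def)
  have surj: "\<exists>\<phi>. plane_iso T2 T1 \<phi> \<and> Q \<phi> = p" if p: "p \<in> orbit q1" for p
  proof -
    obtain g where g: "g \<in> SL2Z" "p = act g q1" using p by (auto simp: orbit_def)
    obtain e where e: "transport T1 e1 g e" using T1.transport_target[OF g(1) e1(1)] by blast
    then have "e \<in> T1.E" by (simp add: transport_def)
    then obtain \<phi> where "plane_iso T2 T1 \<phi>" "map_prod \<phi> \<phi> e2 = e"
      using plane_iso_exists[OF T2.tree T1.tree e2(1)] by blast
    moreover have "form_at T1 e = p" using transportD[OF e T1.lab] e1(2) g(2) by simp
    ultimately show ?thesis by (auto simp: Q_def)
  qed
  have pull: "form_at T1 (map_prod \<phi> \<phi> e) = act g (form_at T1 (map_prod \<phi> \<phi> e2))"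
    if "plane_iso T2 T1 \<phi>" "transport T2 e2 g e" for \<phi> g e
    using transportD[OF that(2) T2.labelling_pullback[OF that(1) T1.lab]] by simp
  have iso_shift: "plane_iso T2 T1 (iterate (river_shift T1) a \<circ> \<phi> \<circ> iterate (river_shift T2) b)"
    if "plane_iso T2 T1 \<phi>" for \<phi> a b
    by (rule plane_iso_comp[OF conjunct1[OF T2.form_auto_iterate[unfolded T2.form_auto_def]]
          plane_iso_comp[OF that conjunct1[OF T1.form_auto_iterate[unfolded T1.form_auto_def]]]])
  \<comment> \<open>Shifting \<open>T1\<close> keeps its forms and leaves \<open>Q\<close> alone.
    Shifting \<open>T2\<close> moves the base edge to another one bearing \<open>q2\<close>, which
    changes \<open>Q\<close> by a matrix of the stabiliser.\<close>
  have equiv: "(\<exists>a b. \<psi> = iterate (river_shift T1) a \<circ> \<phi> \<circ> iterate (river_shift T2) b) \<longleftrightarrow>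
      (\<exists>k. Q \<psi> = A.\<gamma>pow k (Q \<phi>))" if \<phi>: "plane_iso T2 T1 \<phi>" and \<psi>: "plane_iso T2 T1 \<psi>" for \<phi> \<psi>
  proof
    assume "\<exists>a b. \<psi> = iterate (river_shift T1) a \<circ> \<phi> \<circ> iterate (river_shift T2) b"
    then obtain a b where ab: "\<psi> = iterate (river_shift T1) a \<circ> \<phi> \<circ> iterate (river_shift T2) b" by blast
    let ?e = "map_prod (iterate (river_shift T2) b) (iterate (river_shift T2) b) e2"
    have e: "?e \<in> T2.E" "form_at T2 ?e = q2"
      using T2.form_auto_edge[OF T2.form_auto_iterate, of b e2] T2.form_auto_iterate[of b] e2
      by (auto simp: T2.form_auto_def)
    then obtain g where g: "transport T2 e2 g ?e" using T2.transport_exists[OF e2(1)] by blast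
    have "act g q2 = q2" using transportD[OF g T2.lab] e(2) e2(2) by simp
    then obtain k where k: "act g = A.\<gamma>pow k" using A.stabiliser_iterate transport_SL2Z[OF g] by blast
    have "map_prod \<phi> \<phi> ?e \<in> T1.E" using plane_iso_edge[OF \<phi>, of ?e] e(1) by blast
    then have "Q \<psi> = form_at T1 (map_prod \<phi> \<phi> ?e)"
      using T1.form_auto_iterate[of a] unfolding Q_def ab map_prod_comp T1.form_auto_def by blast
    then show "\<exists>k. Q \<psi> = A.\<gamma>pow k (Q \<phi>)" using pull[OF \<phi> g] k Q_def by auto
  next
    assume "\<exists>k. Q \<psi> = A.\<gamma>pow k (Q \<phi>)"
    then obtain g where g: "g \<in> SL2Z" "act g q2 = q2" "Q \<psi> = act g (Q \<phi>)"
      using A.iterate_stabiliser by metis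
    obtain e where e: "transport T2 e2 g e" using T2.transport_target[OF g(1) e2(1)] by blast
    then have eE: "e \<in> T2.E" by (simp add: transport_def)
    have "form_at T2 e2 = form_at T2 e" using transportD[OF e T2.lab] g(2) e2(2) by simp
    then obtain b where b: "e = map_prod (iterate (river_shift T2) b) (iterate (river_shift T2) b) e2"
      using T2.same_form_iff[OF e2(1) eE] by blast
    have "form_at T1 (map_prod \<phi> \<phi> e) = form_at T1 (map_prod \<psi> \<psi> e2)"
      using pull[OF \<phi> e] g(3) by (simp add: Q_def)
    moreover have "map_prod \<phi> \<phi> e \<in> T1.E" "map_prod \<psi> \<psi> e2 \<in> T1.E"
      using plane_iso_edge[OF \<phi>, of e] plane_iso_edge[OF \<psi>, of e2] eE e2(1) by blast+
    ultimately obtain a where a: "map_prod \<psi> \<psi> e2 =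
        map_prod (iterate (river_shift T1) a) (iterate (river_shift T1) a) (map_prod \<phi> \<phi> e)"
      using T1.same_form_iff by blast
    have "\<psi> = iterate (river_shift T1) a \<circ> \<phi> \<circ> iterate (river_shift T2) b"
      by (rule T2.plane_iso_unique[OF \<psi> iso_shift[OF \<phi>] e2(1)]) (simp only: map_prod_comp a b)
    then show "\<exists>a b. \<psi> = iterate (river_shift T1) a \<circ> \<phi> \<circ> iterate (river_shift T2) b" by blast
  qed
  define x where "x = param q2 z"
  have x: "x > 0" using param_pos[OF assms(5)] by (simp add: x_def)
  \<comment> \<open>A complete invariant of the class, with values in the forms counted by
    \<open>intersections_bij\<close>.\<close>
  define h where "h = (\<lambda>\<phi>. A.rep x (Q \<phi>))"
  define X where "X = {p \<in> orbit q1. A.crosses p \<and> x \<le> A.place p \<and> A.place p < A.kappa * x}"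
  have r: "period_equiv T1 T2 = {(\<phi>, \<psi>). \<phi> \<in> CS \<and> \<psi> \<in> CS \<and> h \<phi> = h \<psi>}"
  proof -
    have "(\<exists>a b. \<psi> = iterate (river_shift T1) a \<circ> \<phi> \<circ> iterate (river_shift T2) b) \<longleftrightarrow> h \<phi> = h \<psi>"
      if "\<phi> \<in> CS" "\<psi> \<in> CS" for \<phi> \<psi>
      using equiv[of \<phi> \<psi>] A.rep_eq_iff[OF x, of "Q \<phi>" "Q \<psi>"] that CS_iff unfolding h_def by blast
    then show ?thesis unfolding period_equiv_def CS_def[symmetric] by blast
  qed
  have hX: "h ` CS = X"
  proof
    show "h ` CS \<subseteq> X"
      using A.rep_in_domain[OF x] A.rep_crosses[OF x] A.rep_orbit[OF x] Q_orbit CS_iff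
      by (auto simp: h_def X_def)
    show "X \<subseteq> h ` CS"
    proof
      fix p assume p: "p \<in> X"
      then obtain \<phi> where \<phi>: "plane_iso T2 T1 \<phi>" "Q \<phi> = p" using surj by (auto simp: X_def)
      then have "\<phi> \<in> CS" "h \<phi> = p" using p CS_iff A.rep_id[OF x] by (auto simp: X_def h_def)
      then show "p \<in> h ` CS" by blast
    qed
  qed
  have b1: "bij_betw (\<lambda>c. the_elem (h ` c)) (crossing_classes T1 T2) X"
    using kernel_classes[OF r] unfolding hX unfolding crossing_classes_def CS_def .
  have b2: "bij_betw (\<lambda>p. (geod p, A.meet p)) X (intersections q1 q2 z)"
    using A.intersections_bij[OF pibqf_indef[OF assms(1)] assms(5)] unfolding X_def x_def .
  \<comment> \<open>The forms on a shared edge of the rivers determine the class: superimpositions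
    with equal pairs of forms differ by shifts of both trees, and finitely many pairs occur.\<close>
  have "finite X"
  proof -
    have "\<forall>\<phi>\<in>CS. \<exists>e. e \<in> river_flow T2 \<and> map_prod \<phi> \<phi> e \<in> river T1"
      using cross_shared_edge[OF T1.topo_axioms T2.topo_axioms]
      unfolding CS_def crossing_superimpositions_def by blast
    then obtain s where s: "\<And>\<phi>. \<phi> \<in> CS \<Longrightarrow> s \<phi> \<in> river_flow T2 \<and> map_prod \<phi> \<phi> (s \<phi>) \<in> river T1"
      by metis
    have "finite (h ` CS)"
    proof (rule finite_image_factor)
      let ?f = "\<lambda>\<phi>. (form_at T1 (map_prod \<phi> \<phi> (s \<phi>)), form_at T2 (s \<phi>))"
      have "?f ` CS \<subseteq> (form_at T1 ` river T1) \<times> (form_at T2 ` river_flow T2)" using s by auto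
      then show "finite (?f ` CS)"
        by (rule finite_subset) (simp add: T1.river_forms_finite T2.flow_forms_finite)
      fix \<phi> \<psi> assume c: "\<phi> \<in> CS" "\<psi> \<in> CS" and eq: "?f \<phi> = ?f \<psi>"
      have iso: "plane_iso T2 T1 \<phi>" "plane_iso T2 T1 \<psi>" using c CS_iff by auto
      have E2: "s \<phi> \<in> T2.E" "s \<psi> \<in> T2.E" using s c T2.flow_edge by auto
      then have E1: "map_prod \<phi> \<phi> (s \<phi>) \<in> T1.E" "map_prod \<psi> \<psi> (s \<psi>) \<in> T1.E"
        using plane_iso_edge[OF iso(1), of "s \<phi>"] plane_iso_edge[OF iso(2), of "s \<psi>"] by blast+
      obtain b where b: "s \<phi> = map_prod (iterate (river_shift T2) b) (iterate (river_shift T2) b) (s \<psi>)"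
        using T2.same_form_iff[OF E2(2,1)] eq by auto
      obtain a where a: "map_prod \<psi> \<psi> (s \<psi>) =
          map_prod (iterate (river_shift T1) a) (iterate (river_shift T1) a) (map_prod \<phi> \<phi> (s \<phi>))"
        using T1.same_form_iff[OF E1] eq by auto
      have "\<psi> = iterate (river_shift T1) a \<circ> \<phi> \<circ> iterate (river_shift T2) b"
        by (rule T2.plane_iso_unique[OF iso(2) iso_shift[OF iso(1)] E2(2)])
          (simp only: map_prod_comp a b[symmetric])
      then have "(\<phi>, \<psi>) \<in> period_equiv T1 T2"
        using c unfolding period_equiv_def CS_def by blast
      then show "h \<phi> = h \<psi>" unfolding r by blast
    qed
    then show ?thesis by (simp add: hX)
  qed
  then show ?thesis
    using bij_betw_finite[OF b1] bij_betw_finite[OF b2] bij_betw_same_card[OF b1] bij_betw_same_card[OF b2]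
    by (simp add: intersection_number_def)
qed

end
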